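(* Let $\mathcal{C}$ be a pointed simplicial cofibrantly generated model category, or a left Bousfield localization of one, and let $S$ be a finite set. For every object $X$ of $\mathcal{C}$, the functors $\mathcal{P}(S)\times\mathcal{P}(S)\to\mathcal{C}$ given by $$(U,V)\mapsto\mathcal{X}_{\mathcal{X}_X(U)}(V)\qquad\text{and}\qquad(U,V)\mapsto\mathcal{X}_{\mathcal{X}_X(V)}(U)$$ are naturally isomorphic. Furthermore, this natural isomorphism is also natural in $X$.
   Context: A pointed simplicial model category is tensored over pointed simplicial sets, with tensor denoted $\wedge$ (for a left Bousfield localization, use the tensoring of the underlying pointed simplicial category). For $X\in\mathcal{C}$, $C(X)=X\wedge(\Delta^1,\{0\})$ and $c_X\colon X\to C(X)$ is the map induced by the inclusion $(\{0,1\},\{0\})\to(\Delta^1,\{0\})$. $\mathcal{P}(S)$ is the poset of subsets of $S$ and $\mathcal{P}_{\le1}(S)$ the subposet of subsets of cardinality at most $1$. $\mathcal{X}_X\colon\mathcal{P}(S)\to\mathcal{C}$ denotes the left Kan extension along $\mathcal{P}_{\le1}(S)\subset\mathcal{P}(S)$ of the diagram whose value at $\emptyset$ is $X$, whose value at each singleton is $C(X)$, and all of whose maps $X\to C(X)$ are $c_X$; it is functorial in $X$. *)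

theory Defs
  imports Main "HOL-Library.FuncSet"
begin

section \<open>Categories, functors, natural transformations\<close>

record ('o, 'a) cat =
  Ob :: "'o set"
  Ar :: "'a set"
  Dom :: "'a \<Rightarrow> 'o"
  Cod :: "'a \<Rightarrow> 'o"
  Idn :: "'o \<Rightarrow> 'a"
  Comp :: "'a \<Rightarrow> 'a \<Rightarrow> 'a"   \<comment> \<open>\<open>Comp C g f\<close> is \<open>g\<close> after \<open>f\<close>\<close>

definition hom :: "('o, 'a) cat \<Rightarrow> 'o \<Rightarrow> 'o \<Rightarrow> 'a set" where
  "hom C X Y = {f \<in> Ar C. Dom C f = X \<and> Cod C f = Y}"

locale category =
  fixes C :: "('o, 'a) cat"
  assumes dom_in: "f \<in> Ar C \<Longrightarrow> Dom C f \<in> Ob C"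
    and cod_in: "f \<in> Ar C \<Longrightarrow> Cod C f \<in> Ob C"
    and idn_in: "X \<in> Ob C \<Longrightarrow> Idn C X \<in> hom C X X"
    and comp_in: "f \<in> hom C X Y \<Longrightarrow> g \<in> hom C Y Z \<Longrightarrow> Comp C g f \<in> hom C X Z"
    and idn_left: "f \<in> hom C X Y \<Longrightarrow> Comp C (Idn C Y) f = f"
    and idn_right: "f \<in> hom C X Y \<Longrightarrow> Comp C f (Idn C X) = f"
    and comp_assoc: "f \<in> hom C W X \<Longrightarrow> g \<in> hom C X Y \<Longrightarrow> h \<in> hom C Y Z \<Longrightarrow>
      Comp C h (Comp C g f) = Comp C (Comp C h g) f"

definition is_iso :: "('o, 'a) cat \<Rightarrow> 'a \<Rightarrow> bool" where
  "is_iso C f \<longleftrightarrow> f \<in> Ar C \<and>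
     (\<exists>g \<in> hom C (Cod C f) (Dom C f).
        Comp C g f = Idn C (Dom C f) \<and> Comp C f g = Idn C (Cod C f))"

record ('o, 'a, 'p, 'b) fctr =
  onOb :: "'o \<Rightarrow> 'p"
  onAr :: "'a \<Rightarrow> 'b"

locale is_functor = A: category A + B: category B
  for A :: "('o, 'a) cat" and B :: "('p, 'b) cat" +
  fixes F :: "('o, 'a, 'p, 'b) fctr"
  assumes ob_in: "X \<in> Ob A \<Longrightarrow> onOb F X \<in> Ob B"
    and ar_in: "f \<in> hom A X Y \<Longrightarrow> onAr F f \<in> hom B (onOb F X) (onOb F Y)"
    and pres_idn: "X \<in> Ob A \<Longrightarrow> onAr F (Idn A X) = Idn B (onOb F X)"
    and pres_comp: "f \<in> hom A X Y \<Longrightarrow> g \<in> hom A Y Z \<Longrightarrow>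
      onAr F (Comp A g f) = Comp B (onAr F g) (onAr F f)"

definition comp_fctr :: "('p, 'b, 'q, 'c) fctr \<Rightarrow> ('o, 'a, 'p, 'b) fctr \<Rightarrow> ('o, 'a, 'q, 'c) fctr" where
  "comp_fctr G F = \<lparr>onOb = onOb G \<circ> onOb F, onAr = onAr G \<circ> onAr F\<rparr>"

text \<open>Families of arrows indexed by the objects of \<open>A\<close> are taken \<open>undefined\<close> off \<open>Ob A\<close>, so
  that equality of natural transformations is equality of functions.\<close>

locale nat_trans = F: is_functor A B F + G: is_functor A B G
  for A :: "('o, 'a) cat" and B :: "('p, 'b) cat"
    and F G :: "('o, 'a, 'p, 'b) fctr" +
  fixes \<tau> :: "'o \<Rightarrow> 'b"
  assumes ext: "\<tau> \<in> extensional (Ob A)"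
    and component: "X \<in> Ob A \<Longrightarrow> \<tau> X \<in> hom B (onOb F X) (onOb G X)"
    and naturality: "f \<in> hom A X Y \<Longrightarrow>
      Comp B (\<tau> Y) (onAr F f) = Comp B (onAr G f) (\<tau> X)"

definition nat_iso :: "('o, 'a) cat \<Rightarrow> ('p, 'b) cat \<Rightarrow>
    ('o, 'a, 'p, 'b) fctr \<Rightarrow> ('o, 'a, 'p, 'b) fctr \<Rightarrow> ('o \<Rightarrow> 'b) \<Rightarrow> bool" where
  "nat_iso A B F G \<tau> \<longleftrightarrow> nat_trans A B F G \<tau> \<and> (\<forall>X \<in> Ob A. is_iso B (\<tau> X))"

definition prod_cat :: "('o, 'a) cat \<Rightarrow> ('p, 'b) cat \<Rightarrow> ('o \<times> 'p, 'a \<times> 'b) cat" where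
  "prod_cat A B = \<lparr>Ob = Ob A \<times> Ob B, Ar = Ar A \<times> Ar B,
     Dom = (\<lambda>(f, g). (Dom A f, Dom B g)), Cod = (\<lambda>(f, g). (Cod A f, Cod B g)),
     Idn = (\<lambda>(X, Y). (Idn A X, Idn B Y)),
     Comp = (\<lambda>(f', g') (f, g). (Comp A f' f, Comp B g' g))\<rparr>"

definition swap_functor :: "('o \<times> 'p, 'a \<times> 'b, 'p \<times> 'o, 'b \<times> 'a) fctr" where
  "swap_functor = \<lparr>onOb = (\<lambda>(X, Y). (Y, X)), onAr = (\<lambda>(f, g). (g, f))\<rparr>"

definition poset_cat :: "'v set \<Rightarrow> ('v \<Rightarrow> 'v \<Rightarrow> bool) \<Rightarrow> ('v, 'v \<times> 'v) cat" where
  "poset_cat P le = \<lparr>Ob = P, Ar = {(x, y). x \<in> P \<and> y \<in> P \<and> le x y},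
     Dom = fst, Cod = snd, Idn = (\<lambda>x. (x, x)), Comp = (\<lambda>(_, z) (x, _). (x, z))\<rparr>"

definition inclusion :: "('o, 'a, 'o, 'a) fctr" where
  "inclusion = \<lparr>onOb = (\<lambda>X. X), onAr = (\<lambda>f. f)\<rparr>"

section \<open>Limits, colimits, Kan extensions\<close>

definition is_cocone :: "('i, 'j) cat \<Rightarrow> ('o, 'a) cat \<Rightarrow> ('i, 'j, 'o, 'a) fctr \<Rightarrow> 'o \<Rightarrow> ('i \<Rightarrow> 'a) \<Rightarrow> bool" where
  "is_cocone J C F c t \<longleftrightarrow> c \<in> Ob C \<and> (\<forall>i \<in> Ob J. t i \<in> hom C (onOb F i) c) \<and>
     (\<forall>u \<in> Ar J. Comp C (t (Cod J u)) (onAr F u) = t (Dom J u))"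

definition is_colimit :: "('i, 'j) cat \<Rightarrow> ('o, 'a) cat \<Rightarrow> ('i, 'j, 'o, 'a) fctr \<Rightarrow> 'o \<Rightarrow> ('i \<Rightarrow> 'a) \<Rightarrow> bool" where
  "is_colimit J C F c t \<longleftrightarrow> is_cocone J C F c t \<and>
     (\<forall>d s. is_cocone J C F d s \<longrightarrow> (\<exists>!h. h \<in> hom C c d \<and> (\<forall>i \<in> Ob J. Comp C h (t i) = s i)))"

definition is_cone :: "('i, 'j) cat \<Rightarrow> ('o, 'a) cat \<Rightarrow> ('i, 'j, 'o, 'a) fctr \<Rightarrow> 'o \<Rightarrow> ('i \<Rightarrow> 'a) \<Rightarrow> bool" where
  "is_cone J C F c t \<longleftrightarrow> c \<in> Ob C \<and> (\<forall>i \<in> Ob J. t i \<in> hom C c (onOb F i)) \<and>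
     (\<forall>u \<in> Ar J. Comp C (onAr F u) (t (Dom J u)) = t (Cod J u))"

definition is_limit :: "('i, 'j) cat \<Rightarrow> ('o, 'a) cat \<Rightarrow> ('i, 'j, 'o, 'a) fctr \<Rightarrow> 'o \<Rightarrow> ('i \<Rightarrow> 'a) \<Rightarrow> bool" where
  "is_limit J C F c t \<longleftrightarrow> is_cone J C F c t \<and>
     (\<forall>d s. is_cone J C F d s \<longrightarrow> (\<exists>!h. h \<in> hom C d c \<and> (\<forall>i \<in> Ob J. Comp C (t i) h = s i)))"

text \<open>Smallness. HOL has no universe of small sets, so ``small'' is read relative to a type
  parameter \<open>'u\<close>: a set is small if it embeds in \<open>'u univ\<close>. The summand \<open>nat list\<close> makes
  \<open>'u univ\<close> infinite and provides room for the simplices of the standard simplices (lists of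
  numbers, see below) and nothing else. Everything is polymorphic in \<open>'u\<close>, hence available for
  every bound on the size of small sets. Hom-sets and mapping spaces are not required to be small
  in this sense: with a single bound that would be incompatible with completeness
  (Freyd), whereas a model category in the usual sense fits for each fixed \<open>'u\<close>.\<close>

type_synonym 'u univ = "nat list + 'u"

definition cocomplete :: "'u itself \<Rightarrow> ('o, 'a) cat \<Rightarrow> bool" where
  "cocomplete _ C \<longleftrightarrow> (\<forall>(J :: ('u univ, 'u univ) cat) F. is_functor J C F \<longrightarrow> (\<exists>c t. is_colimit J C F c t))"

definition complete :: "'u itself \<Rightarrow> ('o, 'a) cat \<Rightarrow> bool" where
  "complete _ C \<longleftrightarrow> (\<forall>(J :: ('u univ, 'u univ) cat) F. is_functor J C F \<longrightarrow> (\<exists>c t. is_limit J C F c t))"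

text \<open>\<open>(F, \<eta>)\<close> is the left Kan extension of \<open>D : A \<rightarrow> C\<close> along \<open>K : A \<rightarrow> B\<close>.\<close>

definition is_left_Kan_extension :: "('o, 'a) cat \<Rightarrow> ('p, 'b) cat \<Rightarrow> ('q, 'c) cat \<Rightarrow>
    ('o, 'a, 'p, 'b) fctr \<Rightarrow> ('o, 'a, 'q, 'c) fctr \<Rightarrow>
    ('p, 'b, 'q, 'c) fctr \<Rightarrow> ('o \<Rightarrow> 'c) \<Rightarrow> bool" where
  "is_left_Kan_extension A B C K D F \<eta> \<longleftrightarrow>
     is_functor A B K \<and> is_functor B C F \<and> nat_trans A C D (comp_fctr F K) \<eta> \<and>
     (\<forall>G \<gamma>. is_functor B C G \<longrightarrow> nat_trans A C D (comp_fctr G K) \<gamma> \<longrightarrow>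
        (\<exists>!\<alpha>. nat_trans B C F G \<alpha> \<and> (\<forall>a \<in> Ob A. Comp C (\<alpha> (onOb K a)) (\<eta> a) = \<gamma> a)))"

definition zero_object :: "('o, 'a) cat \<Rightarrow> 'o \<Rightarrow> bool" where
  "zero_object C Z \<longleftrightarrow> Z \<in> Ob C \<and>
     (\<forall>X \<in> Ob C. (\<exists>!f. f \<in> hom C X Z) \<and> (\<exists>!f. f \<in> hom C Z X))"

definition zero_arrow :: "('o, 'a) cat \<Rightarrow> 'o \<Rightarrow> 'o \<Rightarrow> 'a" where
  "zero_arrow C X Y = (THE h. \<exists>Z f g. zero_object C Z \<and> f \<in> hom C X Z \<and> g \<in> hom C Z Y \<and> h = Comp C g f)"

section \<open>Model categories\<close>

record 'a model =
  weq :: "'a set"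
  cof :: "'a set"
  fib :: "'a set"

text \<open>\<open>lifts C i p\<close>: the arrow \<open>i\<close> has the left lifting property with respect to \<open>p\<close>.\<close>

definition lifts :: "('o, 'a) cat \<Rightarrow> 'a \<Rightarrow> 'a \<Rightarrow> bool" where
  "lifts C i p \<longleftrightarrow>
     (\<forall>u \<in> hom C (Dom C i) (Dom C p). \<forall>v \<in> hom C (Cod C i) (Cod C p).
        Comp C p u = Comp C v i \<longrightarrow>
        (\<exists>l \<in> hom C (Cod C i) (Dom C p). Comp C l i = u \<and> Comp C p l = v))"

definition rlp :: "('o, 'a) cat \<Rightarrow> 'a set \<Rightarrow> 'a set" where
  "rlp C I = {p \<in> Ar C. \<forall>i \<in> I. lifts C i p}"

definition is_retract :: "('o, 'a) cat \<Rightarrow> 'a \<Rightarrow> 'a \<Rightarrow> bool" where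
  "is_retract C f g \<longleftrightarrow> f \<in> Ar C \<and> g \<in> Ar C \<and>
     (\<exists>i \<in> hom C (Dom C f) (Dom C g). \<exists>r \<in> hom C (Dom C g) (Dom C f).
      \<exists>i' \<in> hom C (Cod C f) (Cod C g). \<exists>r' \<in> hom C (Cod C g) (Cod C f).
        Comp C r i = Idn C (Dom C f) \<and> Comp C r' i' = Idn C (Cod C f) \<and>
        Comp C g i = Comp C i' f \<and> Comp C f r = Comp C r' g)"

definition two_of_three :: "('o, 'a) cat \<Rightarrow> 'a set \<Rightarrow> bool" where
  "two_of_three C W \<longleftrightarrow>
     (\<forall>f \<in> Ar C. \<forall>g \<in> Ar C. Dom C g = Cod C f \<longrightarrow>
        (f \<in> W \<and> g \<in> W \<longrightarrow> Comp C g f \<in> W) \<and>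
        (f \<in> W \<and> Comp C g f \<in> W \<longrightarrow> g \<in> W) \<and>
        (g \<in> W \<and> Comp C g f \<in> W \<longrightarrow> f \<in> W))"

definition retract_closed :: "('o, 'a) cat \<Rightarrow> 'a set \<Rightarrow> bool" where
  "retract_closed C W \<longleftrightarrow> (\<forall>f g. is_retract C f g \<and> g \<in> W \<longrightarrow> f \<in> W)"

definition factors :: "('o, 'a) cat \<Rightarrow> 'a set \<Rightarrow> 'a set \<Rightarrow> bool" where
  "factors C L R \<longleftrightarrow> (\<forall>f \<in> Ar C. \<exists>i \<in> L. \<exists>p \<in> R.
     Dom C i = Dom C f \<and> Cod C i = Dom C p \<and> Cod C p = Cod C f \<and> Comp C p i = f)"

locale model_category = category C
  for C :: "('o, 'a) cat" +
  fixes U :: "'u itself" and m :: "'a model"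
  assumes complete: "complete U C"
    and cocomplete: "cocomplete U C"
    and classes: "weq m \<subseteq> Ar C" "cof m \<subseteq> Ar C" "fib m \<subseteq> Ar C"
    and weq_two_of_three: "two_of_three C (weq m)"
    and retracts: "retract_closed C (weq m)" "retract_closed C (cof m)" "retract_closed C (fib m)"
    and lift_cof: "i \<in> cof m \<Longrightarrow> p \<in> fib m \<inter> weq m \<Longrightarrow> lifts C i p"
    and lift_fib: "i \<in> cof m \<inter> weq m \<Longrightarrow> p \<in> fib m \<Longrightarrow> lifts C i p"
    and factor_cof: "factors C (cof m) (fib m \<inter> weq m)"
    and factor_fib: "factors C (cof m \<inter> weq m) (fib m)"

definition left_Bousfield_localization ::
    "'u itself \<Rightarrow> ('o, 'a) cat \<Rightarrow> 'a model \<Rightarrow> 'a model \<Rightarrow> bool" where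
  "left_Bousfield_localization U C m m' \<longleftrightarrow>
     model_category C U m \<and> model_category C U m' \<and> cof m' = cof m \<and> weq m \<subseteq> weq m'"

subsection \<open>Cofibrant generation\<close>

definition is_pushout :: "('o, 'a) cat \<Rightarrow> 'a \<Rightarrow> 'a \<Rightarrow> 'a \<Rightarrow> 'a \<Rightarrow> bool" where
  "is_pushout C f g f' g' \<longleftrightarrow>
     f \<in> Ar C \<and> g \<in> Ar C \<and> f' \<in> Ar C \<and> g' \<in> Ar C \<and>
     Dom C f = Dom C g \<and> Dom C f' = Cod C g \<and> Dom C g' = Cod C f \<and> Cod C f' = Cod C g' \<and>
     Comp C g' f = Comp C f' g \<and>
     (\<forall>Z. \<forall>a \<in> hom C (Cod C f) Z. \<forall>b \<in> hom C (Cod C g) Z. Comp C a f = Comp C b g \<longrightarrow>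
        (\<exists>!h. h \<in> hom C (Cod C f') Z \<and> Comp C h g' = a \<and> Comp C h f' = b))"

text \<open>Ordinals are represented by well-orders \<open>r\<close>; \<open>succ_in r a b\<close> says \<open>b = a + 1\<close>.\<close>

definition succ_in :: "'v rel \<Rightarrow> 'v \<Rightarrow> 'v \<Rightarrow> bool" where
  "succ_in r a b \<longleftrightarrow> (a, b) \<in> r \<and> a \<noteq> b \<and> (\<forall>c. (a, c) \<in> r \<and> c \<noteq> a \<longrightarrow> (b, c) \<in> r)"

definition limit_in :: "'v rel \<Rightarrow> 'v \<Rightarrow> bool" where
  "limit_in r b \<longleftrightarrow> b \<in> Field r \<and> underS r b \<noteq> {} \<and> (\<nexists>a. succ_in r a b)"

abbreviation ord_cat :: "'v rel \<Rightarrow> ('v, 'v \<times> 'v) cat" where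
  "ord_cat r \<equiv> poset_cat (Field r) (\<lambda>a b. (a, b) \<in> r)"

text \<open>A \<open>\<lambda>\<close>-sequence of arrows in \<open>D\<close>: a colimit-preserving functor from a nonzero ordinal
  whose successor steps lie in \<open>D\<close>.\<close>

definition trans_seq :: "('o, 'a) cat \<Rightarrow> 'a set \<Rightarrow> 'v rel \<Rightarrow> ('v, 'v \<times> 'v, 'o, 'a) fctr \<Rightarrow> bool" where
  "trans_seq C D r F \<longleftrightarrow> Well_order r \<and> Field r \<noteq> {} \<and> is_functor (ord_cat r) C F \<and>
     (\<forall>b. limit_in r b \<longrightarrow>
        is_colimit (poset_cat (underS r b) (\<lambda>x y. (x, y) \<in> r)) C F (onOb F b) (\<lambda>a. onAr F (a, b))) \<and>
     (\<forall>a b. succ_in r a b \<longrightarrow> onAr F (a, b) \<in> D)"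

definition relative_cell :: "'u itself \<Rightarrow> ('o, 'a) cat \<Rightarrow> 'a set \<Rightarrow> 'a set" where
  "relative_cell _ C I = {f. \<exists>(r :: 'u univ rel) F c t b.
     trans_seq C {f'. \<exists>i \<in> I. \<exists>g g'. is_pushout C i g f' g'} r F \<and>
     is_colimit (ord_cat r) C F c t \<and>
     b \<in> Field r \<and> (\<forall>a \<in> Field r. (b, a) \<in> r) \<and> f = t b}"

text \<open>\<open>W\<close> is small relative to \<open>D\<close>: for some cardinal \<open>\<kappa>\<close>, all regular \<open>\<lambda> \<ge> \<kappa>\<close> and all
  \<open>\<lambda>\<close>-sequences in \<open>D\<close>, the map \<open>colim hom(W, F a) \<rightarrow> hom(W, colim F)\<close> is surjective and
  injective.\<close>

definition small_relative :: "'u itself \<Rightarrow> ('o, 'a) cat \<Rightarrow> 'a set \<Rightarrow> 'o \<Rightarrow> bool" where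
  "small_relative _ C D W \<longleftrightarrow>
     (\<exists>\<kappa> :: 'u univ rel. Card_order \<kappa> \<and>
       (\<forall>(r :: 'u univ rel) F c t.
          Card_order r \<and> infinite (Field r) \<and> regularCard r \<and> (\<kappa>, r) \<in> ordLeq \<and>
          trans_seq C D r F \<and> is_colimit (ord_cat r) C F c t \<longrightarrow>
          (\<forall>h \<in> hom C W c. \<exists>a \<in> Field r. \<exists>g \<in> hom C W (onOb F a). Comp C (t a) g = h) \<and>
          (\<forall>a \<in> Field r. \<forall>g \<in> hom C W (onOb F a). \<forall>g' \<in> hom C W (onOb F a).
             Comp C (t a) g = Comp C (t a) g' \<longrightarrow>
             (\<exists>b. (a, b) \<in> r \<and> Comp C (onAr F (a, b)) g = Comp C (onAr F (a, b)) g'))))"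

definition permits_soa :: "'u itself \<Rightarrow> ('o, 'a) cat \<Rightarrow> 'a set \<Rightarrow> bool" where
  "permits_soa U C I \<longleftrightarrow> (\<forall>i \<in> I. small_relative U C (relative_cell U C I) (Dom C i))"

definition cofibrantly_generated :: "'u itself \<Rightarrow> ('o, 'a) cat \<Rightarrow> 'a model \<Rightarrow> bool" where
  "cofibrantly_generated U C m \<longleftrightarrow>
     (\<exists>I J. I \<subseteq> Ar C \<and> J \<subseteq> Ar C \<and>
        (\<exists>e :: 'a \<Rightarrow> 'u univ. inj_on e I) \<and> (\<exists>e :: 'a \<Rightarrow> 'u univ. inj_on e J) \<and>
        permits_soa U C I \<and> permits_soa U C J \<and>
        fib m \<inter> weq m = rlp C I \<and> fib m = rlp C J)"

section \<open>Simplicial sets\<close>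

text \<open>A monotone map \<open>\<theta> : [k] \<rightarrow> [n]\<close> is the list of its \<open>k + 1\<close> values.\<close>

definition dmaps :: "nat \<Rightarrow> nat \<Rightarrow> nat list set" where
  "dmaps k n = {\<theta>. length \<theta> = Suc k \<and> sorted \<theta> \<and> set \<theta> \<subseteq> {..n}}"

definition dcomp :: "nat list \<Rightarrow> nat list \<Rightarrow> nat list" where
  "dcomp \<theta> \<psi> = map (\<lambda>i. \<theta> ! i) \<psi>"

text \<open>For \<open>\<theta> \<in> dmaps k n\<close>, \<open>act K n \<theta>\<close> is the operator \<open>\<theta>\<^sup>* : K\<^sub>n \<rightarrow> K\<^sub>k\<close>.\<close>

record 'x sset =
  simplices :: "nat \<Rightarrow> 'x set"
  act :: "nat \<Rightarrow> nat list \<Rightarrow> 'x \<Rightarrow> 'x"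

locale simplicial_set =
  fixes K :: "'x sset"
  assumes act_in: "\<theta> \<in> dmaps k n \<Longrightarrow> x \<in> simplices K n \<Longrightarrow> act K n \<theta> x \<in> simplices K k"
    and act_id: "x \<in> simplices K n \<Longrightarrow> act K n [0..<Suc n] x = x"
    and act_comp: "\<theta> \<in> dmaps m n \<Longrightarrow> \<psi> \<in> dmaps k m \<Longrightarrow> x \<in> simplices K n \<Longrightarrow>
      act K n (dcomp \<theta> \<psi>) x = act K m \<psi> (act K n \<theta> x)"

locale simplicial_map = K: simplicial_set K + L: simplicial_set L
  for K :: "'x sset" and L :: "'y sset" +
  fixes f :: "nat \<Rightarrow> 'x \<Rightarrow> 'y"
  assumes map_in: "f n \<in> simplices K n \<rightarrow>\<^sub>E simplices L n"
    and map_act: "\<theta> \<in> dmaps k n \<Longrightarrow> x \<in> simplices K n \<Longrightarrow>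
      f k (act K n \<theta> x) = act L n \<theta> (f n x)"

definition simplicial_iso :: "'x sset \<Rightarrow> 'y sset \<Rightarrow> (nat \<Rightarrow> 'x \<Rightarrow> 'y) \<Rightarrow> bool" where
  "simplicial_iso K L f \<longleftrightarrow> simplicial_map K L f \<and> (\<forall>n. bij_betw (f n) (simplices K n) (simplices L n))"

text \<open>The totally degenerate \<open>n\<close>-simplex on a vertex.\<close>

definition dgn :: "'x sset \<Rightarrow> nat \<Rightarrow> 'x \<Rightarrow> 'x" where
  "dgn K n v = act K 0 (replicate (Suc n) 0) v"

definition std_simplex :: "nat \<Rightarrow> nat list sset" where
  "std_simplex n = \<lparr>simplices = (\<lambda>m. dmaps m n), act = (\<lambda>_ \<theta> \<sigma>. dcomp \<sigma> \<theta>)\<rparr>"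

definition boundary :: "nat \<Rightarrow> nat list sset" where
  "boundary n = \<lparr>simplices = (\<lambda>m. {\<sigma> \<in> dmaps m n. \<exists>j \<le> n. j \<notin> set \<sigma>}), act = (\<lambda>_ \<theta> \<sigma>. dcomp \<sigma> \<theta>)\<rparr>"

definition horn :: "nat \<Rightarrow> nat \<Rightarrow> nat list sset" where
  "horn n k = \<lparr>simplices = (\<lambda>m. {\<sigma> \<in> dmaps m n. \<exists>j \<le> n. j \<noteq> k \<and> j \<notin> set \<sigma>}), act = (\<lambda>_ \<theta> \<sigma>. dcomp \<sigma> \<theta>)\<rparr>"

text \<open>Right lifting property of \<open>p : E \<rightarrow> B\<close> with respect to an inclusion \<open>A \<subseteq> L\<close>.\<close>

definition rlp_incl :: "'l sset \<Rightarrow> 'l sset \<Rightarrow> 'x sset \<Rightarrow> 'y sset \<Rightarrow> (nat \<Rightarrow> 'x \<Rightarrow> 'y) \<Rightarrow> bool" where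
  "rlp_incl A L E B p \<longleftrightarrow>
     (\<forall>a b. simplicial_map A E a \<and> simplicial_map L B b \<and>
        (\<forall>m. \<forall>x \<in> simplices A m. p m (a m x) = b m x) \<longrightarrow>
        (\<exists>l. simplicial_map L E l \<and>
           (\<forall>m. \<forall>x \<in> simplices A m. l m x = a m x) \<and>
           (\<forall>m. \<forall>x \<in> simplices L m. p m (l m x) = b m x)))"

definition Kan_fibration :: "'x sset \<Rightarrow> 'y sset \<Rightarrow> (nat \<Rightarrow> 'x \<Rightarrow> 'y) \<Rightarrow> bool" where
  "Kan_fibration E B p \<longleftrightarrow> simplicial_map E B p \<and>
     (\<forall>n k. 1 \<le> n \<and> k \<le> n \<longrightarrow> rlp_incl (horn n k) (std_simplex n) E B p)"

definition trivial_Kan_fibration :: "'x sset \<Rightarrow> 'y sset \<Rightarrow> (nat \<Rightarrow> 'x \<Rightarrow> 'y) \<Rightarrow> bool" where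
  "trivial_Kan_fibration E B p \<longleftrightarrow> simplicial_map E B p \<and>
     (\<forall>n. rlp_incl (boundary n) (std_simplex n) E B p)"

definition sset_prod :: "'x sset \<Rightarrow> 'y sset \<Rightarrow> ('x \<times> 'y) sset" where
  "sset_prod K L = \<lparr>simplices = (\<lambda>n. simplices K n \<times> simplices L n),
     act = (\<lambda>n \<theta> (x, y). (act K n \<theta> x, act L n \<theta> y))\<rparr>"

text \<open>The internal hom: an \<open>n\<close>-simplex is a map \<open>K \<times> \<Delta>[n] \<rightarrow> L\<close>.\<close>

definition mapping_sset :: "'x sset \<Rightarrow> 'y sset \<Rightarrow> (nat \<Rightarrow> 'x \<times> nat list \<Rightarrow> 'y) sset" where
  "mapping_sset K L = \<lparr>
     simplices = (\<lambda>n. {f. simplicial_map (sset_prod K (std_simplex n)) L f}),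
     act = (\<lambda>n \<theta> f m. \<lambda>(x, \<sigma>) \<in> simplices K m \<times> dmaps m (length \<theta> - 1). f m (x, dcomp \<theta> \<sigma>))\<rparr>"

subsection \<open>Pointed simplicial sets\<close>

record 'x psset = "'x sset" + bpt :: 'x

definition forget_pt :: "'x psset \<Rightarrow> 'x sset" where
  "forget_pt K = \<lparr>simplices = simplices K, act = act K\<rparr>"

definition base :: "'x psset \<Rightarrow> nat \<Rightarrow> 'x" where
  "base K n = dgn (forget_pt K) n (bpt K)"

definition pointed_sset :: "'x psset \<Rightarrow> bool" where
  "pointed_sset K \<longleftrightarrow> simplicial_set (forget_pt K) \<and> bpt K \<in> simplices K 0"

definition pointed_map :: "'x psset \<Rightarrow> 'y psset \<Rightarrow> (nat \<Rightarrow> 'x \<Rightarrow> 'y) \<Rightarrow> bool" where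
  "pointed_map K L f \<longleftrightarrow> pointed_sset K \<and> pointed_sset L \<and>
     simplicial_map (forget_pt K) (forget_pt L) f \<and> f 0 (bpt K) = bpt L"

text \<open>The pointed internal hom: an \<open>n\<close>-simplex is a map \<open>K \<times> \<Delta>[n] \<rightarrow> L\<close> sending
  \<open>{*} \<times> \<Delta>[n]\<close> to the base point.\<close>

definition pointed_mapping_sset :: "'x psset \<Rightarrow> 'y psset \<Rightarrow> (nat \<Rightarrow> 'x \<times> nat list \<Rightarrow> 'y) sset" where
  "pointed_mapping_sset K L = \<lparr>
     simplices = (\<lambda>n. {f \<in> simplices (mapping_sset (forget_pt K) (forget_pt L)) n.
        \<forall>m. \<forall>\<sigma> \<in> dmaps m n. f m (base K m, \<sigma>) = base L m}),
     act = act (mapping_sset (forget_pt K) (forget_pt L))\<rparr>"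

text \<open>\<open>(\<Delta>\<^sup>1, {0})\<close> and \<open>({0, 1}, {0})\<close>, with simplices in \<open>'u univ\<close>.\<close>

definition interval :: "'u univ psset" where
  "interval = \<lparr>simplices = (\<lambda>m. Inl ` dmaps m 1), act = (\<lambda>_ \<theta> x. Inl (dcomp (projl x) \<theta>)), bpt = Inl [0]\<rparr>"

definition endpoints :: "'u univ psset" where
  "endpoints = \<lparr>simplices = (\<lambda>m. {Inl (replicate (Suc m) 0), Inl (replicate (Suc m) 1)}),
     act = (\<lambda>_ \<theta> x. Inl (dcomp (projl x) \<theta>)), bpt = Inl [0]\<rparr>"

section \<open>Pointed simplicial model categories\<close>

text \<open>\<open>Map M X Y\<close> is the simplicial set of maps; \<open>scomp M X Y Z n g f\<close> composes \<open>n\<close>-simplices.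
  The fields \<open>smash\<close> and \<open>smash_unit\<close> hold a choice of tensors \<open>X \<and> K\<close> together with their
  universal maps \<open>K \<rightarrow> Map(X, X \<and> K)\<close>.\<close>

record ('o, 's, 'u) simp_cat =
  Obj :: "'o set"
  Map :: "'o \<Rightarrow> 'o \<Rightarrow> 's sset"
  scomp :: "'o \<Rightarrow> 'o \<Rightarrow> 'o \<Rightarrow> nat \<Rightarrow> 's \<Rightarrow> 's \<Rightarrow> 's"
  sidn :: "'o \<Rightarrow> 's"
  smash :: "'o \<Rightarrow> 'u univ psset \<Rightarrow> 'o"
  smash_unit :: "'o \<Rightarrow> 'u univ psset \<Rightarrow> nat \<Rightarrow> 'u univ \<Rightarrow> 's"

locale simplicial_category =
  fixes M :: "('o, 's, 'u) simp_cat"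
  assumes Map_sset: "X \<in> Obj M \<Longrightarrow> Y \<in> Obj M \<Longrightarrow> simplicial_set (Map M X Y)"
    and scomp_in: "X \<in> Obj M \<Longrightarrow> Y \<in> Obj M \<Longrightarrow> Z \<in> Obj M \<Longrightarrow>
      g \<in> simplices (Map M Y Z) n \<Longrightarrow> f \<in> simplices (Map M X Y) n \<Longrightarrow>
      scomp M X Y Z n g f \<in> simplices (Map M X Z) n"
    and scomp_act: "X \<in> Obj M \<Longrightarrow> Y \<in> Obj M \<Longrightarrow> Z \<in> Obj M \<Longrightarrow>
      g \<in> simplices (Map M Y Z) n \<Longrightarrow> f \<in> simplices (Map M X Y) n \<Longrightarrow> \<theta> \<in> dmaps k n \<Longrightarrow>
      act (Map M X Z) n \<theta> (scomp M X Y Z n g f) =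
      scomp M X Y Z k (act (Map M Y Z) n \<theta> g) (act (Map M X Y) n \<theta> f)"
    and sidn_in: "X \<in> Obj M \<Longrightarrow> sidn M X \<in> simplices (Map M X X) 0"
    and sidn_left: "X \<in> Obj M \<Longrightarrow> Y \<in> Obj M \<Longrightarrow> f \<in> simplices (Map M X Y) n \<Longrightarrow>
      scomp M X Y Y n (dgn (Map M Y Y) n (sidn M Y)) f = f"
    and sidn_right: "X \<in> Obj M \<Longrightarrow> Y \<in> Obj M \<Longrightarrow> f \<in> simplices (Map M X Y) n \<Longrightarrow>
      scomp M X X Y n f (dgn (Map M X X) n (sidn M X)) = f"
    and scomp_assoc: "W \<in> Obj M \<Longrightarrow> X \<in> Obj M \<Longrightarrow> Y \<in> Obj M \<Longrightarrow> Z \<in> Obj M \<Longrightarrow>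
      f \<in> simplices (Map M W X) n \<Longrightarrow> g \<in> simplices (Map M X Y) n \<Longrightarrow> h \<in> simplices (Map M Y Z) n \<Longrightarrow>
      scomp M W Y Z n h (scomp M W X Y n g f) = scomp M W X Z n (scomp M X Y Z n h g) f"

text \<open>The underlying category; an arrow \<open>X \<rightarrow> Y\<close> is a vertex of \<open>Map M X Y\<close>, tagged with
  \<open>X\<close> and \<open>Y\<close>.\<close>

definition und :: "('o, 's, 'u) simp_cat \<Rightarrow> ('o, 'o \<times> 'o \<times> 's) cat" where
  "und M = \<lparr>Ob = Obj M, Ar = {(X, Y, f). X \<in> Obj M \<and> Y \<in> Obj M \<and> f \<in> simplices (Map M X Y) 0},
     Dom = (\<lambda>(X, Y, f). X), Cod = (\<lambda>(X, Y, f). Y), Idn = (\<lambda>X. (X, X, sidn M X)),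
     Comp = (\<lambda>(_, Z, g) (X, Y, f). (X, Z, scomp M X Y Z 0 g f))\<rparr>"

abbreviation vtx :: "'o \<times> 'o \<times> 's \<Rightarrow> 's" where
  "vtx f \<equiv> snd (snd f)"

subsection \<open>Tensors and cotensors\<close>

text \<open>\<open>\<eta> : K \<rightarrow> Map(X, T)\<close> exhibits \<open>T\<close> as \<open>X \<otimes> K\<close>: composition with \<open>\<eta>\<close> is an isomorphism
  \<open>Map(T, Y) \<cong> Map(K, Map(X, Y))\<close> for all \<open>Y\<close>. By the enriched Yoneda lemma, isomorphisms of
  this form are the ones natural in \<open>Y\<close>; similarly for cotensors.\<close>

definition tensor_comparison :: "('o, 's, 'u) simp_cat \<Rightarrow> 'o \<Rightarrow> 'k sset \<Rightarrow> 'o \<Rightarrow> (nat \<Rightarrow> 'k \<Rightarrow> 's) \<Rightarrow>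
    'o \<Rightarrow> nat \<Rightarrow> 's \<Rightarrow> (nat \<Rightarrow> 'k \<times> nat list \<Rightarrow> 's)" where
  "tensor_comparison M X K T \<eta> Y n = (\<lambda>g \<in> simplices (Map M T Y) n.
     \<lambda>m. \<lambda>(k, \<sigma>) \<in> simplices K m \<times> dmaps m n. scomp M X T Y m (act (Map M T Y) n \<sigma> g) (\<eta> m k))"

definition is_tensor :: "('o, 's, 'u) simp_cat \<Rightarrow> 'o \<Rightarrow> 'k sset \<Rightarrow> 'o \<Rightarrow> (nat \<Rightarrow> 'k \<Rightarrow> 's) \<Rightarrow> bool" where
  "is_tensor M X K T \<eta> \<longleftrightarrow> T \<in> Obj M \<and> simplicial_map K (Map M X T) \<eta> \<and>
     (\<forall>Y \<in> Obj M. simplicial_iso (Map M T Y) (mapping_sset K (Map M X Y)) (tensor_comparison M X K T \<eta> Y))"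

definition cotensor_comparison :: "('o, 's, 'u) simp_cat \<Rightarrow> 'o \<Rightarrow> 'k sset \<Rightarrow> 'o \<Rightarrow> (nat \<Rightarrow> 'k \<Rightarrow> 's) \<Rightarrow>
    'o \<Rightarrow> nat \<Rightarrow> 's \<Rightarrow> (nat \<Rightarrow> 'k \<times> nat list \<Rightarrow> 's)" where
  "cotensor_comparison M Y K T \<epsilon> X n = (\<lambda>g \<in> simplices (Map M X T) n.
     \<lambda>m. \<lambda>(k, \<sigma>) \<in> simplices K m \<times> dmaps m n. scomp M X T Y m (\<epsilon> m k) (act (Map M X T) n \<sigma> g))"

definition is_cotensor :: "('o, 's, 'u) simp_cat \<Rightarrow> 'o \<Rightarrow> 'k sset \<Rightarrow> 'o \<Rightarrow> (nat \<Rightarrow> 'k \<Rightarrow> 's) \<Rightarrow> bool" where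
  "is_cotensor M Y K T \<epsilon> \<longleftrightarrow> T \<in> Obj M \<and> simplicial_map K (Map M T Y) \<epsilon> \<and>
     (\<forall>X \<in> Obj M. simplicial_iso (Map M X T) (mapping_sset K (Map M X Y)) (cotensor_comparison M Y K T \<epsilon> X))"

text \<open>In the pointed case the mapping spaces are pointed by the zero arrows, and \<open>X \<and> K\<close> is
  characterised by \<open>Map(X \<and> K, Y) \<cong> Map\<^sub>*(K, Map(X, Y))\<close>.\<close>

definition pMap :: "('o, 's, 'u) simp_cat \<Rightarrow> 'o \<Rightarrow> 'o \<Rightarrow> 's psset" where
  "pMap M X Y = \<lparr>simplices = simplices (Map M X Y), act = act (Map M X Y),
     bpt = vtx (zero_arrow (und M) X Y)\<rparr>"

definition is_smash :: "('o, 's, 'u) simp_cat \<Rightarrow> 'o \<Rightarrow> 'k psset \<Rightarrow> 'o \<Rightarrow> (nat \<Rightarrow> 'k \<Rightarrow> 's) \<Rightarrow> bool" where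
  "is_smash M X K T \<eta> \<longleftrightarrow> T \<in> Obj M \<and> pointed_map K (pMap M X T) \<eta> \<and>
     (\<forall>Y \<in> Obj M. simplicial_iso (Map M T Y) (pointed_mapping_sset K (pMap M X Y))
        (tensor_comparison M X (forget_pt K) T \<eta> Y))"

subsection \<open>The axioms\<close>

text \<open>For \<open>i : A \<rightarrow> B\<close> and \<open>p : X \<rightarrow> Y\<close>, the map
  \<open>Map(B, X) \<rightarrow> Map(A, X) \<times>\<^bsub>Map(A, Y)\<^esub> Map(B, Y)\<close>.\<close>

definition corner_sset :: "('o, 's, 'u) simp_cat \<Rightarrow> 'o \<times> 'o \<times> 's \<Rightarrow> 'o \<times> 'o \<times> 's \<Rightarrow> ('s \<times> 's) sset" where
  "corner_sset M = (\<lambda>(A, B, i) (X, Y, p). \<lparr>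
     simplices = (\<lambda>n. {(u, v). u \<in> simplices (Map M A X) n \<and> v \<in> simplices (Map M B Y) n \<and>
        scomp M A X Y n (dgn (Map M X Y) n p) u = scomp M A B Y n v (dgn (Map M A B) n i)}),
     act = act (sset_prod (Map M A X) (Map M B Y))\<rparr>)"

definition corner_map :: "('o, 's, 'u) simp_cat \<Rightarrow> 'o \<times> 'o \<times> 's \<Rightarrow> 'o \<times> 'o \<times> 's \<Rightarrow> nat \<Rightarrow> 's \<Rightarrow> 's \<times> 's" where
  "corner_map M = (\<lambda>(A, B, i) (X, Y, p) n. \<lambda>h \<in> simplices (Map M B X) n.
     (scomp M A B X n h (dgn (Map M A B) n i), scomp M B X Y n (dgn (Map M X Y) n p) h))"

locale simplicial_model_category =
  simplicial_category M + model_category "und M" "TYPE('u)" m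
  for M :: "('o, 's, 'u) simp_cat" and m :: "('o \<times> 'o \<times> 's) model" +
  assumes tensored: "X \<in> Obj M \<Longrightarrow> simplicial_set (K :: 'u univ sset) \<Longrightarrow> \<exists>T \<eta>. is_tensor M X K T \<eta>"
    and cotensored: "Y \<in> Obj M \<Longrightarrow> simplicial_set (K :: 'u univ sset) \<Longrightarrow> \<exists>T \<epsilon>. is_cotensor M Y K T \<epsilon>"
    and corner_fib: "i \<in> cof m \<Longrightarrow> p \<in> fib m \<Longrightarrow>
      Kan_fibration (Map M (Cod (und M) i) (Dom (und M) p)) (corner_sset M i p) (corner_map M i p)"
    and corner_trivial: "i \<in> cof m \<Longrightarrow> p \<in> fib m \<Longrightarrow> i \<in> weq m \<or> p \<in> weq m \<Longrightarrow>
      trivial_Kan_fibration (Map M (Cod (und M) i) (Dom (und M) p)) (corner_sset M i p) (corner_map M i p)"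

locale pointed_simplicial_model_category = simplicial_model_category M m
  for M :: "('o, 's, 'u) simp_cat" and m +
  assumes pointed: "\<exists>Z. zero_object (und M) Z"
    and smash: "X \<in> Obj M \<Longrightarrow> pointed_sset K \<Longrightarrow> is_smash M X K (smash M X K) (smash_unit M X K)"

definition ps_cg_model_category :: "('o, 's, 'u) simp_cat \<Rightarrow> ('o \<times> 'o \<times> 's) model \<Rightarrow> bool" where
  "ps_cg_model_category M m \<longleftrightarrow>
     pointed_simplicial_model_category M m \<and> cofibrantly_generated TYPE('u) (und M) m"

section \<open>The cubes \<open>\<X>\<^sub>X\<close>\<close>

text \<open>\<open>f \<and> \<phi> : X \<and> K \<rightarrow> X' \<and> L\<close> for an arrow \<open>f : X \<rightarrow> X'\<close> and a pointed map \<open>\<phi> : K \<rightarrow> L\<close>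
  is the arrow corresponding to \<open>K \<rightarrow> L \<rightarrow> Map(X', X' \<and> L) \<rightarrow> Map(X, X' \<and> L)\<close>.\<close>

definition smash_map :: "('o, 's, 'u) simp_cat \<Rightarrow> 'o \<times> 'o \<times> 's \<Rightarrow> 'u univ psset \<Rightarrow> 'u univ psset \<Rightarrow>
    (nat \<Rightarrow> 'u univ \<Rightarrow> 'u univ) \<Rightarrow> 'o \<times> 'o \<times> 's" where
  "smash_map M f K L \<phi> =
     (let X = Dom (und M) f; X' = Cod (und M) f; T = smash M X K; T' = smash M X' L in
      THE g. g \<in> hom (und M) T T' \<and>
        (\<forall>n. \<forall>k \<in> simplices K n.
           scomp M X T T' n (dgn (Map M T T') n (vtx g)) (smash_unit M X K n k) =
           scomp M X X' T' n (smash_unit M X' L n (\<phi> n k)) (dgn (Map M X X') n (vtx f))))"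

definition Cone :: "('o, 's, 'u) simp_cat \<Rightarrow> 'o \<Rightarrow> 'o" where
  "Cone M X = smash M X interval"

definition Cone_map :: "('o, 's, 'u) simp_cat \<Rightarrow> 'o \<times> 'o \<times> 's \<Rightarrow> 'o \<times> 'o \<times> 's" where
  "Cone_map M f = smash_map M f interval interval (\<lambda>n x. x)"

text \<open>\<open>c\<^sub>X\<close> is \<open>X \<and> ({0, 1}, {0}) \<rightarrow> X \<and> (\<Delta>\<^sup>1, {0})\<close>, precomposed with the unit isomorphism
  \<open>X \<cong> X \<and> ({0, 1}, {0})\<close>, which is the value of the universal map at the non-base vertex.\<close>

definition smash_unit_iso :: "('o, 's, 'u) simp_cat \<Rightarrow> 'o \<Rightarrow> 'o \<times> 'o \<times> 's" where
  "smash_unit_iso M X = (X, smash M X endpoints, smash_unit M X endpoints 0 (Inl [1]))"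

definition Cone_incl :: "('o, 's, 'u) simp_cat \<Rightarrow> 'o \<Rightarrow> 'o \<times> 'o \<times> 's" where
  "Cone_incl M X =
     Comp (und M) (smash_map M (Idn (und M) X) endpoints interval (\<lambda>n x. x)) (smash_unit_iso M X)"

definition subsets_cat :: "'e set \<Rightarrow> ('e set, 'e set \<times> 'e set) cat" where
  "subsets_cat S = poset_cat (Pow S) (\<subseteq>)"

definition subsets_le1_cat :: "'e set \<Rightarrow> ('e set, 'e set \<times> 'e set) cat" where
  "subsets_le1_cat S = poset_cat {U \<in> Pow S. finite U \<and> card U \<le> 1} (\<subseteq>)"

definition Cone_diagram :: "('o, 's, 'u) simp_cat \<Rightarrow> 'o \<Rightarrow> ('e set, 'e set \<times> 'e set, 'o, 'o \<times> 'o \<times> 's) fctr" where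
  "Cone_diagram M X = \<lparr>
     onOb = (\<lambda>U. if U = {} then X else Cone M X),
     onAr = (\<lambda>(U, V). if U = V then Idn (und M) (if U = {} then X else Cone M X) else Cone_incl M X)\<rparr>"

definition Cone_diagram_map :: "('o, 's, 'u) simp_cat \<Rightarrow> 'o \<times> 'o \<times> 's \<Rightarrow> 'e set \<Rightarrow> 'o \<times> 'o \<times> 's" where
  "Cone_diagram_map M f U = (if U = {} then f else Cone_map M f)"

text \<open>\<open>is_cube M S \<X> \<eta>\<close>: for each \<open>X\<close>, \<open>\<X> X\<close> with \<open>\<eta> X\<close> is a left Kan extension of the cone
  diagram of \<open>X\<close>.\<close>

definition is_cube :: "('o, 's, 'u) simp_cat \<Rightarrow> 'e set \<Rightarrow>
    ('o \<Rightarrow> ('e set, 'e set \<times> 'e set, 'o, 'o \<times> 'o \<times> 's) fctr) \<Rightarrow>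
    ('o \<Rightarrow> 'e set \<Rightarrow> 'o \<times> 'o \<times> 's) \<Rightarrow> bool" where
  "is_cube M S \<X> \<eta> \<longleftrightarrow> (\<forall>X \<in> Obj M.
     is_left_Kan_extension (subsets_le1_cat S) (subsets_cat S) (und M) inclusion (Cone_diagram M X) (\<X> X) (\<eta> X))"

text \<open>Functoriality of the cubes in \<open>X\<close>: \<open>\<X>\<^sub>f\<close> is the natural transformation induced on left Kan
  extensions by \<open>f\<close>.\<close>

definition cube_map :: "('o, 's, 'u) simp_cat \<Rightarrow> 'e set \<Rightarrow>
    ('o \<Rightarrow> ('e set, 'e set \<times> 'e set, 'o, 'o \<times> 'o \<times> 's) fctr) \<Rightarrow>
    ('o \<Rightarrow> 'e set \<Rightarrow> 'o \<times> 'o \<times> 's) \<Rightarrow> 'o \<times> 'o \<times> 's \<Rightarrow> 'e set \<Rightarrow> 'o \<times> 'o \<times> 's" where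
  "cube_map M S \<X> \<eta> f =
     (let X = Dom (und M) f; X' = Cod (und M) f in
      THE \<alpha>. nat_trans (subsets_cat S) (und M) (\<X> X) (\<X> X') \<alpha> \<and>
        (\<forall>U \<in> Ob (subsets_le1_cat S).
           Comp (und M) (\<alpha> U) (\<eta> X U) = Comp (und M) (\<eta> X' U) (Cone_diagram_map M f U)))"

text \<open>The functor \<open>(U, V) \<mapsto> \<X>\<^bsub>\<X>\<^sub>X(U)\<^esub>(V)\<close> on \<open>\<P>(S) \<times> \<P>(S)\<close>, and its effect on
  an arrow \<open>f\<close> in the variable \<open>X\<close>.\<close>

definition double_cube :: "('o, 's, 'u) simp_cat \<Rightarrow> 'e set \<Rightarrow>
    ('o \<Rightarrow> ('e set, 'e set \<times> 'e set, 'o, 'o \<times> 'o \<times> 's) fctr) \<Rightarrow>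
    ('o \<Rightarrow> 'e set \<Rightarrow> 'o \<times> 'o \<times> 's) \<Rightarrow> 'o \<Rightarrow>
    ('e set \<times> 'e set, ('e set \<times> 'e set) \<times> ('e set \<times> 'e set), 'o, 'o \<times> 'o \<times> 's) fctr" where
  "double_cube M S \<X> \<eta> X = \<lparr>
     onOb = (\<lambda>(U, V). onOb (\<X> (onOb (\<X> X) U)) V),
     onAr = (\<lambda>((U, U'), (V, V')).
       Comp (und M) (cube_map M S \<X> \<eta> (onAr (\<X> X) (U, U')) V')
                    (onAr (\<X> (onOb (\<X> X) U)) (V, V')))\<rparr>"

definition double_cube_map :: "('o, 's, 'u) simp_cat \<Rightarrow> 'e set \<Rightarrow>
    ('o \<Rightarrow> ('e set, 'e set \<times> 'e set, 'o, 'o \<times> 'o \<times> 's) fctr) \<Rightarrow>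
    ('o \<Rightarrow> 'e set \<Rightarrow> 'o \<times> 'o \<times> 's) \<Rightarrow> 'o \<times> 'o \<times> 's \<Rightarrow> 'e set \<times> 'e set \<Rightarrow> 'o \<times> 'o \<times> 's" where
  "double_cube_map M S \<X> \<eta> f = (\<lambda>(U, V). cube_map M S \<X> \<eta> (cube_map M S \<X> \<eta> f U) V)"

end

theory Submission
  imports Defs
begin

text \<open>Write \<open>C\<^sub>A(X)\<close> for \<open>X\<close> if \<open>A\<close> is empty and for \<open>C(X)\<close> if \<open>A\<close> is a singleton. The functor
  \<open>C\<close> preserves left Kan extensions: arrows \<open>C(X) \<rightarrow> Y\<close> correspond to the arrows \<open>X \<rightarrow> Y\<^sup>I\<close> into
  the cotensor with the interval whose value at the vertex \<open>0\<close> is zero. Hence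
  \<open>(U, V) \<mapsto> \<X>\<^bsub>\<X>\<^sub>X(U)\<^esub>(V)\<close> is a left Kan extension of \<open>(A, B) \<mapsto> C\<^sub>B(C\<^sub>A(X))\<close>, defined for \<open>A\<close> and \<open>B\<close>
  of cardinality at most one. The symmetry of the smash product gives an involution of \<open>C(C(X))\<close>
  that exchanges \<open>C(c\<^sub>X)\<close> and \<open>c\<^bsub>C(X)\<^esub>\<close>. It identifies this diagram with its transpose, naturally in
  \<open>X\<close>, and the universal property transports the identification to the Kan extensions.\<close>

section \<open>Natural families and Kan extensions\<close>

text \<open>Kan extensions are given here only by their global universal property, without a colimit
  formula at each subset, so preservation by the cone has to be proved by transposing whole
  extension problems. The true right adjoint of the cone is the object of paths starting at zero, a
  subobject of the cotensor. It is not built: the full cotensor is kept, and starting at zero is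
  treated as an equation between natural families, which uniqueness for Kan extensions carries from
  small subsets to all subsets.

  A second obstacle is that the zero object is assumed only for the underlying category, while the
  symmetry of C(C(X)) must be defined on simplices of every degree, since maps out of C(C(X)) are
  given by families in which an inner and an outer simplex vary together. Representing paths by
  arrows into cotensors or out of cones reduces the vanishing of higher simplices to the uniqueness
  of arrows to and from a zero object.\<close>

lemma (in category) paste_squares:
  assumes "f \<in> hom C X Y" "g \<in> hom C Y Z" "f' \<in> hom C X' Y'" "g' \<in> hom C Y' Z'"
    and "r \<in> hom C X X'" "s \<in> hom C Y Y'" "t \<in> hom C Z Z'"
    and "Comp C s f = Comp C f' r" "Comp C t g = Comp C g' s"
  shows "Comp C t (Comp C g f) = Comp C (Comp C g' f') r"
proof -
  have "Comp C t (Comp C g f) = Comp C (Comp C g' s) f"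
    using comp_assoc[OF assms(1,2,7)] assms(9) by simp
  also have "\<dots> = Comp C g' (Comp C f' r)"
    using comp_assoc[OF assms(1,6,4)] assms(8) by simp
  also have "\<dots> = Comp C (Comp C g' f') r"
    using comp_assoc[OF assms(5,3,4)] .
  finally show ?thesis .
qed

text \<open>This is \<open>nat_trans\<close> minus the functor conditions and the
  \<open>extensional\<close> normalization, so that families can be given by plain lambda terms and
  compared on objects only. \<open>natural_nat_trans\<close> restricts them where the official
  notion is required.\<close>

definition natural :: "('o, 'a) cat \<Rightarrow> ('p, 'b) cat \<Rightarrow> ('o, 'a, 'p, 'b) fctr \<Rightarrow>
    ('o, 'a, 'p, 'b) fctr \<Rightarrow> ('o \<Rightarrow> 'b) \<Rightarrow> bool" where
  "natural A B F G t \<longleftrightarrow>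
     (\<forall>X \<in> Ob A. t X \<in> hom B (onOb F X) (onOb G X)) \<and>
     (\<forall>X Y. \<forall>f \<in> hom A X Y. Comp B (t Y) (onAr F f) = Comp B (onAr G f) (t X))"

lemma naturalI:
  assumes "\<And>X. X \<in> Ob A \<Longrightarrow> t X \<in> hom B (onOb F X) (onOb G X)"
    and "\<And>X Y f. f \<in> hom A X Y \<Longrightarrow> Comp B (t Y) (onAr F f) = Comp B (onAr G f) (t X)"
  shows "natural A B F G t"
  using assms by (auto simp: natural_def)

lemma natural_in: "natural A B F G t \<Longrightarrow> X \<in> Ob A \<Longrightarrow> t X \<in> hom B (onOb F X) (onOb G X)"
  by (simp add: natural_def)

lemma natural_sq: "natural A B F G t \<Longrightarrow> f \<in> hom A X Y \<Longrightarrow>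
    Comp B (t Y) (onAr F f) = Comp B (onAr G f) (t X)"
  by (auto simp: natural_def)

lemma natural_cong:
  assumes "category A" "natural A B F G s" "\<And>X. X \<in> Ob A \<Longrightarrow> s X = t X"
  shows "natural A B F G t"
proof -
  interpret category A by fact
  show ?thesis
    using assms(2,3) dom_in cod_in unfolding natural_def hom_def by fastforce
qed

lemma nat_trans_natural: "nat_trans A B F G t \<Longrightarrow> natural A B F G t"
  by (simp add: natural_def nat_trans.component nat_trans.naturality)

lemma natural_nat_trans:
  assumes "is_functor A B F" "is_functor A B G" "natural A B F G t"
  shows "nat_trans A B F G (restrict t (Ob A))"
proof -
  interpret F: is_functor A B F by fact
  interpret G: is_functor A B G by fact
  show ?thesis
    using assms(3) F.A.dom_in F.A.cod_in
    by unfold_locales (auto simp: natural_def hom_def)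
qed

lemma comp_fctr_simps [simp]:
  "onOb (comp_fctr G F) X = onOb G (onOb F X)" "onAr (comp_fctr G F) f = onAr G (onAr F f)"
  by (simp_all add: comp_fctr_def)

lemma inclusion_simps [simp]: "onOb inclusion X = X" "onAr inclusion f = f"
  by (simp_all add: inclusion_def)

lemma is_functor_comp:
  assumes "is_functor A B F" "is_functor B C G"
  shows "is_functor A C (comp_fctr G F)"
proof -
  interpret F: is_functor A B F by fact
  interpret G: is_functor B C G by fact
  show ?thesis
    by unfold_locales
      (simp_all add: F.ob_in G.ob_in G.ar_in[OF F.ar_in] F.pres_idn G.pres_idn F.pres_comp
        G.pres_comp[OF F.ar_in F.ar_in])
qed

lemma natural_comp:
  assumes F: "is_functor A B F" and G: "is_functor A B G" and H: "is_functor A B H"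
    and s: "natural A B F G s" and t: "natural A B G H t"
  shows "natural A B F H (\<lambda>X. Comp B (t X) (s X))"
proof (rule naturalI)
  interpret F: is_functor A B F by fact
  interpret G: is_functor A B G by fact
  interpret H: is_functor A B H by fact
  fix X assume "X \<in> Ob A"
  then show "Comp B (t X) (s X) \<in> hom B (onOb F X) (onOb H X)"
    using F.B.comp_in natural_in[OF s] natural_in[OF t] by blast
next
  interpret F: is_functor A B F by fact
  interpret G: is_functor A B G by fact
  interpret H: is_functor A B H by fact
  fix X Y f assume f: "f \<in> hom A X Y"
  then have X: "X \<in> Ob A" and Y: "Y \<in> Ob A"
    using F.A.dom_in F.A.cod_in by (auto simp: hom_def)
  note h = natural_in[OF s X] natural_in[OF s Y] natural_in[OF t X] natural_in[OF t Y]
    F.ar_in[OF f] G.ar_in[OF f] H.ar_in[OF f]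
  show "Comp B (Comp B (t Y) (s Y)) (onAr F f) = Comp B (onAr H f) (Comp B (t X) (s X))"
    using F.B.paste_squares[OF h(1,3,2,4) h(5-7)] natural_sq[OF s f] natural_sq[OF t f] by simp
qed

lemma natural_whisker_right:
  assumes "is_functor A B K" "natural B C F G t"
  shows "natural A C (comp_fctr F K) (comp_fctr G K) (\<lambda>X. t (onOb K X))"
proof -
  interpret K: is_functor A B K by fact
  show ?thesis
    by (rule naturalI) (simp_all add: natural_in[OF assms(2)] K.ob_in natural_sq[OF assms(2) K.ar_in])
qed

lemma natural_whisker_left:
  assumes "is_functor A B F" "is_functor A B G" "is_functor B C H" "natural A B F G t"
  shows "natural A C (comp_fctr H F) (comp_fctr H G) (\<lambda>X. onAr H (t X))"
proof (rule naturalI)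
  interpret H: is_functor B C H by fact
  fix X assume "X \<in> Ob A"
  then show "onAr H (t X) \<in> hom C (onOb (comp_fctr H F) X) (onOb (comp_fctr H G) X)"
    using natural_in[OF assms(4)] H.ar_in by simp
next
  interpret F: is_functor A B F by fact
  interpret G: is_functor A B G by fact
  interpret H: is_functor B C H by fact
  fix X Y f assume f: "f \<in> hom A X Y"
  then have X: "X \<in> Ob A" and Y: "Y \<in> Ob A"
    using F.A.dom_in F.A.cod_in by (auto simp: hom_def)
  show "Comp C (onAr H (t Y)) (onAr (comp_fctr H F) f) =
      Comp C (onAr (comp_fctr H G) f) (onAr H (t X))"
    using natural_sq[OF assms(4) f] H.pres_comp[OF F.ar_in[OF f] natural_in[OF assms(4) Y]]
      H.pres_comp[OF natural_in[OF assms(4) X] G.ar_in[OF f]]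
    by simp
qed

section \<open>The universal property of left Kan extensions for natural families\<close>

lemma lan_ex:
  assumes "is_left_Kan_extension A B C K D F \<eta>" "is_functor B C G"
    and "natural A C D (comp_fctr G K) \<gamma>"
  obtains \<alpha> where "natural B C F G \<alpha>" "\<And>a. a \<in> Ob A \<Longrightarrow> Comp C (\<alpha> (onOb K a)) (\<eta> a) = \<gamma> a"
proof -
  have K: "is_functor A B K" and D: "is_functor A C D"
    using assms(1) nat_trans.axioms(1) by (auto simp: is_left_Kan_extension_def)
  have "nat_trans A C D (comp_fctr G K) (restrict \<gamma> (Ob A))"
    using natural_nat_trans[OF D is_functor_comp[OF K assms(2)] assms(3)] .
  then have "\<exists>\<alpha>. nat_trans B C F G \<alpha> \<and>
      (\<forall>a \<in> Ob A. Comp C (\<alpha> (onOb K a)) (\<eta> a) = restrict \<gamma> (Ob A) a)"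
    using assms(1,2) unfolding is_left_Kan_extension_def by blast
  then show thesis
    using that nat_trans_natural by (metis restrict_apply')
qed

text \<open>Both families, once restricted, solve the extension problem whose datum
  \<open>\<gamma>\<close> is the composite of \<open>\<alpha>\<close> with the unit, and that
  problem has exactly one solution. This is the main device for proving equations between arrows out
  of a cube: check them after the unit.\<close>

lemma lan_unique:
  assumes L: "is_left_Kan_extension A B C K D F \<eta>" and G: "is_functor B C G"
    and \<alpha>: "natural B C F G \<alpha>" and \<beta>: "natural B C F G \<beta>"
    and eq: "\<And>a. a \<in> Ob A \<Longrightarrow> Comp C (\<alpha> (onOb K a)) (\<eta> a) = Comp C (\<beta> (onOb K a)) (\<eta> a)"
    and b: "b \<in> Ob B"
  shows "\<alpha> b = \<beta> b"
proof -
  have K: "is_functor A B K" and F: "is_functor B C F" and \<eta>: "nat_trans A C D (comp_fctr F K) \<eta>"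
    using L by (auto simp: is_left_Kan_extension_def)
  interpret K: is_functor A B K by fact
  have D: "is_functor A C D"
    using nat_trans.axioms(1)[OF \<eta>] .
  define \<gamma> where "\<gamma> = (\<lambda>a. Comp C (\<alpha> (onOb K a)) (\<eta> a))"
  have "natural A C D (comp_fctr G K) \<gamma>"
    unfolding \<gamma>_def
    using natural_comp[OF D is_functor_comp[OF K F] is_functor_comp[OF K G]
        nat_trans_natural[OF \<eta>] natural_whisker_right[OF K \<alpha>]] .
  then have "nat_trans A C D (comp_fctr G K) (restrict \<gamma> (Ob A))"
    using natural_nat_trans[OF D is_functor_comp[OF K G]] by blast
  then have ex1: "\<exists>!\<alpha>. nat_trans B C F G \<alpha> \<and>
      (\<forall>a \<in> Ob A. Comp C (\<alpha> (onOb K a)) (\<eta> a) = restrict \<gamma> (Ob A) a)"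
    using L G unfolding is_left_Kan_extension_def by blast
  have 1: "nat_trans B C F G (restrict \<alpha> (Ob B)) \<and>
      (\<forall>a \<in> Ob A. Comp C (restrict \<alpha> (Ob B) (onOb K a)) (\<eta> a) = restrict \<gamma> (Ob A) a)"
    using natural_nat_trans[OF F G \<alpha>] by (simp add: K.ob_in \<gamma>_def)
  have 2: "nat_trans B C F G (restrict \<beta> (Ob B)) \<and>
      (\<forall>a \<in> Ob A. Comp C (restrict \<beta> (Ob B) (onOb K a)) (\<eta> a) = restrict \<gamma> (Ob A) a)"
    using natural_nat_trans[OF F G \<beta>] eq by (simp add: K.ob_in \<gamma>_def)
  have "restrict \<alpha> (Ob B) = restrict \<beta> (Ob B)"
    using ex1 1 2 by blast
  then show ?thesis
    using b by (metis restrict_apply')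
qed

text \<open>Uniqueness is asked only objectwise on \<open>Ob B\<close>; extensionality of
  \<open>nat_trans\<close> upgrades it to equality of functions. The unit is restricted for the same
  reason.\<close>

lemma lanI:
  assumes K: "is_functor A B K" and D: "is_functor A C D" and F: "is_functor B C F"
    and \<eta>: "natural A C D (comp_fctr F K) \<eta>"
    and ex: "\<And>G \<gamma>. is_functor B C G \<Longrightarrow> natural A C D (comp_fctr G K) \<gamma> \<Longrightarrow>
      \<exists>\<alpha>. natural B C F G \<alpha> \<and> (\<forall>a \<in> Ob A. Comp C (\<alpha> (onOb K a)) (\<eta> a) = \<gamma> a)"
    and unique: "\<And>G \<alpha> \<beta> b. is_functor B C G \<Longrightarrow> natural B C F G \<alpha> \<Longrightarrow> natural B C F G \<beta> \<Longrightarrow>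
      (\<forall>a \<in> Ob A. Comp C (\<alpha> (onOb K a)) (\<eta> a) = Comp C (\<beta> (onOb K a)) (\<eta> a)) \<Longrightarrow>
      b \<in> Ob B \<Longrightarrow> \<alpha> b = \<beta> b"
  shows "is_left_Kan_extension A B C K D F (restrict \<eta> (Ob A))"
  unfolding is_left_Kan_extension_def
proof (intro conjI allI impI)
  interpret K: is_functor A B K by fact
  show "nat_trans A C D (comp_fctr F K) (restrict \<eta> (Ob A))"
    using natural_nat_trans[OF D is_functor_comp[OF K F] \<eta>] .
  fix G \<gamma>
  assume G: "is_functor B C G" and "nat_trans A C D (comp_fctr G K) \<gamma>"
  then obtain \<alpha> where \<alpha>: "natural B C F G \<alpha>" "\<forall>a \<in> Ob A. Comp C (\<alpha> (onOb K a)) (\<eta> a) = \<gamma> a"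
    using ex nat_trans_natural by blast
  show "\<exists>!\<alpha>. nat_trans B C F G \<alpha> \<and>
      (\<forall>a \<in> Ob A. Comp C (\<alpha> (onOb K a)) (restrict \<eta> (Ob A) a) = \<gamma> a)"
  proof (rule ex1I[of _ "restrict \<alpha> (Ob B)"])
    show "nat_trans B C F G (restrict \<alpha> (Ob B)) \<and>
        (\<forall>a \<in> Ob A. Comp C (restrict \<alpha> (Ob B) (onOb K a)) (restrict \<eta> (Ob A) a) = \<gamma> a)"
      using natural_nat_trans[OF F G \<alpha>(1)] \<alpha>(2) by (simp add: K.ob_in)
  next
    fix \<beta>
    assume \<beta>: "nat_trans B C F G \<beta> \<and>
        (\<forall>a \<in> Ob A. Comp C (\<beta> (onOb K a)) (restrict \<eta> (Ob A) a) = \<gamma> a)"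
    then have "\<beta> b = \<alpha> b" if "b \<in> Ob B" for b
      using unique[OF G nat_trans_natural \<alpha>(1)] \<alpha>(2) that by simp
    moreover have "\<beta> \<in> extensional (Ob B)"
      using \<beta> nat_trans.ext by blast
    ultimately show "\<beta> = restrict \<alpha> (Ob B)"
      by (intro extensionalityI) auto
  qed
qed (use K F in auto)

section \<open>Functors of two variables, one variable at a time\<close>

definition fix_left :: "('o, 'a) cat \<Rightarrow> ('o \<times> 'p, 'a \<times> 'b, 'q, 'c) fctr \<Rightarrow> 'o \<Rightarrow> ('p, 'b, 'q, 'c) fctr" where
  "fix_left A G X = \<lparr>onOb = (\<lambda>Y. onOb G (X, Y)), onAr = (\<lambda>g. onAr G (Idn A X, g))\<rparr>"

definition fix_right :: "('p, 'b) cat \<Rightarrow> ('o \<times> 'p, 'a \<times> 'b, 'q, 'c) fctr \<Rightarrow> 'p \<Rightarrow> ('o, 'a, 'q, 'c) fctr" where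
  "fix_right B G Y = \<lparr>onOb = (\<lambda>X. onOb G (X, Y)), onAr = (\<lambda>f. onAr G (f, Idn B Y))\<rparr>"

lemma fix_simps [simp]:
  "onOb (fix_left A G X) Y = onOb G (X, Y)" "onAr (fix_left A G X) g = onAr G (Idn A X, g)"
  "onOb (fix_right B G Y) X = onOb G (X, Y)" "onAr (fix_right B G Y) f = onAr G (f, Idn B Y)"
  by (simp_all add: fix_left_def fix_right_def)

lemma prod_cat_simps [simp]:
  "Ob (prod_cat A B) = Ob A \<times> Ob B"
  "(f, g) \<in> hom (prod_cat A B) (X, Y) (X', Y') \<longleftrightarrow> f \<in> hom A X X' \<and> g \<in> hom B Y Y'"
  "Idn (prod_cat A B) (X, Y) = (Idn A X, Idn B Y)"
  "Comp (prod_cat A B) (f', g') (f, g) = (Comp A f' f, Comp B g' g)"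
  by (auto simp: prod_cat_def hom_def)

lemma hom_prod_cat: "hom (prod_cat A B) (X, Y) (X', Y') = hom A X X' \<times> hom B Y Y'"
  by auto

lemma category_prod_cat:
  assumes "category A" "category B"
  shows "category (prod_cat A B)"
proof -
  interpret A: category A by fact
  interpret B: category B by fact
  show ?thesis
  proof
    show "Dom (prod_cat A B) f \<in> Ob (prod_cat A B)" "Cod (prod_cat A B) f \<in> Ob (prod_cat A B)"
      if "f \<in> Ar (prod_cat A B)" for f
      using that A.dom_in A.cod_in B.dom_in B.cod_in by (auto simp: prod_cat_def)
  qed (auto intro: A.idn_in B.idn_in A.comp_in B.comp_in simp: hom_prod_cat A.idn_left B.idn_left
      A.idn_right B.idn_right A.comp_assoc B.comp_assoc)
qed

lemma is_functor_fix_left: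
  assumes "category A" "category B" "is_functor (prod_cat A B) C G" "X \<in> Ob A"
  shows "is_functor B C (fix_left A G X)"
proof -
  interpret A: category A by fact
  interpret B: category B by fact
  interpret G: is_functor "prod_cat A B" C G by fact
  have i: "Idn A X \<in> hom A X X"
    using assms(4) A.idn_in by blast
  show ?thesis
  proof
    show "onOb (fix_left A G X) Y \<in> Ob C" if "Y \<in> Ob B" for Y
      using G.ob_in[of "(X, Y)"] that assms(4) by simp
    show "onAr (fix_left A G X) f \<in> hom C (onOb (fix_left A G X) Y) (onOb (fix_left A G X) Z)"
      if "f \<in> hom B Y Z" for f Y Z
      using G.ar_in[of "(Idn A X, f)" "(X, Y)" "(X, Z)"] that i by simp
    show "onAr (fix_left A G X) (Idn B Y) = Idn C (onOb (fix_left A G X) Y)" if "Y \<in> Ob B" for Y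
      using G.pres_idn[of "(X, Y)"] that assms(4) by simp
    show "onAr (fix_left A G X) (Comp B g f) = Comp C (onAr (fix_left A G X) g) (onAr (fix_left A G X) f)"
      if "f \<in> hom B Y Z" "g \<in> hom B Z W" for f g Y Z W
      using G.pres_comp[of "(Idn A X, f)" "(X, Y)" "(X, Z)" "(Idn A X, g)" "(X, W)"] that i
      by (simp add: A.idn_left[OF i])
  qed
qed

lemma is_functor_fix_right:
  assumes "category A" "category B" "is_functor (prod_cat A B) C G" "Y \<in> Ob B"
  shows "is_functor A C (fix_right B G Y)"
proof -
  interpret A: category A by fact
  interpret B: category B by fact
  interpret G: is_functor "prod_cat A B" C G by fact
  have i: "Idn B Y \<in> hom B Y Y"
    using assms(4) B.idn_in by blast
  show ?thesis
  proof
    show "onOb (fix_right B G Y) X \<in> Ob C" if "X \<in> Ob A" for X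
      using G.ob_in[of "(X, Y)"] that assms(4) by simp
    show "onAr (fix_right B G Y) f \<in> hom C (onOb (fix_right B G Y) X) (onOb (fix_right B G Y) Z)"
      if "f \<in> hom A X Z" for f X Z
      using G.ar_in[of "(f, Idn B Y)" "(X, Y)" "(Z, Y)"] that i by simp
    show "onAr (fix_right B G Y) (Idn A X) = Idn C (onOb (fix_right B G Y) X)" if "X \<in> Ob A" for X
      using G.pres_idn[of "(X, Y)"] that assms(4) by simp
    show "onAr (fix_right B G Y) (Comp A g f) = Comp C (onAr (fix_right B G Y) g) (onAr (fix_right B G Y) f)"
      if "f \<in> hom A X Z" "g \<in> hom A Z W" for f g X Z W
      using G.pres_comp[of "(f, Idn B Y)" "(X, Y)" "(Z, Y)" "(g, Idn B Y)" "(W, Y)"] that i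
      by (simp add: B.idn_left[OF i])
  qed
qed

lemma natural_fix_left:
  assumes "category A" "natural (prod_cat A B) C F G t" "X \<in> Ob A"
  shows "natural B C (fix_left A F X) (fix_left A G X) (\<lambda>Y. t (X, Y))"
proof -
  interpret A: category A by fact
  show ?thesis
    using natural_in[OF assms(2)] natural_sq[OF assms(2)] A.idn_in[OF assms(3)] assms(3)
    by (intro naturalI) simp_all
qed

lemma natural_fix_right:
  assumes "category B" "natural (prod_cat A B) C F G t" "Y \<in> Ob B"
  shows "natural A C (fix_right B F Y) (fix_right B G Y) (\<lambda>X. t (X, Y))"
proof -
  interpret B: category B by fact
  show ?thesis
    using natural_in[OF assms(2)] natural_sq[OF assms(2)] B.idn_in[OF assms(3)] assms(3)
    by (intro naturalI) simp_all
qed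

text \<open>Naturality in each variable separately suffices, because every arrow (f, g) of the
  product factors as (f, 1) after (1, g), and the two squares can be pasted.\<close>

lemma natural_prodI:
  assumes "category A" "category B" "is_functor (prod_cat A B) C F" "is_functor (prod_cat A B) C G"
    and l: "\<And>X. X \<in> Ob A \<Longrightarrow> natural B C (fix_left A F X) (fix_left A G X) (\<lambda>Y. t (X, Y))"
    and r: "\<And>Y. Y \<in> Ob B \<Longrightarrow> natural A C (fix_right B F Y) (fix_right B G Y) (\<lambda>X. t (X, Y))"
  shows "natural (prod_cat A B) C F G t"
proof (rule naturalI)
  fix p assume "p \<in> Ob (prod_cat A B)"
  then show "t p \<in> hom C (onOb F p) (onOb G p)"
    using natural_in[OF l] by (cases p) simp
next
  interpret A: category A by fact
  interpret B: category B by fact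
  interpret F: is_functor "prod_cat A B" C F by fact
  interpret G: is_functor "prod_cat A B" C G by fact
  fix p q h assume h: "h \<in> hom (prod_cat A B) p q"
  obtain X Y X' Y' f g where e: "p = (X, Y)" "q = (X', Y')" "h = (f, g)"
    by (metis surj_pair)
  with h have f: "f \<in> hom A X X'" and g: "g \<in> hom B Y Y'"
    by simp_all
  then have ob: "X \<in> Ob A" "X' \<in> Ob A" "Y \<in> Ob B" "Y' \<in> Ob B"
    using A.dom_in A.cod_in B.dom_in B.cod_in by (auto simp: hom_def)
  have f1: "(f, Idn B Y') \<in> hom (prod_cat A B) (X, Y') (X', Y')"
    and g1: "(Idn A X, g) \<in> hom (prod_cat A B) (X, Y) (X, Y')"
    using f g ob A.idn_in B.idn_in by simp_all
  have h': "h = Comp (prod_cat A B) (f, Idn B Y') (Idn A X, g)"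
    using e A.idn_right[OF f] B.idn_left[OF g] by simp
  have Fh: "onAr F h = Comp C (onAr F (f, Idn B Y')) (onAr F (Idn A X, g))"
    and Gh: "onAr G h = Comp C (onAr G (f, Idn B Y')) (onAr G (Idn A X, g))"
    using F.pres_comp[OF g1 f1] G.pres_comp[OF g1 f1] h' by simp_all
  have sq: "Comp C (t (X, Y')) (onAr F (Idn A X, g)) = Comp C (onAr G (Idn A X, g)) (t (X, Y))"
    "Comp C (t (X', Y')) (onAr F (f, Idn B Y')) = Comp C (onAr G (f, Idn B Y')) (t (X, Y'))"
    using natural_sq[OF l g] natural_sq[OF r f] ob by simp_all
  have t: "t (X, Y) \<in> hom C (onOb F (X, Y)) (onOb G (X, Y))"
    "t (X, Y') \<in> hom C (onOb F (X, Y')) (onOb G (X, Y'))"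
    "t (X', Y') \<in> hom C (onOb F (X', Y')) (onOb G (X', Y'))"
    using natural_in[OF l] ob by simp_all
  show "Comp C (t q) (onAr F h) = Comp C (onAr G h) (t p)"
    unfolding Fh Gh e(1,2)
    by (rule F.B.paste_squares[OF F.ar_in[OF g1] F.ar_in[OF f1] G.ar_in[OF g1] G.ar_in[OF f1] t sq])
qed

lemma hom_poset_cat:
  "u \<in> hom (poset_cat P le) x y \<longleftrightarrow> u = (x, y) \<and> x \<in> P \<and> y \<in> P \<and> le x y"
  by (auto simp: hom_def poset_cat_def)

lemma category_poset_cat:
  assumes refl: "\<And>x. x \<in> P \<Longrightarrow> le x x"
    and trans: "\<And>x y z. x \<in> P \<Longrightarrow> y \<in> P \<Longrightarrow> z \<in> P \<Longrightarrow> le x y \<Longrightarrow> le y z \<Longrightarrow> le x z"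
  shows "category (poset_cat P le)"
proof
  fix x y z f g
  assume f: "f \<in> hom (poset_cat P le) x y" and g: "g \<in> hom (poset_cat P le) y z"
  then have "le x z"
    unfolding hom_poset_cat using trans by blast
  with f g show "Comp (poset_cat P le) g f \<in> hom (poset_cat P le) x z"
    unfolding hom_poset_cat by (simp add: poset_cat_def)
next
  fix x assume "x \<in> Ob (poset_cat P le)"
  then show "Idn (poset_cat P le) x \<in> hom (poset_cat P le) x x"
    unfolding hom_poset_cat using refl by (simp add: poset_cat_def)
qed (unfold hom_poset_cat, auto simp: poset_cat_def)

text \<open>Functors are records of total functions, so two of them that agree on \<open>A\<close>
  need not be equal. This transfers naturality when only their values on \<open>A\<close> agree, for
  instance between a cube and the double cube with one variable fixed.\<close>

lemma natural_fctr_cong: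
  assumes "category A" "natural A B F G t"
    and "\<And>X. X \<in> Ob A \<Longrightarrow> onOb F X = onOb F' X" "\<And>X Y f. f \<in> hom A X Y \<Longrightarrow> onAr F f = onAr F' f"
    and "\<And>X. X \<in> Ob A \<Longrightarrow> onOb G X = onOb G' X" "\<And>X Y f. f \<in> hom A X Y \<Longrightarrow> onAr G f = onAr G' f"
  shows "natural A B F' G' t"
proof (rule naturalI)
  show "t X \<in> hom B (onOb F' X) (onOb G' X)" if "X \<in> Ob A" for X
    using natural_in[OF assms(2) that] assms(3,5) that by simp
  show "Comp B (t Y) (onAr F' f) = Comp B (onAr G' f) (t X)" if "f \<in> hom A X Y" for X Y f
    using natural_sq[OF assms(2) that] assms(4)[OF that] assms(6)[OF that] by simp
qed

text \<open>Both composites of the square are the value of \<open>G\<close> at the single arrow (u,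
  f).\<close>

lemma natural_arrow_left:
  assumes "category A" "category B" "is_functor (prod_cat A B) C G" "u \<in> hom A X X'"
  shows "natural B C (fix_left A G X) (fix_left A G X') (\<lambda>Y. onAr G (u, Idn B Y))"
proof (rule naturalI)
  interpret A: category A by fact
  interpret B: category B by fact
  interpret G: is_functor "prod_cat A B" C G by fact
  have X: "X \<in> Ob A" "X' \<in> Ob A"
    using assms(4) A.dom_in A.cod_in by (auto simp: hom_def)
  show "onAr G (u, Idn B Y) \<in> hom C (onOb (fix_left A G X) Y) (onOb (fix_left A G X') Y)" if "Y \<in> Ob B" for Y
    using G.ar_in[of "(u, Idn B Y)" "(X, Y)" "(X', Y)"] assms(4) B.idn_in[OF that] by simp
  fix Y Y' f assume f: "f \<in> hom B Y Y'"
  then have Y: "Y \<in> Ob B" "Y' \<in> Ob B"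
    using B.dom_in B.cod_in by (auto simp: hom_def)
  have "Comp C (onAr G (u, Idn B Y')) (onAr G (Idn A X, f)) = onAr G (u, f)"
    using G.pres_comp[of "(Idn A X, f)" "(X, Y)" "(X, Y')" "(u, Idn B Y')" "(X', Y')"]
      f assms(4) A.idn_in X B.idn_in Y A.idn_right[OF assms(4)] B.idn_left[OF f] by simp
  moreover have "Comp C (onAr G (Idn A X', f)) (onAr G (u, Idn B Y)) = onAr G (u, f)"
    using G.pres_comp[of "(u, Idn B Y)" "(X, Y)" "(X', Y)" "(Idn A X', f)" "(X', Y')"]
      f assms(4) A.idn_in X B.idn_in Y A.idn_left[OF assms(4)] B.idn_right[OF f] by simp
  ultimately show "Comp C (onAr G (u, Idn B Y')) (onAr (fix_left A G X) f) =
      Comp C (onAr (fix_left A G X') f) (onAr G (u, Idn B Y))"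
    by simp
qed

text \<open>The square is that of \<open>natural_arrow_left\<close>, with the fixed arrow and the
  varying arrow exchanged.\<close>

lemma natural_arrow_right:
  assumes "category A" "category B" "is_functor (prod_cat A B) C G" "v \<in> hom B Y Y'"
  shows "natural A C (fix_right B G Y) (fix_right B G Y') (\<lambda>X. onAr G (Idn A X, v))"
proof (rule naturalI)
  interpret A: category A by fact
  interpret B: category B by fact
  interpret G: is_functor "prod_cat A B" C G by fact
  show "onAr G (Idn A X, v) \<in> hom C (onOb (fix_right B G Y) X) (onOb (fix_right B G Y') X)" if "X \<in> Ob A" for X
    using G.ar_in[of "(Idn A X, v)" "(X, Y)" "(X, Y')"] assms(4) A.idn_in[OF that] by simp
  fix X X' f assume f: "f \<in> hom A X X'"
  then have X: "X \<in> Ob A" "X' \<in> Ob A"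
    using A.dom_in A.cod_in by (auto simp: hom_def)
  show "Comp C (onAr G (Idn A X', v)) (onAr (fix_right B G Y) f) =
      Comp C (onAr (fix_right B G Y') f) (onAr G (Idn A X, v))"
    using natural_sq[OF natural_arrow_left[OF assms(1-3) f] assms(4)] by simp
qed

lemma inclusion_comp [simp]: "comp_fctr inclusion F = F"
  by (simp add: comp_fctr_def inclusion_def comp_def)

lemma is_functor_swap:
  assumes "category A" "category B"
  shows "is_functor (prod_cat A B) (prod_cat B A) swap_functor"
proof -
  interpret AB: category "prod_cat A B" by (rule category_prod_cat) fact+
  interpret BA: category "prod_cat B A" by (rule category_prod_cat) fact+
  show ?thesis
    by unfold_locales (auto simp: swap_functor_def hom_prod_cat)
qed

lemma swap_simps [simp]: "onOb swap_functor (X, Y) = (Y, X)" "onAr swap_functor (f, g) = (g, f)"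
  by (simp_all add: swap_functor_def)

section \<open>Simplices of mapping spaces\<close>

lemma dmaps_iff: "\<theta> \<in> dmaps m n \<longleftrightarrow> length \<theta> = Suc m \<and>
    (\<forall>i j. i \<le> j \<longrightarrow> j \<le> m \<longrightarrow> \<theta> ! i \<le> \<theta> ! j) \<and> (\<forall>i \<le> m. \<theta> ! i \<le> n)"
  by (auto simp: dmaps_def sorted_iff_nth_mono all_set_conv_all_nth less_Suc_eq_le subset_code(1))

lemma dcomp_in: "\<theta> \<in> dmaps m n \<Longrightarrow> \<psi> \<in> dmaps k m \<Longrightarrow> dcomp \<theta> \<psi> \<in> dmaps k n"
  unfolding dmaps_iff by (simp add: dcomp_def less_Suc_eq_le)

lemma dcomp_assoc: "\<psi> \<in> dmaps k m \<Longrightarrow> \<chi> \<in> dmaps l k \<Longrightarrow> dcomp (dcomp \<theta> \<psi>) \<chi> = dcomp \<theta> (dcomp \<psi> \<chi>)"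
  by (auto simp: dmaps_def dcomp_def subset_iff less_Suc_eq_le)

lemma id_in_dmaps: "[0..<Suc n] \<in> dmaps n n"
  by (auto simp: dmaps_def simp del: upt_Suc)

lemma dcomp_id_right: "\<theta> \<in> dmaps n m \<Longrightarrow> dcomp \<theta> [0..<Suc n] = \<theta>"
  by (simp add: dmaps_def dcomp_def list_eq_iff_nth_eq del: upt_Suc)

lemma dmaps_0: "dmaps n 0 = {replicate (Suc n) 0}"
  by (auto simp: dmaps_def simp del: replicate_Suc intro: replicate_eqI)

lemma const_in_dmaps: "i \<le> m \<Longrightarrow> replicate (Suc n) i \<in> dmaps n m"
  by (auto simp: dmaps_def)

lemma dcomp_replicate: "\<psi> \<in> dmaps k n \<Longrightarrow> dcomp (replicate (Suc n) i) \<psi> = replicate (Suc k) i"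
  unfolding dmaps_iff dcomp_def
  by (simp add: list_eq_iff_nth_eq less_Suc_eq_le del: replicate_Suc)

lemma simplicial_set_std_simplex: "simplicial_set (std_simplex n)"
  by unfold_locales (auto simp: std_simplex_def dcomp_in dcomp_id_right dcomp_assoc simp del: upt_Suc)

lemma simplicial_set_prod:
  assumes "simplicial_set K" "simplicial_set L"
  shows "simplicial_set (sset_prod K L)"
proof -
  interpret K: simplicial_set K by fact
  interpret L: simplicial_set L by fact
  show ?thesis
    by unfold_locales
      (auto simp: sset_prod_def K.act_in L.act_in K.act_id L.act_id K.act_comp L.act_comp simp del: upt_Suc)
qed

lemma interval_simps:
  "simplices interval n = Inl ` dmaps n 1" "act interval n \<theta> (Inl x) = Inl (dcomp x \<theta>)"
  "bpt interval = Inl [0]"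
  by (simp_all add: interval_def)

lemma endpoints_simps:
  "simplices endpoints n = {Inl (replicate (Suc n) 0), Inl (replicate (Suc n) 1)}"
  "act endpoints n \<theta> (Inl x) = Inl (dcomp x \<theta>)" "bpt endpoints = Inl [0]"
  by (simp_all add: endpoints_def)

lemma forget_pt_simps [simp]: "simplices (forget_pt K) = simplices K" "act (forget_pt K) = act K"
  by (simp_all add: forget_pt_def)

lemma pointed_sset_interval: "pointed_sset interval"
  unfolding pointed_sset_def
proof
  show "simplicial_set (forget_pt interval)"
    by unfold_locales
      (auto simp: interval_simps dcomp_in dcomp_id_right dcomp_assoc simp del: upt_Suc)
  show "bpt interval \<in> simplices interval 0"
    using const_in_dmaps[of 0 1 0] by (simp add: interval_simps)
qed

lemma simplicial_set_interval: "simplicial_set (forget_pt interval)"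
  using conjunct1[OF pointed_sset_interval[unfolded pointed_sset_def]] .

lemma bpt_interval_in: "bpt interval \<in> simplices interval 0"
  using conjunct2[OF pointed_sset_interval[unfolded pointed_sset_def]] .

lemma pointed_sset_endpoints: "pointed_sset endpoints"
  unfolding pointed_sset_def
proof
  have *: "replicate (Suc n) (0::nat) \<in> dmaps n 1" "replicate (Suc n) (1::nat) \<in> dmaps n 1" for n
    using const_in_dmaps by simp_all
  show "simplicial_set (forget_pt endpoints)"
  proof
    show "act (forget_pt endpoints) n \<theta> x \<in> simplices (forget_pt endpoints) k"
      if "\<theta> \<in> dmaps k n" "x \<in> simplices (forget_pt endpoints) n" for \<theta> k n x
      using that dcomp_replicate[OF that(1)] by (auto simp: endpoints_simps simp del: replicate_Suc)
    show "act (forget_pt endpoints) n [0..<Suc n] x = x"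
      if "x \<in> simplices (forget_pt endpoints) n" for n x
      using that dcomp_replicate[OF id_in_dmaps]
      by (auto simp: endpoints_simps simp del: replicate_Suc upt_Suc)
    show "act (forget_pt endpoints) n (dcomp \<theta> \<psi>) x =
        act (forget_pt endpoints) m \<psi> (act (forget_pt endpoints) n \<theta> x)"
      if "\<theta> \<in> dmaps m n" "\<psi> \<in> dmaps k m" "x \<in> simplices (forget_pt endpoints) n" for \<theta> \<psi> k m n x
      using that dcomp_assoc[OF that(1,2)] by (auto simp: endpoints_simps simp del: replicate_Suc)
  qed
  show "bpt endpoints \<in> simplices endpoints 0"
    by (simp add: endpoints_simps)
qed

lemma base_interval: "base interval n = Inl (replicate (Suc n) 0)"
proof -
  have "dcomp (replicate (Suc 0) 0) (replicate (Suc n) 0) = replicate (Suc n) (0::nat)"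
    by (rule dcomp_replicate) (rule const_in_dmaps, simp)
  then show ?thesis
    by (simp add: base_def dgn_def interval_simps)
qed

lemma endpoints_subset: "simplices endpoints n \<subseteq> simplices interval n"
  using const_in_dmaps[of 0 1 n] const_in_dmaps[of 1 1 n]
  by (auto simp: endpoints_simps interval_simps simp del: replicate_Suc)

lemma hom_Ar: "f \<in> hom C X Y \<Longrightarrow> f \<in> Ar C" by (simp add: hom_def)

text \<open>The \<open>n\<close>-simplices of the mapping spaces, tagged with source and target, form a category
  \<open>lev M n\<close> whose instance \<open>n = 0\<close> is the underlying category.\<close>

definition lev :: "('o, 's, 'u) simp_cat \<Rightarrow> nat \<Rightarrow> ('o, 'o \<times> 'o \<times> 's) cat" where
  "lev M n = \<lparr>Ob = Obj M, Ar = {(X, Y, f). X \<in> Obj M \<and> Y \<in> Obj M \<and> f \<in> simplices (Map M X Y) n},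
     Dom = (\<lambda>(X, Y, f). X), Cod = (\<lambda>(X, Y, f). Y),
     Idn = (\<lambda>X. (X, X, dgn (Map M X X) n (sidn M X))),
     Comp = (\<lambda>(_, Z, g) (X, Y, f). (X, Z, scomp M X Y Z n g f))\<rparr>"

definition Act :: "('o, 's, 'u) simp_cat \<Rightarrow> nat \<Rightarrow> nat list \<Rightarrow> 'o \<times> 'o \<times> 's \<Rightarrow> 'o \<times> 'o \<times> 's" where
  "Act M n \<theta> = (\<lambda>(X, Y, f). (X, Y, act (Map M X Y) n \<theta> f))"

text \<open>Total degeneracy carries arrows of the underlying category to level \<open>n\<close>,
  compatibly with composition and identities. It makes composites of an ordinary arrow with an
  \<open>n\<close>-simplex expressible inside \<open>lev M n\<close>.\<close>

definition Dgn :: "('o, 's, 'u) simp_cat \<Rightarrow> nat \<Rightarrow> 'o \<times> 'o \<times> 's \<Rightarrow> 'o \<times> 'o \<times> 's" where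
  "Dgn M n = Act M 0 (replicate (Suc n) 0)"

lemma lev_simps [simp]:
  "Ob (lev M n) = Obj M" "Comp (lev M n) (Y', Z, g) (X, Y, f) = (X, Z, scomp M X Y Z n g f)"
  by (simp_all add: lev_def)

lemma lev_hom: "h \<in> hom (lev M n) X Y \<longleftrightarrow>
    (\<exists>f. h = (X, Y, f) \<and> X \<in> Obj M \<and> Y \<in> Obj M \<and> f \<in> simplices (Map M X Y) n)"
  by (auto simp: lev_def hom_def)

lemma lev_hom_obj: "h \<in> hom (lev M n) X Y \<Longrightarrow> X \<in> Obj M" "h \<in> hom (lev M n) X Y \<Longrightarrow> Y \<in> Obj M"
  by (auto simp: lev_hom)

lemma Act_simp [simp]: "Act M n \<theta> (X, Y, f) = (X, Y, act (Map M X Y) n \<theta> f)"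
  by (simp add: Act_def)

lemma Dgn_simp: "Dgn M n (X, Y, f) = (X, Y, dgn (Map M X Y) n f)"
  by (simp add: Dgn_def dgn_def)

context simplicial_category
begin

lemma act_Map_in:
  "X \<in> Obj M \<Longrightarrow> Y \<in> Obj M \<Longrightarrow> \<theta> \<in> dmaps k n \<Longrightarrow> f \<in> simplices (Map M X Y) n \<Longrightarrow>
    act (Map M X Y) n \<theta> f \<in> simplices (Map M X Y) k"
  using Map_sset simplicial_set.act_in by metis

lemma dgn_Map_in:
  "X \<in> Obj M \<Longrightarrow> Y \<in> Obj M \<Longrightarrow> f \<in> simplices (Map M X Y) 0 \<Longrightarrow>
    dgn (Map M X Y) n f \<in> simplices (Map M X Y) n"
  unfolding dgn_def by (rule act_Map_in) (auto intro: const_in_dmaps simp del: replicate_Suc)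

lemma dgn_Map_0:
  "X \<in> Obj M \<Longrightarrow> Y \<in> Obj M \<Longrightarrow> f \<in> simplices (Map M X Y) 0 \<Longrightarrow> dgn (Map M X Y) 0 f = f"
  using simplicial_set.act_id[OF Map_sset, where n = 0] by (simp add: dgn_def)

lemma category_lev: "category (lev M n)"
proof
  fix X assume "X \<in> Ob (lev M n)"
  then show "Idn (lev M n) X \<in> hom (lev M n) X X"
    using dgn_Map_in[OF _ _ sidn_in] by (simp add: lev_hom) (simp add: lev_def)
next
  fix f X Y assume "f \<in> hom (lev M n) X Y"
  then show "Comp (lev M n) (Idn (lev M n) Y) f = f" "Comp (lev M n) f (Idn (lev M n) X) = f"
    using sidn_left sidn_right by (auto simp: lev_def hom_def)
next
  fix W X Y Z f g h
  assume "f \<in> hom (lev M n) W X" "g \<in> hom (lev M n) X Y" "h \<in> hom (lev M n) Y Z"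
  then show "Comp (lev M n) h (Comp (lev M n) g f) = Comp (lev M n) (Comp (lev M n) h g) f"
    using scomp_assoc by (auto simp: lev_hom)
next
  fix X Y Z f g
  assume "f \<in> hom (lev M n) X Y" "g \<in> hom (lev M n) Y Z"
  then show "Comp (lev M n) g f \<in> hom (lev M n) X Z"
    using scomp_in by (auto simp: lev_hom)
qed (auto simp: lev_def)

lemma Act_in: "\<theta> \<in> dmaps k n \<Longrightarrow> f \<in> hom (lev M n) X Y \<Longrightarrow> Act M n \<theta> f \<in> hom (lev M k) X Y"
  using act_Map_in by (auto simp: lev_hom)

lemma Act_id: "f \<in> hom (lev M n) X Y \<Longrightarrow> Act M n [0..<Suc n] f = f"
  using simplicial_set.act_id[OF Map_sset] by (auto simp: lev_hom simp del: upt_Suc)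

lemma Act_dcomp: "\<theta> \<in> dmaps m n \<Longrightarrow> \<psi> \<in> dmaps k m \<Longrightarrow> f \<in> hom (lev M n) X Y \<Longrightarrow>
    Act M n (dcomp \<theta> \<psi>) f = Act M m \<psi> (Act M n \<theta> f)"
  using simplicial_set.act_comp[OF Map_sset] by (auto simp: lev_hom)

lemma Act_Comp: "\<theta> \<in> dmaps k n \<Longrightarrow> f \<in> hom (lev M n) X Y \<Longrightarrow> g \<in> hom (lev M n) Y Z \<Longrightarrow>
    Act M n \<theta> (Comp (lev M n) g f) = Comp (lev M k) (Act M n \<theta> g) (Act M n \<theta> f)"
  using scomp_act by (auto simp: lev_hom)

text \<open>\<open>Idn\<close> is absent from the list: at level 0 it is \<open>dgn\<close> applied
  to \<open>sidn\<close>, which is known to equal \<open>sidn\<close> only on objects, so the two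
  records cannot simply be identified.\<close>

lemma und_eq_lev: "Ob (und M) = Obj M" "Ar (und M) = Ar (lev M 0)" "Dom (und M) = Dom (lev M 0)"
  "Cod (und M) = Cod (lev M 0)" "Comp (und M) = Comp (lev M 0)" "hom (und M) = hom (lev M 0)"
  by (auto simp: und_def lev_def hom_def fun_eq_iff)

lemma Dgn_in: "f \<in> hom (und M) X Y \<Longrightarrow> Dgn M n f \<in> hom (lev M n) X Y"
  unfolding Dgn_def und_eq_lev by (rule Act_in[OF const_in_dmaps]) auto

lemma Dgn_Comp: "f \<in> hom (und M) X Y \<Longrightarrow> g \<in> hom (und M) Y Z \<Longrightarrow>
    Dgn M n (Comp (und M) g f) = Comp (lev M n) (Dgn M n g) (Dgn M n f)"
  unfolding Dgn_def und_eq_lev by (rule Act_Comp[OF const_in_dmaps]) auto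

text \<open>A constant map after any operator is again constant, so restricting a totally degenerate
  simplex along an operator gives the total degeneracy of the same vertex.\<close>

lemma Act_Dgn:
  assumes "\<theta> \<in> dmaps k n" "f \<in> hom (und M) X Y"
  shows "Act M n \<theta> (Dgn M n f) = Dgn M k f"
  using Act_dcomp[OF const_in_dmaps[of 0 0 n] assms(1)] assms(2) dcomp_replicate[OF assms(1), of 0]
  by (simp add: Dgn_def und_eq_lev del: replicate_Suc)

lemma Dgn_0: "f \<in> hom (und M) X Y \<Longrightarrow> Dgn M 0 f = f"
  using Act_id[of f 0 X Y] by (simp add: Dgn_def und_eq_lev)

lemma Dgn_Idn: "X \<in> Obj M \<Longrightarrow> Dgn M n (Idn (und M) X) = Idn (lev M n) X"
  by (simp add: Dgn_simp und_def lev_def)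

end

text \<open>Simplicial maps \<open>K \<rightarrow> Map(X, Y)\<close>, with tagged values.\<close>

definition family :: "('o, 's, 'u) simp_cat \<Rightarrow> ('k, 'z) sset_scheme \<Rightarrow> 'o \<Rightarrow> 'o \<Rightarrow>
    (nat \<Rightarrow> 'k \<Rightarrow> 'o \<times> 'o \<times> 's) \<Rightarrow> bool" where
  "family M K X Y p \<longleftrightarrow>
     (\<forall>n. \<forall>x \<in> simplices K n. p n x \<in> hom (lev M n) X Y) \<and>
     (\<forall>n k. \<forall>\<theta> \<in> dmaps k n. \<forall>x \<in> simplices K n. p k (act K n \<theta> x) = Act M n \<theta> (p n x))"

lemma familyI:
  assumes "\<And>n x. x \<in> simplices K n \<Longrightarrow> p n x \<in> hom (lev M n) X Y"
    and "\<And>n k \<theta> x. \<theta> \<in> dmaps k n \<Longrightarrow> x \<in> simplices K n \<Longrightarrow> p k (act K n \<theta> x) = Act M n \<theta> (p n x)"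
  shows "family M K X Y p"
  using assms by (auto simp: family_def)

lemma family_in: "family M K X Y p \<Longrightarrow> x \<in> simplices K n \<Longrightarrow> p n x \<in> hom (lev M n) X Y"
  by (simp add: family_def)

lemma family_act: "family M K X Y p \<Longrightarrow> \<theta> \<in> dmaps k n \<Longrightarrow> x \<in> simplices K n \<Longrightarrow>
    p k (act K n \<theta> x) = Act M n \<theta> (p n x)"
  by (simp add: family_def)

lemma family_simplicial_map:
  fixes K :: "'k sset"
  assumes "family M K X Y p" "simplicial_set K" "simplicial_set (Map M X Y)"
  shows "simplicial_map K (Map M X Y) (\<lambda>n. \<lambda>x \<in> simplices K n. vtx (p n x))"
proof -
  interpret K: simplicial_set K by fact
  interpret Y: simplicial_set "Map M X Y" by fact
  show ?thesis
  proof
    show "(\<lambda>x \<in> simplices K n. vtx (p n x)) \<in> simplices K n \<rightarrow>\<^sub>E simplices (Map M X Y) n" for n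
      using family_in[OF assms(1)] by (fastforce simp: lev_hom)
    show "(\<lambda>x \<in> simplices K k. vtx (p k x)) (act K n \<theta> x) =
        act (Map M X Y) n \<theta> ((\<lambda>x \<in> simplices K n. vtx (p n x)) x)"
      if "\<theta> \<in> dmaps k n" "x \<in> simplices K n" for \<theta> k n x
      using family_in[OF assms(1) that(2)] family_act[OF assms(1) that] that
      by (auto simp: K.act_in lev_hom)
  qed
qed

lemma simplicial_map_family:
  fixes K :: "'k sset"
  assumes "simplicial_map K (Map M X Y) f" "X \<in> Obj M" "Y \<in> Obj M"
  shows "family M K X Y (\<lambda>n x. (X, Y, f n x))"
proof -
  interpret simplicial_map K "Map M X Y" f by fact
  show ?thesis
    using assms map_in map_act by (intro familyI) (auto simp: lev_hom PiE_def Pi_def)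
qed

section \<open>The universal property of the smash product\<close>

lemma (in category) zero_comp_unique:
  assumes Z: "zero_object C Z" and Z': "zero_object C Z'"
    and f: "f \<in> hom C X Z" "f' \<in> hom C X Z'" and g: "g \<in> hom C Z Y" "g' \<in> hom C Z' Y"
  shows "Comp C g' f' = Comp C g f"
proof -
  have X: "X \<in> Ob C" and Y: "Y \<in> Ob C"
    using f g dom_in cod_in by (auto simp: hom_def)
  obtain z where z: "z \<in> hom C Z Z'"
    using Z Z' by (auto simp: zero_object_def)
  \<comment> \<open>The two routes are compared along \<open>z\<close>: arrows into
    \<open>Z'\<close> are unique, and in the next step arrows out of \<open>Z\<close> are.\<close>
  have "Comp C z f = f'"
    using comp_in[OF f(1) z] f(2) Z' X unfolding zero_object_def by blast
  moreover have "Comp C g' z = g"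
    using comp_in[OF z g(2)] g(1) Z Y unfolding zero_object_def by blast
  ultimately show ?thesis
    using comp_assoc[OF f(1) z g(2)] by simp
qed

lemma (in category) zero_arrow_eq:
  assumes "zero_object C Z" "f \<in> hom C X Z" "g \<in> hom C Z Y"
  shows "zero_arrow C X Y = Comp C g f"
  unfolding zero_arrow_def
proof (rule the_equality)
  show "\<exists>Z f' g'. zero_object C Z \<and> f' \<in> hom C X Z \<and> g' \<in> hom C Z Y \<and> Comp C g f = Comp C g' f'"
    using assms by blast
qed (use zero_comp_unique assms in blast)

locale pointed_category = category C for C :: "('o, 'a) cat" +
  assumes ex_zero: "\<exists>Z. zero_object C Z"
begin

lemma zero_arrow_factors:
  assumes "X \<in> Ob C" "Y \<in> Ob C"
  obtains Z f g where "zero_object C Z" "f \<in> hom C X Z" "g \<in> hom C Z Y" "zero_arrow C X Y = Comp C g f"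
proof -
  obtain Z where Z: "zero_object C Z"
    using ex_zero by blast
  with assms have "\<exists>!f. f \<in> hom C X Z" "\<exists>!g. g \<in> hom C Z Y"
    by (simp_all add: zero_object_def)
  then obtain f g where "f \<in> hom C X Z" "g \<in> hom C Z Y"
    by (elim ex1E)
  then show thesis
    using that Z zero_arrow_eq[OF Z] by simp
qed

lemma zero_arrow_in: "X \<in> Ob C \<Longrightarrow> Y \<in> Ob C \<Longrightarrow> zero_arrow C X Y \<in> hom C X Y"
  by (erule (1) zero_arrow_factors) (simp add: comp_in)

lemma comp_zero:
  assumes "X \<in> Ob C" "g \<in> hom C Y Z"
  shows "Comp C g (zero_arrow C X Y) = zero_arrow C X Z"
proof -
  have "Y \<in> Ob C"
    using assms(2) dom_in by (auto simp: hom_def)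
  from zero_arrow_factors[OF assms(1) this] obtain O' f h where
    h: "zero_object C O'" "f \<in> hom C X O'" "h \<in> hom C O' Y" "zero_arrow C X Y = Comp C h f" .
  then show ?thesis
    using zero_arrow_eq[OF h(1,2) comp_in[OF h(3) assms(2)]] comp_assoc[OF h(2,3) assms(2)] by simp
qed

lemma zero_comp:
  assumes "Z \<in> Ob C" "f \<in> hom C X Y"
  shows "Comp C (zero_arrow C Y Z) f = zero_arrow C X Z"
proof -
  have "Y \<in> Ob C"
    using assms(2) cod_in by (auto simp: hom_def)
  from zero_arrow_factors[OF this assms(1)] obtain O' g h where
    h: "zero_object C O'" "g \<in> hom C Y O'" "h \<in> hom C O' Z" "zero_arrow C Y Z = Comp C h g" .
  then show ?thesis
    using zero_arrow_eq[OF h(1) comp_in[OF assms(2) h(2)] h(3)] comp_assoc[OF assms(2) h(2,3)] by simp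
qed

end

text \<open>The universal map from \<open>K\<close> to Map(X, X \<and> K), tagged with source and
  target so that its values are arrows of \<open>lev M n\<close>.\<close>

definition smash_arr :: "('o, 's, 'u) simp_cat \<Rightarrow> 'u univ psset \<Rightarrow> 'o \<Rightarrow> nat \<Rightarrow> 'u univ \<Rightarrow> 'o \<times> 'o \<times> 's" where
  "smash_arr M K X n k = (X, smash M X K, smash_unit M X K n k)"

lemma forget_pt_pMap [simp]: "forget_pt (pMap M X Y) = Map M X Y"
  by (simp add: pMap_def forget_pt_def)

lemma base_pMap:
  assumes "zero_arrow (und M) X Y \<in> hom (und M) X Y"
  shows "(X, Y, base (pMap M X Y) n) = Dgn M n (zero_arrow (und M) X Y)"
proof -
  have "\<exists>v. h = (X, Y, v)" if "h \<in> hom (und M) X Y" for h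
    using that by (auto simp: hom_def und_def)
  from this[OF assms] obtain v where v: "zero_arrow (und M) X Y = (X, Y, v)"
    by blast
  have "base (pMap M X Y) n = dgn (Map M X Y) n (bpt (pMap M X Y))"
    by (simp add: base_def)
  then show ?thesis
    using v by (simp add: Dgn_simp pMap_def)
qed

section \<open>Existence and uniqueness of simplices out of a smash product\<close>

context pointed_simplicial_model_category
begin

sublocale pointed_category "und M"
  using pointed by unfold_locales

abbreviation "zero X Y \<equiv> zero_arrow (und M) X Y"

lemma zero_in: "X \<in> Obj M \<Longrightarrow> Y \<in> Obj M \<Longrightarrow> zero X Y \<in> hom (und M) X Y"
  using zero_arrow_in und_eq_lev(1) by blast

lemma smash_obj: "X \<in> Obj M \<Longrightarrow> pointed_sset K \<Longrightarrow> smash M X K \<in> Obj M"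
  using smash by (auto simp: is_smash_def)

lemma smash_arr_family:
  assumes "X \<in> Obj M" "pointed_sset K"
  shows "family M K X (smash M X K) (smash_arr M K X)"
proof -
  have "simplicial_map (forget_pt K) (Map M X (smash M X K)) (smash_unit M X K)"
    using smash[OF assms] by (simp add: is_smash_def pointed_map_def)
  from simplicial_map_family[OF this assms(1) smash_obj[OF assms]]
  show ?thesis
    by (simp add: family_def smash_arr_def)
qed

lemma base_in: "pointed_sset K \<Longrightarrow> base K n \<in> simplices K n"
  using simplicial_set.act_in[OF _ const_in_dmaps[of 0 0 n]]
  by (fastforce simp: pointed_sset_def base_def dgn_def simp del: replicate_Suc)

lemma smash_arr_base:
  assumes "X \<in> Obj M" "pointed_sset K"
  shows "smash_arr M K X n (base K n) = Dgn M n (zero X (smash M X K))"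
proof -
  let ?T = "smash M X K"
  have p: "pointed_map K (pMap M X ?T) (smash_unit M X K)"
    using smash[OF assms] by (simp add: is_smash_def)
  then have "smash_unit M X K 0 (bpt K) = bpt (pMap M X ?T)"
    by (simp add: pointed_map_def)
  moreover have "smash_arr M K X n (base K n) = Act M 0 (replicate (Suc n) 0) (smash_arr M K X 0 (bpt K))"
    using family_act[OF smash_arr_family[OF assms] const_in_dmaps[of 0 0 n]] assms(2)
    by (simp add: base_def dgn_def pointed_sset_def del: replicate_Suc)
  ultimately have "smash_arr M K X n (base K n) = (X, ?T, base (pMap M X ?T) n)"
    by (simp add: smash_arr_def base_def dgn_def)
  also have "\<dots> = Dgn M n (zero X ?T)"
    by (rule base_pMap) (rule zero_in[OF assms(1) smash_obj[OF assms]])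
  finally show ?thesis .
qed

text \<open>Surjectivity of the tensor comparison in degree \<open>n\<close>. The data
  \<open>w\<close> amounts to a simplicial map from K \<times> Delta[n] to Map(X, Y), with
  \<open>k\<close> and \<open>\<sigma>\<close> as its two coordinates, and \<open>based\<close> says
  that it is constantly zero over the base point of \<open>K\<close>.\<close>

lemma smash_exists:
  assumes X: "X \<in> Obj M" and Y: "Y \<in> Obj M" and K: "pointed_sset K"
    and in_hom: "\<And>m k \<sigma>. k \<in> simplices K m \<Longrightarrow> \<sigma> \<in> dmaps m n \<Longrightarrow> w m k \<sigma> \<in> hom (lev M m) X Y"
    and act: "\<And>m l k \<sigma> \<theta>. k \<in> simplices K m \<Longrightarrow> \<sigma> \<in> dmaps m n \<Longrightarrow> \<theta> \<in> dmaps l m \<Longrightarrow>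
      w l (act K m \<theta> k) (dcomp \<sigma> \<theta>) = Act M m \<theta> (w m k \<sigma>)"
    and based: "\<And>m \<sigma>. \<sigma> \<in> dmaps m n \<Longrightarrow> w m (base K m) \<sigma> = Dgn M m (zero X Y)"
  obtains a where "a \<in> hom (lev M n) (smash M X K) Y"
    "\<And>m k \<sigma>. k \<in> simplices K m \<Longrightarrow> \<sigma> \<in> dmaps m n \<Longrightarrow>
      Comp (lev M m) (Act M n \<sigma> a) (smash_arr M K X m k) = w m k \<sigma>"
proof -
  let ?T = "smash M X K"
  let ?P = "sset_prod (forget_pt K) (std_simplex n)"
  let ?f = "\<lambda>m. \<lambda>x \<in> simplices K m \<times> dmaps m n. vtx (w m (fst x) (snd x))"
  have "family M ?P X Y (\<lambda>m x. w m (fst x) (snd x))"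
    by (rule familyI) (auto simp: sset_prod_def std_simplex_def in_hom act)
  moreover have "simplicial_set ?P"
    using K by (intro simplicial_set_prod simplicial_set_std_simplex) (simp add: pointed_sset_def)
  ultimately have "simplicial_map ?P (Map M X Y) (\<lambda>m. \<lambda>x \<in> simplices ?P m. vtx (w m (fst x) (snd x)))"
    by (rule family_simplicial_map[OF _ _ Map_sset[OF X Y]])
  then have "simplicial_map ?P (Map M X Y) ?f"
    by (simp add: sset_prod_def std_simplex_def)
  moreover have "?f m (base K m, \<sigma>) = base (pMap M X Y) m" if "\<sigma> \<in> dmaps m n" for m \<sigma>
  proof -
    have "w m (base K m) \<sigma> = (X, Y, base (pMap M X Y) m)"
      using base_pMap[OF zero_in[OF X Y]] based[OF that] by simp
    then show ?thesis
      using that base_in[OF K] by simp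
  qed
  ultimately have "?f \<in> simplices (pointed_mapping_sset K (pMap M X Y)) n"
    by (simp add: pointed_mapping_sset_def mapping_sset_def)
  moreover have "bij_betw (tensor_comparison M X (forget_pt K) ?T (smash_unit M X K) Y n)
      (simplices (Map M ?T Y) n) (simplices (pointed_mapping_sset K (pMap M X Y)) n)"
    using smash[OF X K] Y by (simp add: is_smash_def simplicial_iso_def)
  ultimately obtain g where g: "g \<in> simplices (Map M ?T Y) n"
    and eq: "tensor_comparison M X (forget_pt K) ?T (smash_unit M X K) Y n g = ?f"
    by (auto simp: bij_betw_def image_iff dest!: equalityD2 subsetD)
  show thesis
  proof
    show "(?T, Y, g) \<in> hom (lev M n) ?T Y"
      using g smash_obj[OF X K] Y by (simp add: lev_hom)
    fix m k \<sigma> assume k: "k \<in> simplices K m" and \<sigma>: "\<sigma> \<in> dmaps m n"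
    have "scomp M X ?T Y m (act (Map M ?T Y) n \<sigma> g) (smash_unit M X K m k) = vtx (w m k \<sigma>)"
      using fun_cong[OF fun_cong[OF eq, of m], of "(k, \<sigma>)"] g k \<sigma> by (simp add: tensor_comparison_def)
    then show "Comp (lev M m) (Act M n \<sigma> (?T, Y, g)) (smash_arr M K X m k) = w m k \<sigma>"
      using in_hom[OF k \<sigma>] by (auto simp: smash_arr_def lev_hom)
  qed
qed

text \<open>Injectivity of the tensor comparison in degree \<open>n\<close>.\<close>

lemma smash_unique:
  assumes X: "X \<in> Obj M" and K: "pointed_sset K"
    and a: "a \<in> hom (lev M n) (smash M X K) Y" and b: "b \<in> hom (lev M n) (smash M X K) Y"
    and eq: "\<And>m k \<sigma>. k \<in> simplices K m \<Longrightarrow> \<sigma> \<in> dmaps m n \<Longrightarrow>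
      Comp (lev M m) (Act M n \<sigma> a) (smash_arr M K X m k) = Comp (lev M m) (Act M n \<sigma> b) (smash_arr M K X m k)"
  shows "a = b"
proof -
  let ?T = "smash M X K"
  let ?t = "tensor_comparison M X (forget_pt K) ?T (smash_unit M X K) Y n"
  obtain a' b' where ab: "a = (?T, Y, a')" "b = (?T, Y, b')" and Y: "Y \<in> Obj M"
    "a' \<in> simplices (Map M ?T Y) n" "b' \<in> simplices (Map M ?T Y) n"
    using a b by (auto simp: lev_hom)
  \<comment> \<open>Off the simplices of K \<times> Delta[n] both sides are
    \<open>undefined\<close>, so the assumed equations already give equality of functions.\<close>
  have "?t a' m x = ?t b' m x" for m x
    using eq[of "fst x" m "snd x"] Y(2,3)
    by (cases x) (auto simp: tensor_comparison_def restrict_def ab smash_arr_def)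
  then have "?t a' = ?t b'"
    by blast
  moreover have "inj_on ?t (simplices (Map M ?T Y) n)"
    using smash[OF X K] Y(1) by (simp add: is_smash_def simplicial_iso_def bij_betw_def)
  ultimately show ?thesis
    using ab Y by (auto dest: inj_onD)
qed

end

section \<open>Paths\<close>

text \<open>The cotensor of \<open>Y\<close> with the interval, seen through arrows only: it
  represents all simplicial maps from the interval to Map(X, Y), with no condition at the base
  vertex, because cotensors are available for unpointed simplicial sets.\<close>

definition is_path_object :: "('o, 's, 'u) simp_cat \<Rightarrow> 'o \<Rightarrow> 'o \<Rightarrow> (nat \<Rightarrow> 'u univ \<Rightarrow> 'o \<times> 'o \<times> 's) \<Rightarrow> bool" where
  "is_path_object M Y T \<epsilon> \<longleftrightarrow> T \<in> Obj M \<and> family M interval T Y \<epsilon> \<and>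
     (\<forall>X \<in> Obj M. \<forall>p. family M interval X Y p \<longrightarrow>
        (\<exists>!h. h \<in> hom (und M) X T \<and>
          (\<forall>n. \<forall>k \<in> simplices interval n. Comp (lev M n) (\<epsilon> n k) (Dgn M n h) = p n k)))"

definition path_obj :: "('o, 's, 'u) simp_cat \<Rightarrow> 'o \<Rightarrow> 'o" where
  "path_obj M Y = (SOME T. \<exists>\<epsilon>. is_path_object M Y T \<epsilon>)"

definition path_ev :: "('o, 's, 'u) simp_cat \<Rightarrow> 'o \<Rightarrow> nat \<Rightarrow> 'u univ \<Rightarrow> 'o \<times> 'o \<times> 's" where
  "path_ev M Y = (SOME \<epsilon>. is_path_object M Y (path_obj M Y) \<epsilon>)"

definition cone_arr :: "('o, 's, 'u) simp_cat \<Rightarrow> 'o \<Rightarrow> nat \<Rightarrow> 'u univ \<Rightarrow> 'o \<times> 'o \<times> 's" where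
  "cone_arr M = smash_arr M interval"

text \<open>In coordinates, a point of C(C(X)) is a point of \<open>X\<close> with an inner
  coordinate \<open>k\<close> and an outer coordinate \<open>l\<close>; the equation exchanges the
  two.\<close>

definition flip :: "('o, 's, 'u) simp_cat \<Rightarrow> 'o \<Rightarrow> 'o \<times> 'o \<times> 's" where
  "flip M X = (SOME g. g \<in> hom (und M) (Cone M (Cone M X)) (Cone M (Cone M X)) \<and>
     (\<forall>n. \<forall>k \<in> simplices interval n. \<forall>l \<in> simplices interval n.
        Comp (lev M n) (Dgn M n g) (Comp (lev M n) (cone_arr M (Cone M X) n l) (cone_arr M X n k)) =
        Comp (lev M n) (cone_arr M (Cone M X) n k) (cone_arr M X n l)))"

context simplicial_category
begin

lemmas lev_in = category.comp_in[OF category_lev]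
lemmas lev_assoc = category.comp_assoc[OF category_lev]

lemma family_post:
  assumes "family M K X Y p" "g \<in> hom (und M) Y Z"
  shows "family M K X Z (\<lambda>n k. Comp (lev M n) (Dgn M n g) (p n k))"
  by (rule familyI) (simp_all add: lev_in[OF family_in[OF assms(1)] Dgn_in[OF assms(2)]]
      Act_Comp[OF _ family_in[OF assms(1)] Dgn_in[OF assms(2)]] family_act[OF assms(1)] Act_Dgn[OF _ assms(2)])

lemma family_pre:
  assumes "family M K X Y p" "f \<in> hom (und M) W X"
  shows "family M K W Y (\<lambda>n k. Comp (lev M n) (p n k) (Dgn M n f))"
  by (rule familyI) (simp_all add: lev_in[OF Dgn_in[OF assms(2)] family_in[OF assms(1)]]
      Act_Comp[OF _ Dgn_in[OF assms(2)] family_in[OF assms(1)]] family_act[OF assms(1)] Act_Dgn[OF _ assms(2)])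

lemma family_Dgn: "f \<in> hom (und M) X Y \<Longrightarrow> family M K X Y (\<lambda>n k. Dgn M n f)"
  by (intro familyI) (simp_all add: Dgn_in Act_Dgn)

end

lemma act_base:
  assumes "pointed_sset K" "\<theta> \<in> dmaps k n"
  shows "act K n \<theta> (base K n) = base K k"
proof -
  have "simplicial_set (forget_pt K)" "bpt K \<in> simplices (forget_pt K) 0"
    using assms(1) by (simp_all add: pointed_sset_def)
  from simplicial_set.act_comp[OF this(1) const_in_dmaps[of 0 0 n] assms(2) this(2)]
  show ?thesis
    using dcomp_replicate[OF assms(2), of 0] by (simp add: base_def dgn_def del: replicate_Suc)
qed

lemma interval_act_in: "\<theta> \<in> dmaps k n \<Longrightarrow> x \<in> simplices interval n \<Longrightarrow> act interval n \<theta> x \<in> simplices interval k"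
  by (auto simp: interval_simps dcomp_in)

lemma interval_act_dcomp: "\<theta> \<in> dmaps m n \<Longrightarrow> \<psi> \<in> dmaps k m \<Longrightarrow> x \<in> simplices interval n \<Longrightarrow>
    act interval n (dcomp \<theta> \<psi>) x = act interval m \<psi> (act interval n \<theta> x)"
  by (auto simp: interval_simps dcomp_assoc)

section \<open>Path objects, cones, and zero in higher simplicial degrees\<close>

context pointed_simplicial_model_category
begin

abbreviation I :: "'u univ psset" where "I \<equiv> interval"

lemma family_base:
  assumes "pointed_sset K" "family M K X Y p" "p 0 (bpt K) = zero X Y"
  shows "p n (base K n) = Dgn M n (zero X Y)"
  using assms family_act[OF assms(2) const_in_dmaps[of 0 0 n], of "bpt K"]
  by (simp add: base_def dgn_def Dgn_def pointed_sset_def del: replicate_Suc)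

text \<open>This is \<open>smash_exists\<close> for \<open>n = 0\<close>, where the simplex
  coordinate \<open>\<sigma>\<close> is the unique map to [0] and carries no information.\<close>

lemma smash_vertex_exists:
  assumes X: "X \<in> Obj M" and Y: "Y \<in> Obj M" and K: "pointed_sset K"
    and p: "family M K X Y p" "p 0 (bpt K) = zero X Y"
  obtains g where "g \<in> hom (und M) (smash M X K) Y"
    "\<And>n k. k \<in> simplices K n \<Longrightarrow> Comp (lev M n) (Dgn M n g) (smash_arr M K X n k) = p n k"
proof (rule smash_exists[OF X Y K, of 0 "\<lambda>m k \<sigma>. p m k"])
  fix a assume a: "a \<in> hom (lev M 0) (smash M X K) Y"
    "\<And>m k \<sigma>. k \<in> simplices K m \<Longrightarrow> \<sigma> \<in> dmaps m 0 \<Longrightarrow>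
      Comp (lev M m) (Act M 0 \<sigma> a) (smash_arr M K X m k) = p m k"
  show thesis
  proof (rule that)
    show "a \<in> hom (und M) (smash M X K) Y"
      using a(1) by (simp add: und_eq_lev)
    show "Comp (lev M n) (Dgn M n a) (smash_arr M K X n k) = p n k" if "k \<in> simplices K n" for n k
      using a(2)[OF that const_in_dmaps[of 0 0 n]] by (simp add: Dgn_def)
  qed
qed (use p family_in family_act family_base[OF K p] in \<open>fast+\<close>)

lemma smash_vertex_unique:
  assumes X: "X \<in> Obj M" and K: "pointed_sset K"
    and a: "a \<in> hom (und M) (smash M X K) Y" and b: "b \<in> hom (und M) (smash M X K) Y"
    and eq: "\<And>n k. k \<in> simplices K n \<Longrightarrow>
      Comp (lev M n) (Dgn M n a) (smash_arr M K X n k) = Comp (lev M n) (Dgn M n b) (smash_arr M K X n k)"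
  shows "a = b"
  using a b eq by (intro smash_unique[OF X K, of a 0 Y b]) (auto simp: und_eq_lev dmaps_0 Dgn_def simp del: replicate_Suc)

text \<open>Degree 0 of the cotensor isomorphism: a vertex of the internal hom is a simplicial map
  on I \<times> Delta[0], and since Delta[0] has one simplex in each degree, this is the same as a
  family on the interval.\<close>

lemma path_object_exists:
  assumes Y: "Y \<in> Obj M"
  obtains T \<epsilon> where "is_path_object M Y T \<epsilon>"
proof -
  let ?I = "forget_pt I"
  let ?P = "sset_prod ?I (std_simplex 0)"
  have I: "simplicial_set ?I"
    by (rule simplicial_set_interval)
  then obtain T \<epsilon> where T: "is_cotensor M Y ?I T \<epsilon>"
    using cotensored[OF Y] by blast
  define \<epsilon>' where "\<epsilon>' = (\<lambda>n k. (T, Y, \<epsilon> n k))"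
  have TO: "T \<in> Obj M" and "simplicial_map ?I (Map M T Y) \<epsilon>"
    using T by (simp_all add: is_cotensor_def)
  from simplicial_map_family[OF this(2,1) Y] have fam: "family M I T Y \<epsilon>'"
    by (simp add: family_def \<epsilon>'_def)
  have "\<exists>!h. h \<in> hom (und M) X T \<and>
      (\<forall>n. \<forall>k \<in> simplices I n. Comp (lev M n) (\<epsilon>' n k) (Dgn M n h) = p n k)"
    if X: "X \<in> Obj M" and p: "family M I X Y p" for X p
  proof -
    let ?c = "cotensor_comparison M Y ?I T \<epsilon> X 0"
    let ?f = "\<lambda>m. \<lambda>x \<in> simplices ?P m. vtx (p m (fst x))"
    have "family M ?P X Y (\<lambda>m x. p m (fst x))"
      using family_in[OF p] family_act[OF p] by (intro familyI) (auto simp: sset_prod_def)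
    from family_simplicial_map[OF this simplicial_set_prod[OF I simplicial_set_std_simplex] Map_sset[OF X Y]]
    have "?f \<in> simplices (mapping_sset ?I (Map M X Y)) 0"
      by (simp add: mapping_sset_def)
    moreover have bij: "bij_betw ?c (simplices (Map M X T) 0) (simplices (mapping_sset ?I (Map M X Y)) 0)"
      using T X by (simp add: is_cotensor_def simplicial_iso_def)
    ultimately obtain g where g: "g \<in> simplices (Map M X T) 0" and eq: "?c g = ?f"
      by (auto simp: bij_betw_def image_iff dest!: equalityD2 subsetD)
    \<comment> \<open>This converts equality of two partial functions on I \<times> Delta[0] into
      equations at the pairs of \<open>k\<close> with the constant list 0, which is the form
      required by \<open>is_path_object\<close>.\<close>
    have char: "?c h = ?f \<longleftrightarrow> (\<forall>n. \<forall>k \<in> simplices I n. Comp (lev M n) (\<epsilon>' n k) (Dgn M n (X, T, h)) = p n k)"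
      if h: "h \<in> simplices (Map M X T) 0" for h
    proof -
      have "?c h = ?f \<longleftrightarrow> (\<forall>n. \<forall>k \<in> simplices I n. ?c h n (k, replicate (Suc n) 0) = ?f n (k, replicate (Suc n) 0))"
      proof (rule iffI, simp, intro ext)
        fix n and x :: "'u univ \<times> nat list"
        assume all: "\<forall>n. \<forall>k \<in> simplices I n. ?c h n (k, replicate (Suc n) 0) = ?f n (k, replicate (Suc n) 0)"
        show "?c h n x = ?f n x"
        proof (cases "x \<in> simplices ?P n")
          case True
          then obtain k where "x = (k, replicate (Suc n) 0)" "k \<in> simplices I n"
            by (auto simp: sset_prod_def std_simplex_def dmaps_0)
          then show ?thesis
            using all by blast
        next
          case False
          then have "x \<notin> simplices I n \<times> dmaps n 0"
            by (simp add: sset_prod_def std_simplex_def)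
          then show ?thesis
            using h False by (simp add: cotensor_comparison_def)
        qed
      qed
      also have "\<dots> \<longleftrightarrow> (\<forall>n. \<forall>k \<in> simplices I n. Comp (lev M n) (\<epsilon>' n k) (Dgn M n (X, T, h)) = p n k)"
      proof (intro all_cong1 ball_cong refl)
        fix n and k :: "'u univ" assume k: "k \<in> simplices I n"
        have "replicate (Suc n) 0 \<in> dmaps n 0"
          by (simp only: dmaps_0 singletonI)
        then show "?c h n (k, replicate (Suc n) 0) = ?f n (k, replicate (Suc n) 0) \<longleftrightarrow>
            Comp (lev M n) (\<epsilon>' n k) (Dgn M n (X, T, h)) = p n k"
          using k h family_in[OF p k]
          by (auto simp: cotensor_comparison_def sset_prod_def std_simplex_def \<epsilon>'_def Dgn_def lev_hom
              simp del: replicate_Suc)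
      qed
      finally show ?thesis .
    qed
    show ?thesis
    proof (rule ex1I[of _ "(X, T, g)"])
      show "(X, T, g) \<in> hom (und M) X T \<and>
          (\<forall>n. \<forall>k \<in> simplices I n. Comp (lev M n) (\<epsilon>' n k) (Dgn M n (X, T, g)) = p n k)"
        using char[OF g] eq g X TO by (simp add: und_eq_lev lev_hom)
      fix h assume h: "h \<in> hom (und M) X T \<and>
          (\<forall>n. \<forall>k \<in> simplices I n. Comp (lev M n) (\<epsilon>' n k) (Dgn M n h) = p n k)"
      then obtain h' where h': "h = (X, T, h')" "h' \<in> simplices (Map M X T) 0"
        by (auto simp: und_eq_lev lev_hom)
      then have "?c h' = ?c g"
        using char[OF h'(2)] h eq by simp
      then show "h = (X, T, g)"
        using inj_onD[OF bij_betw_imp_inj_on[OF bij]] h' g by simp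
    qed
  qed
  then have "is_path_object M Y T \<epsilon>'"
    using TO fam by (simp add: is_path_object_def)
  then show thesis
    by (rule that)
qed

lemma path_object:
  assumes "Y \<in> Obj M"
  shows "is_path_object M Y (path_obj M Y) (path_ev M Y)"
proof -
  have "\<exists>T \<epsilon>. is_path_object M Y T \<epsilon>"
    using path_object_exists[OF assms] by blast
  then have "\<exists>\<epsilon>. is_path_object M Y (path_obj M Y) \<epsilon>"
    unfolding path_obj_def by (rule someI_ex)
  then show ?thesis
    unfolding path_ev_def by (rule someI_ex)
qed

lemma path_obj_in: "Y \<in> Obj M \<Longrightarrow> path_obj M Y \<in> Obj M"
  using path_object by (simp add: is_path_object_def)

lemma path_ev_family: "Y \<in> Obj M \<Longrightarrow> family M I (path_obj M Y) Y (path_ev M Y)"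
  using path_object by (simp add: is_path_object_def)

lemma path_exists:
  assumes "X \<in> Obj M" "Y \<in> Obj M" "family M I X Y p"
  obtains h where "h \<in> hom (und M) X (path_obj M Y)"
    "\<And>n k. k \<in> simplices I n \<Longrightarrow> Comp (lev M n) (path_ev M Y n k) (Dgn M n h) = p n k"
  using path_object[OF assms(2)] assms unfolding is_path_object_def by blast

lemma path_unique:
  assumes Y: "Y \<in> Obj M" and a: "a \<in> hom (und M) X (path_obj M Y)" and b: "b \<in> hom (und M) X (path_obj M Y)"
    and eq: "\<And>n k. k \<in> simplices I n \<Longrightarrow>
      Comp (lev M n) (path_ev M Y n k) (Dgn M n a) = Comp (lev M n) (path_ev M Y n k) (Dgn M n b)"
  shows "a = b"
proof -
  have X: "X \<in> Obj M"
    using a lev_hom_obj by (simp add: und_eq_lev)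
  have "\<exists>!h. h \<in> hom (und M) X (path_obj M Y) \<and>
      (\<forall>n. \<forall>k \<in> simplices I n. Comp (lev M n) (path_ev M Y n k) (Dgn M n h) =
         Comp (lev M n) (path_ev M Y n k) (Dgn M n b))"
    using path_object[OF Y] family_pre[OF path_ev_family[OF Y] b] X by (simp add: is_path_object_def)
  then show ?thesis
    using a b eq by blast
qed

lemma Cone_obj: "X \<in> Obj M \<Longrightarrow> Cone M X \<in> Obj M"
  unfolding Cone_def using smash_obj pointed_sset_interval by blast

lemma cone_arr_family: "X \<in> Obj M \<Longrightarrow> family M I X (Cone M X) (cone_arr M X)"
  unfolding Cone_def cone_arr_def using smash_arr_family pointed_sset_interval by blast

lemmas cone_arr_in = family_in[OF cone_arr_family]
lemmas cone_arr_act = family_act[OF cone_arr_family]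

lemma cone_arr_base: "X \<in> Obj M \<Longrightarrow> cone_arr M X n (base I n) = Dgn M n (zero X (Cone M X))"
  unfolding Cone_def cone_arr_def using smash_arr_base pointed_sset_interval by blast

lemma cone_exists:
  assumes "X \<in> Obj M" "Y \<in> Obj M" "family M I X Y p" "p 0 (bpt I) = zero X Y"
  obtains g where "g \<in> hom (und M) (Cone M X) Y"
    "\<And>n k. k \<in> simplices I n \<Longrightarrow> Comp (lev M n) (Dgn M n g) (cone_arr M X n k) = p n k"
  using smash_vertex_exists[OF assms(1,2) pointed_sset_interval assms(3,4)]
  by (auto simp: Cone_def cone_arr_def)

lemma cone_unique:
  assumes "X \<in> Obj M" "a \<in> hom (und M) (Cone M X) Y" "b \<in> hom (und M) (Cone M X) Y"
    and "\<And>n k. k \<in> simplices I n \<Longrightarrow>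
      Comp (lev M n) (Dgn M n a) (cone_arr M X n k) = Comp (lev M n) (Dgn M n b) (cone_arr M X n k)"
  shows "a = b"
  using smash_vertex_unique[OF assms(1) pointed_sset_interval] assms(2-) by (simp add: Cone_def cone_arr_def)

text \<open>A path of arrows out of \<open>Z\<close> is a single arrow from \<open>Z\<close> into
  the path object of \<open>Y\<close>. A zero object has only one such arrow, and the constant zero
  path also gives one, so the two paths coincide in every degree.\<close>

lemma path_from_zero:
  assumes Z: "zero_object (und M) Z" and Y: "Y \<in> Obj M" and p: "family M I Z Y p"
    and k: "k \<in> simplices I n"
  shows "p n k = Dgn M n (zero Z Y)"
proof -
  have ZO: "Z \<in> Obj M"
    using Z by (simp add: zero_object_def und_eq_lev)
  obtain a where a: "a \<in> hom (und M) Z (path_obj M Y)"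
      "\<And>n k. k \<in> simplices I n \<Longrightarrow> Comp (lev M n) (path_ev M Y n k) (Dgn M n a) = p n k"
    using path_exists[OF ZO Y p] by blast
  obtain b where b: "b \<in> hom (und M) Z (path_obj M Y)"
      "\<And>n k. k \<in> simplices I n \<Longrightarrow> Comp (lev M n) (path_ev M Y n k) (Dgn M n b) = Dgn M n (zero Z Y)"
    using path_exists[OF ZO Y family_Dgn[OF zero_in[OF ZO Y]]] by blast
  have "\<exists>!h. h \<in> hom (und M) Z (path_obj M Y)"
    using Z path_obj_in[OF Y] by (simp add: zero_object_def und_eq_lev)
  then have "a = b"
    using a(1) b(1) by blast
  then show ?thesis
    using a(2)[OF k] b(2)[OF k] by simp
qed

text \<open>There is only one arrow from \<open>X\<close> to \<open>Z\<close>, so the path starts at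
  zero and is therefore an arrow from the cone of \<open>X\<close> to \<open>Z\<close>. That arrow
  is unique too, and the constant zero path yields it as well.\<close>

lemma path_to_zero:
  assumes Z: "zero_object (und M) Z" and X: "X \<in> Obj M" and p: "family M I X Z p"
    and k: "k \<in> simplices I n"
  shows "p n k = Dgn M n (zero X Z)"
proof -
  have ZO: "Z \<in> Obj M"
    using Z by (simp add: zero_object_def und_eq_lev)
  have uniq: "\<exists>!h. h \<in> hom (und M) W Z" if "W \<in> Obj M" for W
    using Z that by (simp add: zero_object_def und_eq_lev)
  from family_in[OF p bpt_interval_in] have "p 0 (bpt I) = zero X Z"
    using uniq[OF X] zero_in[OF X ZO] by (auto simp: und_eq_lev)
  then obtain a where a: "a \<in> hom (und M) (Cone M X) Z"
      "\<And>n k. k \<in> simplices I n \<Longrightarrow> Comp (lev M n) (Dgn M n a) (cone_arr M X n k) = p n k"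
    using cone_exists[OF X ZO p] by blast
  have "Dgn M 0 (zero X Z) = zero X Z"
    using Dgn_0 zero_in[OF X ZO] by blast
  then obtain b where b: "b \<in> hom (und M) (Cone M X) Z"
      "\<And>n k. k \<in> simplices I n \<Longrightarrow> Comp (lev M n) (Dgn M n b) (cone_arr M X n k) = Dgn M n (zero X Z)"
    using cone_exists[OF X ZO family_Dgn[OF zero_in[OF X ZO]]] by blast
  have "a = b"
    using a(1) b(1) uniq[OF Cone_obj[OF X]] by blast
  then show ?thesis
    using a(2)[OF k] b(2)[OF k] by simp
qed

text \<open>Factoring the zero arrow through a zero object turns the cone coordinate into a path
  with values in that object, to which \<open>path_to_zero\<close> applies. Uniqueness of zero
  arrows in the underlying category alone would cover only \<open>n = 0\<close>.\<close>

lemma zero_comp_cone_arr: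
  assumes X: "X \<in> Obj M" and Y: "Y \<in> Obj M" and k: "k \<in> simplices I n"
  shows "Comp (lev M n) (Dgn M n (zero (Cone M X) Y)) (cone_arr M X n k) = Dgn M n (zero X Y)"
proof -
  obtain Z f g where Z: "zero_object (und M) Z" and f: "f \<in> hom (und M) (Cone M X) Z"
    and g: "g \<in> hom (und M) Z Y" and eq: "zero (Cone M X) Y = Comp (und M) g f"
    using zero_arrow_factors Cone_obj[OF X] Y und_eq_lev(1) by metis
  have ZO: "Z \<in> Obj M"
    using Z by (simp add: zero_object_def und_eq_lev)
  have "Comp (lev M n) (Dgn M n f) (cone_arr M X n k) = Dgn M n (zero X Z)"
    using path_to_zero[OF Z X family_post[OF cone_arr_family[OF X] f] k] .
  then have "Comp (lev M n) (Dgn M n (zero (Cone M X) Y)) (cone_arr M X n k) =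
      Comp (lev M n) (Dgn M n g) (Dgn M n (zero X Z))"
    using lev_assoc[OF cone_arr_in[OF X k] Dgn_in[OF f] Dgn_in[OF g]] Dgn_Comp[OF f g] by (simp add: eq)
  also have "\<dots> = Dgn M n (zero X Y)"
    using Dgn_Comp[OF zero_in[OF X ZO] g] comp_zero[OF _ g, of X] X by (simp add: und_eq_lev(1))
  finally show ?thesis .
qed

text \<open>The counterpart of \<open>zero_comp_cone_arr\<close>: the factorization now produces a
  path of arrows out of a zero object, and \<open>path_from_zero\<close> applies.\<close>

lemma cone_arr_comp_zero:
  assumes X: "X \<in> Obj M" and W: "W \<in> Obj M" and k: "k \<in> simplices I n"
  shows "Comp (lev M n) (cone_arr M X n k) (Dgn M n (zero W X)) = Dgn M n (zero W (Cone M X))"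
proof -
  obtain Z f g where Z: "zero_object (und M) Z" and f: "f \<in> hom (und M) W Z"
    and g: "g \<in> hom (und M) Z X" and eq: "zero W X = Comp (und M) g f"
    using zero_arrow_factors X W und_eq_lev(1) by metis
  have ZO: "Z \<in> Obj M"
    using Z by (simp add: zero_object_def und_eq_lev)
  note CX = Cone_obj[OF X]
  have "Comp (lev M n) (cone_arr M X n k) (Dgn M n g) = Dgn M n (zero Z (Cone M X))"
    using path_from_zero[OF Z CX family_pre[OF cone_arr_family[OF X] g] k] .
  then have "Comp (lev M n) (cone_arr M X n k) (Dgn M n (zero W X)) =
      Comp (lev M n) (Dgn M n (zero Z (Cone M X))) (Dgn M n f)"
    using lev_assoc[OF Dgn_in[OF f] Dgn_in[OF g] cone_arr_in[OF X k]] Dgn_Comp[OF f g] by (simp add: eq)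
  also have "\<dots> = Dgn M n (zero W (Cone M X))"
    using Dgn_Comp[OF f zero_in[OF ZO CX]] zero_comp[OF _ f, of "Cone M X"] CX by (simp add: und_eq_lev(1))
  finally show ?thesis .
qed

end

section \<open>The cone functor and its symmetry\<close>

context pointed_simplicial_model_category
begin

lemma und_obj: "h \<in> hom (und M) X Y \<Longrightarrow> X \<in> Obj M" "h \<in> hom (und M) X Y \<Longrightarrow> Y \<in> Obj M"
  using lev_hom_obj by (simp_all add: und_eq_lev)

lemma und_Dom_Cod: "h \<in> hom (und M) X Y \<Longrightarrow> Dom (und M) h = X" "h \<in> hom (und M) X Y \<Longrightarrow> Cod (und M) h = Y"
  by (simp_all add: hom_def)

text \<open>The prescribed family vanishes at the base vertex, because \<open>\<phi>\<close>
  preserves base points and \<open>smash_arr\<close> is zero there. So the universal property yields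
  exactly one arrow, and the \<open>THE\<close> in the definition of \<open>smash_map\<close>
  denotes it.\<close>

lemma smash_map:
  assumes f: "f \<in> hom (und M) X X'" and K: "pointed_sset K" and L: "pointed_sset L"
    and in_L: "\<And>n k. k \<in> simplices K n \<Longrightarrow> \<phi> n k \<in> simplices L n"
    and act: "\<And>n m \<theta> k. \<theta> \<in> dmaps m n \<Longrightarrow> k \<in> simplices K n \<Longrightarrow> \<phi> m (act K n \<theta> k) = act L n \<theta> (\<phi> n k)"
    and bpt: "\<phi> 0 (bpt K) = bpt L"
  shows "smash_map M f K L \<phi> \<in> hom (und M) (smash M X K) (smash M X' L)"
    and "k \<in> simplices K n \<Longrightarrow> Comp (lev M n) (Dgn M n (smash_map M f K L \<phi>)) (smash_arr M K X n k) =
      Comp (lev M n) (smash_arr M L X' n (\<phi> n k)) (Dgn M n f)"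
proof -
  let ?T = "smash M X K" and ?T' = "smash M X' L"
  let ?p = "\<lambda>n k. Comp (lev M n) (smash_arr M L X' n (\<phi> n k)) (Dgn M n f)"
  let ?P = "\<lambda>g. g \<in> hom (und M) ?T ?T' \<and>
    (\<forall>n. \<forall>k \<in> simplices K n. Comp (lev M n) (Dgn M n g) (smash_arr M K X n k) = ?p n k)"
  have X: "X \<in> Obj M" and X': "X' \<in> Obj M"
    using und_obj[OF f] by blast+
  have T': "?T' \<in> Obj M"
    using smash_obj[OF X' L] .
  have "family M K X' ?T' (\<lambda>n k. smash_arr M L X' n (\<phi> n k))"
    using family_in[OF smash_arr_family[OF X' L]] family_act[OF smash_arr_family[OF X' L]]
    by (intro familyI) (simp_all add: in_L act)
  then have p: "family M K X ?T' ?p"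
    using f by (rule family_pre)
  have "\<phi> 0 (bpt K) = base L 0"
    using bpt simplicial_set.act_id[of "forget_pt L" "bpt L" 0] L
    by (simp add: base_def dgn_def pointed_sset_def)
  then have "?p 0 (bpt K) = Comp (lev M 0) (Dgn M 0 (zero X' ?T')) (Dgn M 0 f)"
    using smash_arr_base[OF X' L] by simp
  also have "\<dots> = zero X ?T'"
    using zero_comp[OF _ f, of ?T'] T' Dgn_0[OF f] Dgn_0[OF zero_in[OF X' T']] by (simp add: und_eq_lev)
  finally have "?p 0 (bpt K) = zero X ?T'" .
  then obtain g where "g \<in> hom (und M) ?T ?T'"
    "\<And>n k. k \<in> simplices K n \<Longrightarrow> Comp (lev M n) (Dgn M n g) (smash_arr M K X n k) = ?p n k"
    by (rule smash_vertex_exists[OF X T' K p]) (rule that)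
  then have g: "?P g"
    by simp
  have uniq: "h = g" if h: "?P h" for h
  proof (rule smash_vertex_unique[OF X K conjunct1[OF h] conjunct1[OF g]])
    fix n k assume k: "k \<in> simplices K n"
    show "Comp (lev M n) (Dgn M n h) (smash_arr M K X n k) = Comp (lev M n) (Dgn M n g) (smash_arr M K X n k)"
      by (rule trans[OF bspec[OF spec[OF conjunct2[OF h]] k] sym[OF bspec[OF spec[OF conjunct2[OF g]] k]]])
  qed
  \<comment> \<open>The condition on untagged simplices under the \<open>THE\<close> is the tagged
    condition \<open>?P\<close>.\<close>
  have "(h \<in> hom (und M) ?T ?T' \<and> (\<forall>n. \<forall>k \<in> simplices K n.
           scomp M X ?T ?T' n (dgn (Map M ?T ?T') n (vtx h)) (smash_unit M X K n k) =
           scomp M X X' ?T' n (smash_unit M X' L n (\<phi> n k)) (dgn (Map M X X') n (vtx f)))) = ?P h" for h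
    using f by (auto simp: und_eq_lev lev_hom Dgn_simp smash_arr_def)
  then have "smash_map M f K L \<phi> = (THE h. ?P h)"
    unfolding smash_map_def Let_def und_Dom_Cod[OF f] by (rule arg_cong[OF ext])
  also have "\<dots> = g"
    using g uniq by (rule the_equality)
  finally have "smash_map M f K L \<phi> = g" .
  with g show "smash_map M f K L \<phi> \<in> hom (und M) ?T ?T'"
    and "k \<in> simplices K n \<Longrightarrow> Comp (lev M n) (Dgn M n (smash_map M f K L \<phi>)) (smash_arr M K X n k) = ?p n k"
    by simp_all
qed

lemma Cone_map_in: "f \<in> hom (und M) X X' \<Longrightarrow> Cone_map M f \<in> hom (und M) (Cone M X) (Cone M X')"
  unfolding Cone_map_def Cone_def by (rule smash_map(1)) (simp_all add: pointed_sset_interval)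

lemma Cone_map_arr:
  assumes "f \<in> hom (und M) X X'" "k \<in> simplices I n"
  shows "Comp (lev M n) (Dgn M n (Cone_map M f)) (cone_arr M X n k) =
    Comp (lev M n) (cone_arr M X' n k) (Dgn M n f)"
  unfolding Cone_map_def cone_arr_def
  by (rule smash_map(2)) (simp_all add: pointed_sset_interval assms)

lemma Dgn_comp_arr:
  assumes "X \<in> Obj M" "f \<in> hom (und M) (Cone M X) Y" "g \<in> hom (und M) Y Z" "k \<in> simplices I n"
  shows "Comp (lev M n) (Dgn M n (Comp (und M) g f)) (cone_arr M X n k) =
    Comp (lev M n) (Dgn M n g) (Comp (lev M n) (Dgn M n f) (cone_arr M X n k))"
  using lev_assoc[OF cone_arr_in[OF assms(1,4)] Dgn_in[OF assms(2)] Dgn_in[OF assms(3)]]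
    Dgn_Comp[OF assms(2,3)] by simp

lemma Cone_map_Idn:
  assumes "X \<in> Obj M"
  shows "Cone_map M (Idn (und M) X) = Idn (und M) (Cone M X)"
proof (rule cone_unique[OF assms])
  have i: "Idn (und M) X \<in> hom (und M) X X" and ci: "Idn (und M) (Cone M X) \<in> hom (und M) (Cone M X) (Cone M X)"
    using idn_in assms Cone_obj by (simp_all add: und_eq_lev(1))
  show "Cone_map M (Idn (und M) X) \<in> hom (und M) (Cone M X) (Cone M X)"
    and "Idn (und M) (Cone M X) \<in> hom (und M) (Cone M X) (Cone M X)"
    using Cone_map_in[OF i] ci .
  fix n and k :: "'u univ" assume k: "k \<in> simplices I n"
  note u = cone_arr_in[OF assms k]
  show "Comp (lev M n) (Dgn M n (Cone_map M (Idn (und M) X))) (cone_arr M X n k) =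
      Comp (lev M n) (Dgn M n (Idn (und M) (Cone M X))) (cone_arr M X n k)"
    using Cone_map_arr[OF i k] category.idn_left[OF category_lev u] category.idn_right[OF category_lev u]
      assms Cone_obj[OF assms] by (simp add: Dgn_Idn)
qed

lemma Cone_map_Comp:
  assumes f: "f \<in> hom (und M) X Y" and g: "g \<in> hom (und M) Y Z"
  shows "Cone_map M (Comp (und M) g f) = Comp (und M) (Cone_map M g) (Cone_map M f)"
proof (rule cone_unique)
  show X: "X \<in> Obj M"
    using und_obj[OF f] by blast
  have Y: "Y \<in> Obj M"
    using und_obj[OF f] by blast
  have gf: "Comp (und M) g f \<in> hom (und M) X Z"
    using comp_in f g .
  note Cf = Cone_map_in[OF f] and Cg = Cone_map_in[OF g]
  show "Cone_map M (Comp (und M) g f) \<in> hom (und M) (Cone M X) (Cone M Z)"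
    using Cone_map_in[OF gf] .
  show "Comp (und M) (Cone_map M g) (Cone_map M f) \<in> hom (und M) (Cone M X) (Cone M Z)"
    using comp_in Cf Cg .
  fix n and k :: "'u univ" assume k: "k \<in> simplices I n"
  have "Comp (lev M n) (Dgn M n (Cone_map M (Comp (und M) g f))) (cone_arr M X n k) =
      Comp (lev M n) (Comp (lev M n) (cone_arr M Z n k) (Dgn M n g)) (Dgn M n f)"
    using Cone_map_arr[OF gf k] Dgn_Comp[OF f g]
      lev_assoc[OF Dgn_in[OF f] Dgn_in[OF g] cone_arr_in[OF und_obj(2)[OF g] k]] by simp
  also have "\<dots> = Comp (lev M n) (Dgn M n (Cone_map M g)) (Comp (lev M n) (cone_arr M Y n k) (Dgn M n f))"
    using Cone_map_arr[OF g k] lev_assoc[OF Dgn_in[OF f] cone_arr_in[OF Y k] Dgn_in[OF Cg]] by simp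
  also have "\<dots> = Comp (lev M n) (Dgn M n (Comp (und M) (Cone_map M g) (Cone_map M f))) (cone_arr M X n k)"
    using Cone_map_arr[OF f k] Dgn_comp_arr[OF X Cf Cg k] by simp
  finally show "Comp (lev M n) (Dgn M n (Cone_map M (Comp (und M) g f))) (cone_arr M X n k) =
      Comp (lev M n) (Dgn M n (Comp (und M) (Cone_map M g) (Cone_map M f))) (cone_arr M X n k)" .
qed

lemma one_in_interval: "Inl (replicate (Suc n) 1) \<in> simplices I n"
  using const_in_dmaps[of 1 1 n] by (simp add: interval_simps del: replicate_Suc)

text \<open>The inclusion of \<open>endpoints\<close> keeps the vertex 1, so the defining equation
  of \<open>smash_map\<close> at that vertex removes the detour through X \<and>
  \<open>endpoints\<close>.\<close>

lemma Cone_incl_eq: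
  assumes "X \<in> Obj M"
  shows "Cone_incl M X = cone_arr M X 0 (Inl [1])"
proof -
  have i: "Idn (und M) X \<in> hom (und M) X X"
    using idn_in assms by (simp add: und_eq_lev(1))
  have 1: "Inl [1] \<in> simplices (endpoints :: 'u univ psset) 0"
    by (simp add: endpoints_simps)
  let ?g = "smash_map M (Idn (und M) X) endpoints interval (\<lambda>n x. x)"
  have hyps: "act endpoints n \<theta> k = act interval n \<theta> k" "bpt endpoints = bpt I"
    if "k \<in> simplices (endpoints :: 'u univ psset) n" for n \<theta> and k :: "'u univ"
    by (simp_all add: endpoints_def interval_def)
  have g: "?g \<in> hom (und M) (smash M X endpoints) (smash M X interval)"
    by (rule smash_map(1)[OF i pointed_sset_endpoints pointed_sset_interval])
      (use endpoints_subset hyps in \<open>auto simp: endpoints_simps interval_simps\<close>)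
  have eq: "Comp (lev M 0) (Dgn M 0 ?g) (smash_arr M endpoints X 0 (Inl [1])) =
      Comp (lev M 0) (smash_arr M interval X 0 (Inl [1])) (Dgn M 0 (Idn (und M) X))"
    by (rule smash_map(2)[OF i pointed_sset_endpoints pointed_sset_interval])
      (use endpoints_subset hyps 1 in \<open>auto simp: endpoints_simps interval_simps\<close>)
  have u: "cone_arr M X 0 (Inl [1]) \<in> hom (und M) X (Cone M X)"
    using cone_arr_in[OF assms, of "Inl [1]" 0] one_in_interval[of 0] by (simp add: und_eq_lev)
  show ?thesis
    using eq Dgn_0[OF g] Dgn_0[OF i] idn_right[OF u]
    by (simp add: Cone_incl_def smash_unit_iso_def smash_arr_def cone_arr_def und_eq_lev(5))
qed

lemma Cone_incl_in:
  assumes "X \<in> Obj M"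
  shows "Cone_incl M X \<in> hom (und M) X (Cone M X)"
  using cone_arr_in[OF assms one_in_interval[of 0]] assms by (simp add: und_eq_lev Cone_incl_eq)

lemma Dgn_Cone_incl:
  assumes "X \<in> Obj M"
  shows "Dgn M n (Cone_incl M X) = cone_arr M X n (Inl (replicate (Suc n) 1))"
proof -
  have "dcomp (replicate (Suc 0) 1) (replicate (Suc n) 0) = replicate (Suc n) (1::nat)"
    by (rule dcomp_replicate) (rule const_in_dmaps, simp)
  then show ?thesis
    using cone_arr_act[OF assms const_in_dmaps[of 0 0 n] one_in_interval[of 0]] assms
    by (simp add: Cone_incl_eq Dgn_def interval_simps)
qed

lemma Cone_incl_natural:
  assumes f: "f \<in> hom (und M) X Y"
  shows "Comp (und M) (Cone_map M f) (Cone_incl M X) = Comp (und M) (Cone_incl M Y) f"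
  using Cone_map_arr[OF f one_in_interval[of 0]] Dgn_0[OF f] Dgn_0[OF Cone_map_in[OF f]] und_obj[OF f]
  by (simp add: Cone_incl_eq und_eq_lev(5))

text \<open>Uniqueness for the outer cone leaves an equation between \<open>n\<close>-simplices of
  Map(C(X), Y), for which the inner cone needs \<open>smash_unique\<close> in degree
  \<open>n\<close>. Coordinates \<open>k\<close> and \<open>l\<close> of equal degree still suffice,
  because the outer one can be restricted to the degree of the inner one.\<close>

lemma cone_cone_unique:
  assumes X: "X \<in> Obj M"
    and a: "a \<in> hom (und M) (Cone M (Cone M X)) Y" and b: "b \<in> hom (und M) (Cone M (Cone M X)) Y"
    and eq: "\<And>n k l. k \<in> simplices I n \<Longrightarrow> l \<in> simplices I n \<Longrightarrow>
      Comp (lev M n) (Dgn M n a) (Comp (lev M n) (cone_arr M (Cone M X) n l) (cone_arr M X n k)) =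
      Comp (lev M n) (Dgn M n b) (Comp (lev M n) (cone_arr M (Cone M X) n l) (cone_arr M X n k))"
  shows "a = b"
proof (rule cone_unique[OF Cone_obj[OF X] a b])
  note CX = Cone_obj[OF X]
  fix n and l :: "'u univ" assume l: "l \<in> simplices I n"
  \<comment> \<open>Restriction along \<open>\<sigma>\<close> fixes the degenerate part coming from
    \<open>c\<close> and moves entirely onto the outer coordinate \<open>l\<close>.\<close>
  have *: "Comp (lev M m) (Act M n \<sigma> (Comp (lev M n) (Dgn M n c) (cone_arr M (Cone M X) n l))) (cone_arr M X m k) =
      Comp (lev M m) (Dgn M m c) (Comp (lev M m) (cone_arr M (Cone M X) m (act I n \<sigma> l)) (cone_arr M X m k))"
    if k: "k \<in> simplices I m" and \<sigma>: "\<sigma> \<in> dmaps m n" and c: "c \<in> hom (und M) (Cone M (Cone M X)) Y" for m k \<sigma> c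
    using Act_Comp[OF \<sigma> cone_arr_in[OF CX l] Dgn_in[OF c]] Act_Dgn[OF \<sigma> c] cone_arr_act[OF CX \<sigma> l]
      lev_assoc[OF cone_arr_in[OF X k] cone_arr_in[OF CX interval_act_in[OF \<sigma> l]] Dgn_in[OF c]]
    by simp
  show "Comp (lev M n) (Dgn M n a) (cone_arr M (Cone M X) n l) = Comp (lev M n) (Dgn M n b) (cone_arr M (Cone M X) n l)"
  proof (rule smash_unique[OF X pointed_sset_interval])
    show "Comp (lev M n) (Dgn M n a) (cone_arr M (Cone M X) n l) \<in> hom (lev M n) (smash M X I) Y"
      "Comp (lev M n) (Dgn M n b) (cone_arr M (Cone M X) n l) \<in> hom (lev M n) (smash M X I) Y"
      using lev_in[OF cone_arr_in[OF CX l] Dgn_in[OF a]] lev_in[OF cone_arr_in[OF CX l] Dgn_in[OF b]]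
      by (simp_all add: Cone_def)
    fix m k \<sigma> assume k: "k \<in> simplices I m" and \<sigma>: "\<sigma> \<in> dmaps m n"
    show "Comp (lev M m) (Act M n \<sigma> (Comp (lev M n) (Dgn M n a) (cone_arr M (Cone M X) n l))) (smash_arr M I X m k) =
        Comp (lev M m) (Act M n \<sigma> (Comp (lev M n) (Dgn M n b) (cone_arr M (Cone M X) n l))) (smash_arr M I X m k)"
      using *[OF k \<sigma> a] *[OF k \<sigma> b] eq[OF k interval_act_in[OF \<sigma> l]] by (simp add: cone_arr_def)
  qed
qed

text \<open>An \<open>n\<close>-simplex of \<open>Map(C(X), C(C(X)))\<close> that swaps a fixed coordinate \<open>l \<in> I\<^sub>n\<close> with the
  cone coordinate; as \<open>l\<close> varies, these assemble to \<open>flip\<close>.\<close>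

lemma flip_slice_exists:
  assumes X: "X \<in> Obj M" and l: "l \<in> simplices I n"
  shows "\<exists>a. a \<in> hom (lev M n) (Cone M X) (Cone M (Cone M X)) \<and>
    (\<forall>m. \<forall>k \<in> simplices I m. \<forall>\<sigma> \<in> dmaps m n. Comp (lev M m) (Act M n \<sigma> a) (cone_arr M X m k) =
      Comp (lev M m) (cone_arr M (Cone M X) m k) (cone_arr M X m (act I n \<sigma> l)))"
proof -
  note CX = Cone_obj[OF X] and CCX = Cone_obj[OF Cone_obj[OF X]]
  note u = cone_arr_in[OF X] and v = cone_arr_in[OF CX]
  show ?thesis
  proof (rule smash_exists[OF X CCX pointed_sset_interval, where n = n and
        w = "\<lambda>m k \<sigma>. Comp (lev M m) (cone_arr M (Cone M X) m k) (cone_arr M X m (act I n \<sigma> l))"])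
    show "Comp (lev M m) (cone_arr M (Cone M X) m k) (cone_arr M X m (act I n \<sigma> l))
        \<in> hom (lev M m) X (Cone M (Cone M X))"
      if "k \<in> simplices I m" "\<sigma> \<in> dmaps m n" for m k \<sigma>
      using lev_in[OF u[OF interval_act_in[OF that(2) l]] v[OF that(1)]] .
    show "Comp (lev M j) (cone_arr M (Cone M X) j (act I m \<theta> k)) (cone_arr M X j (act I n (dcomp \<sigma> \<theta>) l)) =
        Act M m \<theta> (Comp (lev M m) (cone_arr M (Cone M X) m k) (cone_arr M X m (act I n \<sigma> l)))"
      if "k \<in> simplices I m" "\<sigma> \<in> dmaps m n" "\<theta> \<in> dmaps j m" for m j k \<sigma> \<theta>
      using Act_Comp[OF that(3) u[OF interval_act_in[OF that(2) l]] v[OF that(1)]]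
        cone_arr_act[OF CX that(3,1)] cone_arr_act[OF X that(3) interval_act_in[OF that(2) l]]
        interval_act_dcomp[OF that(2,3) l] by simp
    show "Comp (lev M m) (cone_arr M (Cone M X) m (base I m)) (cone_arr M X m (act I n \<sigma> l)) =
        Dgn M m (zero X (Cone M (Cone M X)))"
      if "\<sigma> \<in> dmaps m n" for m \<sigma>
      using zero_comp_cone_arr[OF X CCX interval_act_in[OF that l]] cone_arr_base[OF CX] by simp
  next
    fix a assume "a \<in> hom (lev M n) (smash M X I) (Cone M (Cone M X))"
      "\<And>m k \<sigma>. k \<in> simplices I m \<Longrightarrow> \<sigma> \<in> dmaps m n \<Longrightarrow>
        Comp (lev M m) (Act M n \<sigma> a) (smash_arr M I X m k) =
        Comp (lev M m) (cone_arr M (Cone M X) m k) (cone_arr M X m (act I n \<sigma> l))"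
    then show ?thesis
      by (intro exI[of _ a]) (simp add: Cone_def cone_arr_def)
  qed
qed

text \<open>The slices for varying \<open>l\<close> must form a pointed simplicial map into
  Map(C(X), C(C(X))). They are chosen by \<open>SOME\<close>, but each is determined by its defining
  equations, and this forces compatibility with the simplicial operators.\<close>

lemma flip_exists:
  assumes X: "X \<in> Obj M"
  shows "\<exists>g. g \<in> hom (und M) (Cone M (Cone M X)) (Cone M (Cone M X)) \<and>
     (\<forall>n. \<forall>k \<in> simplices I n. \<forall>l \<in> simplices I n.
        Comp (lev M n) (Dgn M n g) (Comp (lev M n) (cone_arr M (Cone M X) n l) (cone_arr M X n k)) =
        Comp (lev M n) (cone_arr M (Cone M X) n k) (cone_arr M X n l))"
proof -
  note CX = Cone_obj[OF X] and CCX = Cone_obj[OF Cone_obj[OF X]]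
  note u = cone_arr_in[OF X] and v = cone_arr_in[OF CX]
  define q where "q = (\<lambda>n l. SOME a. a \<in> hom (lev M n) (Cone M X) (Cone M (Cone M X)) \<and>
    (\<forall>m. \<forall>k \<in> simplices I m. \<forall>\<sigma> \<in> dmaps m n. Comp (lev M m) (Act M n \<sigma> a) (cone_arr M X m k) =
      Comp (lev M m) (cone_arr M (Cone M X) m k) (cone_arr M X m (act I n \<sigma> l))))"
  have "q n l \<in> hom (lev M n) (Cone M X) (Cone M (Cone M X)) \<and>
    (\<forall>m. \<forall>k \<in> simplices I m. \<forall>\<sigma> \<in> dmaps m n. Comp (lev M m) (Act M n \<sigma> (q n l)) (cone_arr M X m k) =
      Comp (lev M m) (cone_arr M (Cone M X) m k) (cone_arr M X m (act I n \<sigma> l)))"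
    if "l \<in> simplices I n" for n l
    unfolding q_def by (rule someI_ex[OF flip_slice_exists[OF X that]])
  then have q_in: "\<And>n l. l \<in> simplices I n \<Longrightarrow> q n l \<in> hom (lev M n) (Cone M X) (Cone M (Cone M X))"
    and q: "\<And>n l m k \<sigma>. l \<in> simplices I n \<Longrightarrow> k \<in> simplices I m \<Longrightarrow> \<sigma> \<in> dmaps m n \<Longrightarrow>
      Comp (lev M m) (Act M n \<sigma> (q n l)) (cone_arr M X m k) =
      Comp (lev M m) (cone_arr M (Cone M X) m k) (cone_arr M X m (act I n \<sigma> l))"
    by simp_all
  have q_unique: "a = b"
    if "a \<in> hom (lev M n) (Cone M X) (Cone M (Cone M X))" "b \<in> hom (lev M n) (Cone M X) (Cone M (Cone M X))"
      "\<And>m k \<sigma>. k \<in> simplices I m \<Longrightarrow> \<sigma> \<in> dmaps m n \<Longrightarrow>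
        Comp (lev M m) (Act M n \<sigma> a) (cone_arr M X m k) = Comp (lev M m) (Act M n \<sigma> b) (cone_arr M X m k)"
    for a b n
    using smash_unique[OF X pointed_sset_interval, of a n _ b] that by (simp add: Cone_def cone_arr_def)
  have fam: "family M I (Cone M X) (Cone M (Cone M X)) q"
  proof (rule familyI)
    fix n m \<theta> and l :: "'u univ" assume \<theta>: "\<theta> \<in> dmaps m n" and l: "l \<in> simplices I n"
    show "q m (act I n \<theta> l) = Act M n \<theta> (q n l)"
    proof (rule q_unique)
      fix j k \<sigma> assume k: "k \<in> simplices I j" and \<sigma>: "\<sigma> \<in> dmaps j m"
      show "Comp (lev M j) (Act M m \<sigma> (q m (act I n \<theta> l))) (cone_arr M X j k) =
          Comp (lev M j) (Act M m \<sigma> (Act M n \<theta> (q n l))) (cone_arr M X j k)"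
        using q[OF interval_act_in[OF \<theta> l] k \<sigma>] q[OF l k dcomp_in[OF \<theta> \<sigma>]]
          Act_dcomp[OF \<theta> \<sigma> q_in[OF l]] interval_act_dcomp[OF \<theta> \<sigma> l] by simp
    qed (simp_all add: q_in l \<theta> Act_in[OF \<theta> q_in[OF l]] interval_act_in)
  qed (rule q_in)
  have z: "zero (Cone M X) (Cone M (Cone M X)) \<in> hom (und M) (Cone M X) (Cone M (Cone M X))"
    using zero_in[OF CX CCX] .
  have b0: "base I 0 = bpt I"
    by (simp add: base_interval interval_simps)
  \<comment> \<open>At the base vertex the coordinate \<open>l\<close>, which the slice places
    inside, is the base point; hence every value is a composite with a zero arrow on the
    right.\<close>
  have "q 0 (base I 0) = Dgn M 0 (zero (Cone M X) (Cone M (Cone M X)))"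
  proof (rule q_unique)
    show "q 0 (base I 0) \<in> hom (lev M 0) (Cone M X) (Cone M (Cone M X))"
      using q_in[OF base_in[OF pointed_sset_interval]] .
    show "Dgn M 0 (zero (Cone M X) (Cone M (Cone M X))) \<in> hom (lev M 0) (Cone M X) (Cone M (Cone M X))"
      using Dgn_in[OF z] .
    fix m k \<sigma> assume k: "k \<in> simplices I m" and \<sigma>: "\<sigma> \<in> dmaps m 0"
    have "Comp (lev M m) (Act M 0 \<sigma> (q 0 (base I 0))) (cone_arr M X m k) =
        Comp (lev M m) (cone_arr M (Cone M X) m k) (Dgn M m (zero X (Cone M X)))"
      using q[OF base_in[OF pointed_sset_interval] k \<sigma>] cone_arr_base[OF X]
        act_base[of I, OF pointed_sset_interval \<sigma>] by simp
    also have "\<dots> = Dgn M m (zero X (Cone M (Cone M X)))"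
      using cone_arr_comp_zero[OF CX X k] .
    also have "\<dots> = Comp (lev M m) (Act M 0 \<sigma> (Dgn M 0 (zero (Cone M X) (Cone M (Cone M X))))) (cone_arr M X m k)"
      using zero_comp_cone_arr[OF X CCX k] Act_Dgn[OF \<sigma> z] by simp
    finally show "Comp (lev M m) (Act M 0 \<sigma> (q 0 (base I 0))) (cone_arr M X m k) =
        Comp (lev M m) (Act M 0 \<sigma> (Dgn M 0 (zero (Cone M X) (Cone M (Cone M X))))) (cone_arr M X m k)" .
  qed
  then have "q 0 (bpt I) = zero (Cone M X) (Cone M (Cone M X))"
    using Dgn_0[OF z] b0 by simp
  then obtain g where g: "g \<in> hom (und M) (Cone M (Cone M X)) (Cone M (Cone M X))"
    and gq: "\<And>n l. l \<in> simplices I n \<Longrightarrow> Comp (lev M n) (Dgn M n g) (cone_arr M (Cone M X) n l) = q n l"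
    using cone_exists[OF CX CCX fam] by blast
  \<comment> \<open>The slice equation is used with \<open>\<sigma>\<close> the identity of [n], so
    that both coordinates have degree \<open>n\<close>.\<close>
  have "Comp (lev M n) (Dgn M n g) (Comp (lev M n) (cone_arr M (Cone M X) n l) (cone_arr M X n k)) =
      Comp (lev M n) (cone_arr M (Cone M X) n k) (cone_arr M X n l)"
    if k: "k \<in> simplices I n" and l: "l \<in> simplices I n" for n k l
    using lev_assoc[OF u[OF k] v[OF l] Dgn_in[OF g]] gq[OF l] q[OF l k id_in_dmaps] Act_id[OF q_in[OF l]]
      simplicial_set.act_id[OF simplicial_set_interval, of l n] l by simp
  with g show ?thesis
    by blast
qed

lemma flip_in: "X \<in> Obj M \<Longrightarrow> flip M X \<in> hom (und M) (Cone M (Cone M X)) (Cone M (Cone M X))"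
  and flip_arr: "X \<in> Obj M \<Longrightarrow> k \<in> simplices I n \<Longrightarrow> l \<in> simplices I n \<Longrightarrow>
    Comp (lev M n) (Dgn M n (flip M X)) (Comp (lev M n) (cone_arr M (Cone M X) n l) (cone_arr M X n k)) =
    Comp (lev M n) (cone_arr M (Cone M X) n k) (cone_arr M X n l)"
  using someI_ex[OF flip_exists, of X] by (simp_all add: flip_def)

lemma flip_flip:
  assumes X: "X \<in> Obj M"
  shows "Comp (und M) (flip M X) (flip M X) = Idn (und M) (Cone M (Cone M X))"
proof (rule cone_cone_unique[OF X])
  note CX = Cone_obj[OF X] and CCX = Cone_obj[OF Cone_obj[OF X]]
  note fl = flip_in[OF X]
  show "Comp (und M) (flip M X) (flip M X) \<in> hom (und M) (Cone M (Cone M X)) (Cone M (Cone M X))"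
    using comp_in fl fl .
  show "Idn (und M) (Cone M (Cone M X)) \<in> hom (und M) (Cone M (Cone M X)) (Cone M (Cone M X))"
    using idn_in CCX by (simp add: und_eq_lev(1))
  fix n and k l :: "'u univ" assume k: "k \<in> simplices I n" and l: "l \<in> simplices I n"
  note uv = lev_in[OF cone_arr_in[OF X k] cone_arr_in[OF CX l]]
  show "Comp (lev M n) (Dgn M n (Comp (und M) (flip M X) (flip M X)))
        (Comp (lev M n) (cone_arr M (Cone M X) n l) (cone_arr M X n k)) =
      Comp (lev M n) (Dgn M n (Idn (und M) (Cone M (Cone M X))))
        (Comp (lev M n) (cone_arr M (Cone M X) n l) (cone_arr M X n k))"
    using lev_assoc[OF uv Dgn_in[OF fl] Dgn_in[OF fl]] flip_arr[OF X k l] flip_arr[OF X l k]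
      Dgn_Comp[OF fl fl] Dgn_Idn[OF CCX] category.idn_left[OF category_lev uv] by simp
qed

lemma Cone_map_Cone_map_arr:
  assumes f: "f \<in> hom (und M) X Y" and k: "k \<in> simplices I n" and l: "l \<in> simplices I n"
  shows "Comp (lev M n) (Dgn M n (Cone_map M (Cone_map M f)))
      (Comp (lev M n) (cone_arr M (Cone M X) n l) (cone_arr M X n k)) =
    Comp (lev M n) (Comp (lev M n) (cone_arr M (Cone M Y) n l) (cone_arr M Y n k)) (Dgn M n f)"
proof -
  have X: "X \<in> Obj M" and Y: "Y \<in> Obj M"
    using und_obj[OF f] by blast+
  note CX = Cone_obj[OF X] and CY = Cone_obj[OF Y]
  note Cf = Cone_map_in[OF f] and uX = cone_arr_in[OF X k] and uY = cone_arr_in[OF Y k]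
  note vX = cone_arr_in[OF CX l] and vY = cone_arr_in[OF CY l]
  show ?thesis
    by (rule category.paste_squares[OF category_lev uX vX uY vY Dgn_in[OF f] Dgn_in[OF Cf]
          Dgn_in[OF Cone_map_in[OF Cf]] Cone_map_arr[OF f k] Cone_map_arr[OF Cf l]])
qed

text \<open>In coordinates both sides send (x, k, l) to (f x, l, k).\<close>

lemma flip_natural:
  assumes f: "f \<in> hom (und M) X Y"
  shows "Comp (und M) (flip M Y) (Cone_map M (Cone_map M f)) = Comp (und M) (Cone_map M (Cone_map M f)) (flip M X)"
proof (rule cone_cone_unique)
  show X: "X \<in> Obj M"
    using und_obj[OF f] by blast
  have Y: "Y \<in> Obj M"
    using und_obj[OF f] by blast
  note CX = Cone_obj[OF X] and CY = Cone_obj[OF Y]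
  note CCf = Cone_map_in[OF Cone_map_in[OF f]] and flX = flip_in[OF X] and flY = flip_in[OF Y]
  show "Comp (und M) (flip M Y) (Cone_map M (Cone_map M f)) \<in> hom (und M) (Cone M (Cone M X)) (Cone M (Cone M Y))"
    using comp_in CCf flY .
  show "Comp (und M) (Cone_map M (Cone_map M f)) (flip M X) \<in> hom (und M) (Cone M (Cone M X)) (Cone M (Cone M Y))"
    using comp_in flX CCf .
  fix n and k l :: "'u univ" assume k: "k \<in> simplices I n" and l: "l \<in> simplices I n"
  let ?uv = "Comp (lev M n) (cone_arr M (Cone M X) n l) (cone_arr M X n k)"
  note uv = lev_in[OF cone_arr_in[OF X k] cone_arr_in[OF CX l]]
  note uvY = lev_in[OF cone_arr_in[OF Y k] cone_arr_in[OF CY l]]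
  have "Comp (lev M n) (Dgn M n (Comp (und M) (flip M Y) (Cone_map M (Cone_map M f)))) ?uv =
      Comp (lev M n) (Dgn M n (flip M Y))
        (Comp (lev M n) (Comp (lev M n) (cone_arr M (Cone M Y) n l) (cone_arr M Y n k)) (Dgn M n f))"
    using lev_assoc[OF uv Dgn_in[OF CCf] Dgn_in[OF flY]] Dgn_Comp[OF CCf flY]
      Cone_map_Cone_map_arr[OF f k l] by simp
  also have "\<dots> = Comp (lev M n) (Comp (lev M n) (cone_arr M (Cone M Y) n k) (cone_arr M Y n l)) (Dgn M n f)"
    using lev_assoc[OF Dgn_in[OF f] uvY Dgn_in[OF flY]] flip_arr[OF Y k l] by simp
  also have "\<dots> = Comp (lev M n) (Dgn M n (Cone_map M (Cone_map M f))) (Comp (lev M n) (Dgn M n (flip M X)) ?uv)"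
    using flip_arr[OF X k l] Cone_map_Cone_map_arr[OF f l k] by simp
  also have "\<dots> = Comp (lev M n) (Dgn M n (Comp (und M) (Cone_map M (Cone_map M f)) (flip M X))) ?uv"
    using lev_assoc[OF uv Dgn_in[OF flX] Dgn_in[OF CCf]] Dgn_Comp[OF flX CCf] by simp
  finally show "Comp (lev M n) (Dgn M n (Comp (und M) (flip M Y) (Cone_map M (Cone_map M f)))) ?uv =
      Comp (lev M n) (Dgn M n (Comp (und M) (Cone_map M (Cone_map M f)) (flip M X))) ?uv" .
qed

text \<open>By \<open>Dgn_Cone_incl\<close> the cone inclusion inserts the coordinate constantly 1.
  Under C(c) it is the inner coordinate, and \<open>flip_arr\<close> makes it the outer one.\<close>

lemma flip_Cone_map_incl:
  assumes X: "X \<in> Obj M"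
  shows "Comp (und M) (flip M X) (Cone_map M (Cone_incl M X)) = Cone_incl M (Cone M X)"
proof (rule cone_unique[OF X])
  note CX = Cone_obj[OF X]
  note c = Cone_incl_in[OF X] and Cc = Cone_map_in[OF Cone_incl_in[OF X]] and fl = flip_in[OF X]
  show "Comp (und M) (flip M X) (Cone_map M (Cone_incl M X)) \<in> hom (und M) (Cone M X) (Cone M (Cone M X))"
    using comp_in Cc fl .
  show "Cone_incl M (Cone M X) \<in> hom (und M) (Cone M X) (Cone M (Cone M X))"
    using Cone_incl_in[OF CX] .
  fix n and k :: "'u univ" assume k: "k \<in> simplices I n"
  show "Comp (lev M n) (Dgn M n (Comp (und M) (flip M X) (Cone_map M (Cone_incl M X)))) (cone_arr M X n k) =
      Comp (lev M n) (Dgn M n (Cone_incl M (Cone M X))) (cone_arr M X n k)"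
    unfolding Dgn_comp_arr[OF X Cc fl k] Cone_map_arr[OF c k] Dgn_Cone_incl[OF X] Dgn_Cone_incl[OF CX]
    using flip_arr[OF X one_in_interval k] .
qed

lemma flip_incl_Cone:
  assumes X: "X \<in> Obj M"
  shows "Comp (und M) (flip M X) (Cone_incl M (Cone M X)) = Cone_map M (Cone_incl M X)"
proof -
  note c = Cone_map_in[OF Cone_incl_in[OF X]] and fl = flip_in[OF X]
  have "Comp (und M) (flip M X) (Cone_incl M (Cone M X)) =
      Comp (und M) (Comp (und M) (flip M X) (flip M X)) (Cone_map M (Cone_incl M X))"
    using comp_assoc[OF c fl fl] flip_Cone_map_incl[OF X] by simp
  then show ?thesis
    using idn_left[OF c] flip_flip[OF X] by simp
qed

end

section \<open>The cone preserves left Kan extensions\<close>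

definition cone_fctr :: "('o, 's, 'u) simp_cat \<Rightarrow> ('o, 'o \<times> 'o \<times> 's, 'o, 'o \<times> 'o \<times> 's) fctr" where
  "cone_fctr M = \<lparr>onOb = Cone M, onAr = Cone_map M\<rparr>"

definition path_lift :: "('o, 's, 'u) simp_cat \<Rightarrow> 'o \<Rightarrow> 'o \<Rightarrow> (nat \<Rightarrow> 'u univ \<Rightarrow> 'o \<times> 'o \<times> 's) \<Rightarrow> 'o \<times> 'o \<times> 's" where
  "path_lift M X Y p = (SOME h. h \<in> hom (und M) X (path_obj M Y) \<and>
     (\<forall>n. \<forall>k \<in> simplices interval n. Comp (lev M n) (path_ev M Y n k) (Dgn M n h) = p n k))"

definition path_map :: "('o, 's, 'u) simp_cat \<Rightarrow> 'o \<times> 'o \<times> 's \<Rightarrow> 'o \<times> 'o \<times> 's" where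
  "path_map M g = path_lift M (path_obj M (Dom (und M) g)) (Cod (und M) g)
     (\<lambda>n k. Comp (lev M n) (Dgn M n g) (path_ev M (Dom (und M) g) n k))"

definition path_fctr :: "('o, 's, 'u) simp_cat \<Rightarrow> ('o, 'o \<times> 'o \<times> 's, 'o, 'o \<times> 'o \<times> 's) fctr" where
  "path_fctr M = \<lparr>onOb = path_obj M, onAr = path_map M\<rparr>"

text \<open>The transpose of an arrow out of the cone. It is injective but in general reaches only
  part of the arrows into \<open>path_obj\<close>; \<open>mate_value\<close> and
  \<open>mate_surj\<close> identify which part.\<close>

definition mate :: "('o, 's, 'u) simp_cat \<Rightarrow> 'o \<Rightarrow> 'o \<Rightarrow> 'o \<times> 'o \<times> 's \<Rightarrow> 'o \<times> 'o \<times> 's" where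
  "mate M X Y g = path_lift M X Y (\<lambda>n k. Comp (lev M n) (Dgn M n g) (cone_arr M X n k))"

lemma fctr_simps [simp]:
  "onOb (cone_fctr M) = Cone M" "onAr (cone_fctr M) = Cone_map M"
  "onOb (path_fctr M) = path_obj M" "onAr (path_fctr M) = path_map M"
  by (simp_all add: cone_fctr_def path_fctr_def)

context pointed_simplicial_model_category
begin

lemma is_functor_cone: "is_functor (und M) (und M) (cone_fctr M)"
  by unfold_locales (simp_all add: und_eq_lev(1) Cone_obj Cone_map_in Cone_map_Idn Cone_map_Comp)

lemma path_lift:
  assumes "X \<in> Obj M" "Y \<in> Obj M" "family M I X Y p"
  shows "path_lift M X Y p \<in> hom (und M) X (path_obj M Y)"
    and "k \<in> simplices I n \<Longrightarrow> Comp (lev M n) (path_ev M Y n k) (Dgn M n (path_lift M X Y p)) = p n k"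
proof -
  have "\<exists>h. h \<in> hom (und M) X (path_obj M Y) \<and>
     (\<forall>n. \<forall>k \<in> simplices I n. Comp (lev M n) (path_ev M Y n k) (Dgn M n h) = p n k)"
    by (rule path_exists[OF assms]) blast
  from someI_ex[OF this, folded path_lift_def]
  show "path_lift M X Y p \<in> hom (und M) X (path_obj M Y)"
    and "k \<in> simplices I n \<Longrightarrow> Comp (lev M n) (path_ev M Y n k) (Dgn M n (path_lift M X Y p)) = p n k"
    by simp_all
qed

lemmas path_ev_in = family_in[OF path_ev_family]

lemma path_map_in: "g \<in> hom (und M) Y Z \<Longrightarrow> path_map M g \<in> hom (und M) (path_obj M Y) (path_obj M Z)"
  and path_map_ev: "g \<in> hom (und M) Y Z \<Longrightarrow> k \<in> simplices I n \<Longrightarrow>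
    Comp (lev M n) (path_ev M Z n k) (Dgn M n (path_map M g)) = Comp (lev M n) (Dgn M n g) (path_ev M Y n k)"
  unfolding path_map_def
  using path_lift[OF path_obj_in und_obj(2) family_post[OF path_ev_family]] und_obj
  by (simp_all add: und_Dom_Cod)

lemma path_ev_comp:
  assumes "Y \<in> Obj M" "f \<in> hom (und M) W X" "g \<in> hom (und M) X (path_obj M Y)" "k \<in> simplices I n"
  shows "Comp (lev M n) (path_ev M Y n k) (Dgn M n (Comp (und M) g f)) =
    Comp (lev M n) (Comp (lev M n) (path_ev M Y n k) (Dgn M n g)) (Dgn M n f)"
  using lev_assoc[OF Dgn_in[OF assms(2)] Dgn_in[OF assms(3)] path_ev_in[OF assms(1,4)]]
    Dgn_Comp[OF assms(2,3)] by simp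

lemma is_functor_path: "is_functor (und M) (und M) (path_fctr M)"
proof
  show "onOb (path_fctr M) X \<in> Ob (und M)" if "X \<in> Ob (und M)" for X
    using that by (simp add: und_eq_lev(1) path_obj_in)
  show "onAr (path_fctr M) f \<in> hom (und M) (onOb (path_fctr M) X) (onOb (path_fctr M) Y)"
    if "f \<in> hom (und M) X Y" for f X Y
    using that by (simp add: path_map_in)
next
  fix X assume "X \<in> Ob (und M)"
  then have X: "X \<in> Obj M" and i: "Idn (und M) X \<in> hom (und M) X X"
    using idn_in by (simp_all add: und_eq_lev(1))
  note PX = path_obj_in[OF X]
  have j: "Idn (und M) (path_obj M X) \<in> hom (und M) (path_obj M X) (path_obj M X)"
    using idn_in PX by (simp add: und_eq_lev(1))
  have "path_map M (Idn (und M) X) = Idn (und M) (path_obj M X)"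
  proof (rule path_unique[OF X path_map_in[OF i] j])
    fix n and k :: "'u univ" assume k: "k \<in> simplices I n"
    note e = path_ev_in[OF X k]
    show "Comp (lev M n) (path_ev M X n k) (Dgn M n (path_map M (Idn (und M) X))) =
        Comp (lev M n) (path_ev M X n k) (Dgn M n (Idn (und M) (path_obj M X)))"
      using path_map_ev[OF i k] category.idn_left[OF category_lev e] category.idn_right[OF category_lev e]
      by (simp add: Dgn_Idn[OF X] Dgn_Idn[OF PX])
  qed
  then show "onAr (path_fctr M) (Idn (und M) X) = Idn (und M) (onOb (path_fctr M) X)"
    by simp
next
  fix f g X Y Z assume f: "f \<in> hom (und M) X Y" and g: "g \<in> hom (und M) Y Z"
  note gf = comp_in[OF f g] and Pf = path_map_in[OF f] and Pg = path_map_in[OF g]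
  have Z: "Z \<in> Obj M" and Y: "Y \<in> Obj M" and X: "X \<in> Obj M"
    using und_obj[OF f] und_obj[OF g] by blast+
  have "path_map M (Comp (und M) g f) = Comp (und M) (path_map M g) (path_map M f)"
  proof (rule path_unique[OF Z path_map_in[OF gf] comp_in[OF Pf Pg]])
    fix n and k :: "'u univ" assume k: "k \<in> simplices I n"
    have "Comp (lev M n) (path_ev M Z n k) (Dgn M n (path_map M (Comp (und M) g f))) =
        Comp (lev M n) (Dgn M n g) (Comp (lev M n) (Dgn M n f) (path_ev M X n k))"
      using path_map_ev[OF gf k] lev_assoc[OF path_ev_in[OF X k] Dgn_in[OF f] Dgn_in[OF g]] Dgn_Comp[OF f g]
      by simp
    also have "\<dots> = Comp (lev M n) (Comp (lev M n) (Dgn M n g) (path_ev M Y n k)) (Dgn M n (path_map M f))"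
      using path_map_ev[OF f k] lev_assoc[OF Dgn_in[OF Pf] path_ev_in[OF Y k] Dgn_in[OF g]] by simp
    also have "\<dots> = Comp (lev M n) (path_ev M Z n k) (Dgn M n (Comp (und M) (path_map M g) (path_map M f)))"
      using path_map_ev[OF g k] path_ev_comp[OF Z Pf Pg k] by simp
    finally show "Comp (lev M n) (path_ev M Z n k) (Dgn M n (path_map M (Comp (und M) g f))) =
        Comp (lev M n) (path_ev M Z n k) (Dgn M n (Comp (und M) (path_map M g) (path_map M f)))" .
  qed
  then show "onAr (path_fctr M) (Comp (und M) g f) = Comp (und M) (onAr (path_fctr M) g) (onAr (path_fctr M) f)"
    by simp
qed

section \<open>Transposition between cones and path objects\<close>

lemma mate:
  assumes "X \<in> Obj M" "g \<in> hom (und M) (Cone M X) Y"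
  shows "mate M X Y g \<in> hom (und M) X (path_obj M Y)"
    and "k \<in> simplices I n \<Longrightarrow> Comp (lev M n) (path_ev M Y n k) (Dgn M n (mate M X Y g)) =
      Comp (lev M n) (Dgn M n g) (cone_arr M X n k)"
  unfolding mate_def
  using path_lift[OF assms(1) und_obj(2)[OF assms(2)] family_post[OF cone_arr_family[OF assms(1)] assms(2)]]
  by simp_all

text \<open>Precomposition with C(f) becomes precomposition with f. In \<open>lan_cone\<close> this
  turns the unit obtained by applying the cone back into the given unit.\<close>

lemma mate_comp:
  assumes f: "f \<in> hom (und M) X X'" and g: "g \<in> hom (und M) (Cone M X') Y"
  shows "mate M X Y (Comp (und M) g (Cone_map M f)) = Comp (und M) (mate M X' Y g) f"
proof -
  have X: "X \<in> Obj M" and X': "X' \<in> Obj M" and Y: "Y \<in> Obj M"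
    using und_obj[OF f] und_obj[OF g] by blast+
  note Cf = Cone_map_in[OF f]
  note gf = comp_in[OF Cf g] and mg = mate(1)[OF X' g]
  show ?thesis
  proof (rule path_unique[OF Y mate(1)[OF X gf] comp_in[OF f mg]])
    fix n and k :: "'u univ" assume k: "k \<in> simplices I n"
    show "Comp (lev M n) (path_ev M Y n k) (Dgn M n (mate M X Y (Comp (und M) g (Cone_map M f)))) =
        Comp (lev M n) (path_ev M Y n k) (Dgn M n (Comp (und M) (mate M X' Y g) f))"
      unfolding mate(2)[OF X gf k] path_ev_comp[OF Y f mg k] mate(2)[OF X' g k]
        Dgn_comp_arr[OF X Cf g k] Cone_map_arr[OF f k]
      by (rule lev_assoc[OF Dgn_in[OF f] cone_arr_in[OF X' k] Dgn_in[OF g]])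
  qed
qed

lemma mate_post:
  assumes X: "X \<in> Obj M" and g: "g \<in> hom (und M) (Cone M X) Y" and h: "h \<in> hom (und M) Y Z"
  shows "mate M X Z (Comp (und M) h g) = Comp (und M) (path_map M h) (mate M X Y g)"
proof -
  have Y: "Y \<in> Obj M" and Z: "Z \<in> Obj M"
    using und_obj[OF h] by blast+
  note hg = comp_in[OF g h] and mg = mate(1)[OF X g] and Ph = path_map_in[OF h]
  show ?thesis
  proof (rule path_unique[OF Z mate(1)[OF X hg] comp_in[OF mg Ph]])
    fix n and k :: "'u univ" assume k: "k \<in> simplices I n"
    show "Comp (lev M n) (path_ev M Z n k) (Dgn M n (mate M X Z (Comp (und M) h g))) =
        Comp (lev M n) (path_ev M Z n k) (Dgn M n (Comp (und M) (path_map M h) (mate M X Y g)))"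
      unfolding mate(2)[OF X hg k] path_ev_comp[OF Z mg Ph k] path_map_ev[OF h k] Dgn_comp_arr[OF X g h k]
        mate(2)[OF X g k, symmetric]
      by (rule lev_assoc[OF Dgn_in[OF mg] path_ev_in[OF Y k] Dgn_in[OF h]])
  qed
qed

lemma mate_inj:
  assumes X: "X \<in> Obj M" and g: "g \<in> hom (und M) (Cone M X) Y" and h: "h \<in> hom (und M) (Cone M X) Y"
    and eq: "mate M X Y g = mate M X Y h"
  shows "g = h"
proof (rule cone_unique[OF X g h])
  fix n and k :: "'u univ" assume k: "k \<in> simplices I n"
  show "Comp (lev M n) (Dgn M n g) (cone_arr M X n k) = Comp (lev M n) (Dgn M n h) (cone_arr M X n k)"
    unfolding mate(2)[OF X g k, symmetric] mate(2)[OF X h k, symmetric] eq ..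
qed

text \<open>The arrows \<open>X \<rightarrow> Y\<^sup>I\<close> that arise from arrows \<open>C(X) \<rightarrow> Y\<close> are those whose value at the
  vertex \<open>0\<close> is zero.\<close>

lemma mate_value:
  assumes X: "X \<in> Obj M" and g: "g \<in> hom (und M) (Cone M X) Y"
  shows "Comp (und M) (path_ev M Y 0 (bpt I)) (mate M X Y g) = zero X Y"
proof -
  note CX = Cone_obj[OF X]
  have b: "base I 0 = bpt I"
    by (simp add: base_interval interval_simps)
  have "cone_arr M X 0 (bpt I) = zero X (Cone M X)"
    using cone_arr_base[OF X, of 0] b Dgn_0[OF zero_in[OF X CX]] by simp
  then show ?thesis
    using mate(2)[OF X g bpt_interval_in] Dgn_0[OF mate(1)[OF X g]] Dgn_0[OF g] comp_zero[OF _ g, of X] X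
    by (simp add: und_eq_lev)
qed

lemma mate_surj:
  assumes X: "X \<in> Obj M" and Y: "Y \<in> Obj M" and h: "h \<in> hom (und M) X (path_obj M Y)"
    and z: "Comp (und M) (path_ev M Y 0 (bpt I)) h = zero X Y"
  obtains g where "g \<in> hom (und M) (Cone M X) Y" "mate M X Y g = h"
proof -
  note fam = family_pre[OF path_ev_family[OF Y] h]
  have "Comp (lev M 0) (path_ev M Y 0 (bpt I)) (Dgn M 0 h) = zero X Y"
    using z Dgn_0[OF h] by (simp add: und_eq_lev)
  then obtain g where g: "g \<in> hom (und M) (Cone M X) Y"
    and eq: "\<And>n k. k \<in> simplices I n \<Longrightarrow>
      Comp (lev M n) (Dgn M n g) (cone_arr M X n k) = Comp (lev M n) (path_ev M Y n k) (Dgn M n h)"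
    by (rule cone_exists[OF X Y fam]) (rule that)
  have "mate M X Y g = h"
    by (rule path_unique[OF Y mate(1)[OF X g] h]) (simp add: mate(2)[OF X g] eq)
  with g show thesis
    by (rule that)
qed

lemma mate_natural:
  assumes F: "is_functor A (und M) F" and \<gamma>: "natural A (und M) (comp_fctr (cone_fctr M) F) G \<gamma>"
    and G: "is_functor A (und M) G"
  shows "natural A (und M) F (comp_fctr (path_fctr M) G) (\<lambda>a. mate M (onOb F a) (onOb G a) (\<gamma> a))"
proof (rule naturalI)
  interpret F: is_functor A "und M" F by fact
  interpret G: is_functor A "und M" G by fact
  have Fo: "onOb F a \<in> Obj M" if "a \<in> Ob A" for a
    using F.ob_in[OF that] by (simp add: und_eq_lev(1))
  have in_hom: "\<gamma> a \<in> hom (und M) (Cone M (onOb F a)) (onOb G a)" if "a \<in> Ob A" for a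
    using natural_in[OF \<gamma> that] by simp
  show "mate M (onOb F a) (onOb G a) (\<gamma> a) \<in> hom (und M) (onOb F a) (onOb (comp_fctr (path_fctr M) G) a)"
    if "a \<in> Ob A" for a
    using mate(1)[OF Fo in_hom] that by simp
  fix a b j assume j: "j \<in> hom A a b"
  then have a: "a \<in> Ob A" and b: "b \<in> Ob A"
    using F.A.dom_in F.A.cod_in by (auto simp: hom_def)
  have "Comp (und M) (\<gamma> b) (Cone_map M (onAr F j)) = Comp (und M) (onAr G j) (\<gamma> a)"
    using natural_sq[OF \<gamma> j] by simp
  then show "Comp (und M) (mate M (onOb F b) (onOb G b) (\<gamma> b)) (onAr F j) =
      Comp (und M) (onAr (comp_fctr (path_fctr M) G) j) (mate M (onOb F a) (onOb G a) (\<gamma> a))"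
    using mate_comp[OF F.ar_in[OF j] in_hom[OF b]] mate_post[OF Fo[OF a] in_hom[OF a] G.ar_in[OF j]] by simp
qed

text \<open>The zero family is the competitor in the uniqueness argument inside
  \<open>lan_cone\<close>.\<close>

lemma natural_zero:
  assumes "is_functor A (und M) F" "is_functor A (und M) G"
  shows "natural A (und M) F G (\<lambda>a. zero (onOb F a) (onOb G a))"
proof (rule naturalI)
  interpret F: is_functor A "und M" F by fact
  interpret G: is_functor A "und M" G by fact
  show "zero (onOb F a) (onOb G a) \<in> hom (und M) (onOb F a) (onOb G a)" if "a \<in> Ob A" for a
    using that zero_arrow_in F.ob_in G.ob_in by blast
  fix a b j assume j: "j \<in> hom A a b"
  then have "a \<in> Ob A" "b \<in> Ob A"
    using F.A.dom_in F.A.cod_in by (auto simp: hom_def)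
  then show "Comp (und M) (zero (onOb F b) (onOb G b)) (onAr F j) =
      Comp (und M) (onAr G j) (zero (onOb F a) (onOb G a))"
    using zero_comp[OF G.ob_in F.ar_in[OF j]] comp_zero[OF F.ob_in G.ar_in[OF j]] by simp
qed

text \<open>Naturality of evaluation at the base vertex is what makes "starts at zero" an equation
  between natural families, accessible to \<open>lan_unique\<close>.\<close>

lemma path_value_natural: "natural (und M) (und M) (path_fctr M) inclusion (\<lambda>Y. path_ev M Y 0 (bpt I))"
proof (rule naturalI)
  fix Y assume "Y \<in> Ob (und M)"
  then show "path_ev M Y 0 (bpt I) \<in> hom (und M) (onOb (path_fctr M) Y) (onOb inclusion Y)"
    using path_ev_in[OF _ bpt_interval_in] by (simp add: und_eq_lev)
next
  fix Y Z g assume g: "g \<in> hom (und M) Y Z"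
  then show "Comp (und M) (path_ev M Z 0 (bpt I)) (onAr (path_fctr M) g) =
      Comp (und M) (onAr inclusion g) (path_ev M Y 0 (bpt I))"
    using path_map_ev[OF g bpt_interval_in] Dgn_0[OF g] Dgn_0[OF path_map_in[OF g]] by (simp add: und_eq_lev)
qed

text \<open>An extension problem for the cone of \<open>N\<close> with target \<open>G\<close> is
  transposed to one for \<open>N\<close> whose target is the path object of \<open>G\<close>. The
  hypothesis solves the latter, and the solution is transposed back. Uniqueness is transposed in the
  same way.\<close>

lemma lan_cone:
  assumes L: "is_left_Kan_extension A B (und M) K N F \<eta>"
  shows "is_left_Kan_extension A B (und M) K (comp_fctr (cone_fctr M) N) (comp_fctr (cone_fctr M) F)
    (\<lambda>a \<in> Ob A. Cone_map M (\<eta> a))"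
proof -
  have K: "is_functor A B K" and F: "is_functor B (und M) F"
    and \<eta>: "nat_trans A (und M) N (comp_fctr F K) \<eta>"
    using L by (auto simp: is_left_Kan_extension_def)
  have N: "is_functor A (und M) N"
    using nat_trans.axioms(1)[OF \<eta>] .
  note \<eta> = nat_trans_natural[OF \<eta>]
  interpret K: is_functor A B K by fact
  interpret N: is_functor A "und M" N by fact
  interpret F: is_functor B "und M" F by fact
  have \<eta>_in: "\<eta> a \<in> hom (und M) (onOb N a) (onOb F (onOb K a))" if "a \<in> Ob A" for a
    using natural_in[OF \<eta> that] by simp
  have FO: "onOb F b \<in> Obj M" if "b \<in> Ob B" for b
    using F.ob_in[OF that] by (simp add: und_eq_lev(1))
  have NO: "onOb N a \<in> Obj M" if "a \<in> Ob A" for a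
    using N.ob_in[OF that] by (simp add: und_eq_lev(1))
  show ?thesis
  proof (rule lanI)
    show "is_functor A B K" "is_functor A (und M) (comp_fctr (cone_fctr M) N)"
      "is_functor B (und M) (comp_fctr (cone_fctr M) F)"
      using K is_functor_comp[OF N is_functor_cone] is_functor_comp[OF F is_functor_cone] .
    show "natural A (und M) (comp_fctr (cone_fctr M) N) (comp_fctr (comp_fctr (cone_fctr M) F) K) (\<lambda>a. Cone_map M (\<eta> a))"
      using natural_whisker_left[OF N is_functor_comp[OF K F] is_functor_cone \<eta>]
      by (simp add: natural_def)
  next
    fix G \<gamma>
    assume G: "is_functor B (und M) G"
      and \<gamma>: "natural A (und M) (comp_fctr (cone_fctr M) N) (comp_fctr G K) \<gamma>"
    interpret G: is_functor B "und M" G by fact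
    have GO: "onOb G b \<in> Obj M" if "b \<in> Ob B" for b
      using G.ob_in[OF that] by (simp add: und_eq_lev(1))
    note PG = is_functor_comp[OF G is_functor_path]
    let ?h = "\<lambda>a. mate M (onOb N a) (onOb G (onOb K a)) (\<gamma> a)"
    have \<gamma>_in: "\<gamma> a \<in> hom (und M) (Cone M (onOb N a)) (onOb G (onOb K a))" if "a \<in> Ob A" for a
      using natural_in[OF \<gamma> that] by simp
    have "natural A (und M) N (comp_fctr (comp_fctr (path_fctr M) G) K) ?h"
      using mate_natural[OF N \<gamma> is_functor_comp[OF K G]] by (simp add: natural_def)
    from lan_ex[OF L PG this] obtain H where H: "natural B (und M) F (comp_fctr (path_fctr M) G) H"
      and H\<eta>: "\<And>a. a \<in> Ob A \<Longrightarrow> Comp (und M) (H (onOb K a)) (\<eta> a) = ?h a"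
      by blast
    have H_in: "H b \<in> hom (und M) (onOb F b) (path_obj M (onOb G b))" if "b \<in> Ob B" for b
      using natural_in[OF H that] by simp
    let ?v = "\<lambda>b. path_ev M (onOb G b) 0 (bpt I)"
    have v: "natural B (und M) (comp_fctr (path_fctr M) G) G ?v"
      using natural_whisker_right[OF G path_value_natural] by (simp add: natural_def)
    have v_in: "?v b \<in> hom (und M) (path_obj M (onOb G b)) (onOb G b)" if "b \<in> Ob B" for b
      using natural_in[OF v that] by simp
    \<comment> \<open>This is what allows transposing back. After the unit, \<open>H\<close> is the
      transpose of \<open>\<gamma>\<close> and so starts at zero; since the zero family has the same
      composite with the unit, uniqueness extends the vanishing to all of \<open>B\<close>.\<close>
    have vH: "Comp (und M) (?v b) (H b) = zero (onOb F b) (onOb G b)" if "b \<in> Ob B" for b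
    proof (rule lan_unique[OF L G natural_comp[OF F PG G H v] natural_zero[OF F G] _ that])
      fix a assume a: "a \<in> Ob A"
      note Ka = K.ob_in[OF a]
      show "Comp (und M) (Comp (und M) (?v (onOb K a)) (H (onOb K a))) (\<eta> a) =
          Comp (und M) (zero (onOb F (onOb K a)) (onOb G (onOb K a))) (\<eta> a)"
        using comp_assoc[OF \<eta>_in[OF a] H_in[OF Ka] v_in[OF Ka]] H\<eta>[OF a]
          mate_value[OF NO[OF a] \<gamma>_in[OF a]] zero_comp[OF G.ob_in[OF Ka] \<eta>_in[OF a]] by simp
    qed
    define \<alpha> where "\<alpha> = (\<lambda>b. SOME g. g \<in> hom (und M) (Cone M (onOb F b)) (onOb G b) \<and>
      mate M (onOb F b) (onOb G b) g = H b)"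
    have "\<alpha> b \<in> hom (und M) (Cone M (onOb F b)) (onOb G b) \<and> mate M (onOb F b) (onOb G b) (\<alpha> b) = H b"
      if b: "b \<in> Ob B" for b
    proof -
      have "\<exists>g. g \<in> hom (und M) (Cone M (onOb F b)) (onOb G b) \<and> mate M (onOb F b) (onOb G b) g = H b"
        by (rule mate_surj[OF FO[OF b] GO[OF b] H_in[OF b] vH[OF b]]) blast
      then show ?thesis
        unfolding \<alpha>_def by (rule someI_ex)
    qed
    then have \<alpha>_in: "\<And>b. b \<in> Ob B \<Longrightarrow> \<alpha> b \<in> hom (und M) (Cone M (onOb F b)) (onOb G b)"
      and mate_\<alpha>: "\<And>b. b \<in> Ob B \<Longrightarrow> mate M (onOb F b) (onOb G b) (\<alpha> b) = H b"
      by simp_all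
    have "natural B (und M) (comp_fctr (cone_fctr M) F) G \<alpha>"
    proof (rule naturalI)
      show "\<alpha> b \<in> hom (und M) (onOb (comp_fctr (cone_fctr M) F) b) (onOb G b)" if "b \<in> Ob B" for b
        using \<alpha>_in[OF that] by simp
      fix b b' j assume j: "j \<in> hom B b b'"
      then have b: "b \<in> Ob B" and b': "b' \<in> Ob B"
        using K.B.dom_in K.B.cod_in by (auto simp: hom_def)
      note Fj = F.ar_in[OF j] and Gj = G.ar_in[OF j]
      \<comment> \<open>The arrows \<open>\<alpha> b\<close> were chosen object by object;
        injectivity of transposition reduces their naturality to that of \<open>H\<close>.\<close>
      have "Comp (und M) (\<alpha> b') (Cone_map M (onAr F j)) = Comp (und M) (onAr G j) (\<alpha> b)"
      proof (rule mate_inj[OF FO[OF b] comp_in[OF Cone_map_in[OF Fj] \<alpha>_in[OF b']] comp_in[OF \<alpha>_in[OF b] Gj]])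
        show "mate M (onOb F b) (onOb G b') (Comp (und M) (\<alpha> b') (Cone_map M (onAr F j))) =
            mate M (onOb F b) (onOb G b') (Comp (und M) (onAr G j) (\<alpha> b))"
          unfolding mate_comp[OF Fj \<alpha>_in[OF b']] mate_post[OF FO[OF b] \<alpha>_in[OF b] Gj] mate_\<alpha>[OF b] mate_\<alpha>[OF b']
          using natural_sq[OF H j] by simp
      qed
      then show "Comp (und M) (\<alpha> b') (onAr (comp_fctr (cone_fctr M) F) j) = Comp (und M) (onAr G j) (\<alpha> b)"
        by simp
    qed
    moreover have "Comp (und M) (\<alpha> (onOb K a)) (Cone_map M (\<eta> a)) = \<gamma> a" if a: "a \<in> Ob A" for a
    proof -
      note Ka = K.ob_in[OF a]
      show ?thesis
        by (rule mate_inj[OF NO[OF a] comp_in[OF Cone_map_in[OF \<eta>_in[OF a]] \<alpha>_in[OF Ka]] \<gamma>_in[OF a]])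
          (simp only: mate_comp[OF \<eta>_in[OF a] \<alpha>_in[OF Ka]] mate_\<alpha>[OF Ka] H\<eta>[OF a])
    qed
    ultimately show "\<exists>\<alpha>. natural B (und M) (comp_fctr (cone_fctr M) F) G \<alpha> \<and>
        (\<forall>a \<in> Ob A. Comp (und M) (\<alpha> (onOb K a)) (Cone_map M (\<eta> a)) = \<gamma> a)"
      by blast
  next
    fix G \<alpha> \<beta> b
    assume G: "is_functor B (und M) G"
      and \<alpha>: "natural B (und M) (comp_fctr (cone_fctr M) F) G \<alpha>"
      and \<beta>: "natural B (und M) (comp_fctr (cone_fctr M) F) G \<beta>"
      and eq: "\<forall>a \<in> Ob A. Comp (und M) (\<alpha> (onOb K a)) (Cone_map M (\<eta> a)) = Comp (und M) (\<beta> (onOb K a)) (Cone_map M (\<eta> a))"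
      and b: "b \<in> Ob B"
    have \<alpha>_in: "\<alpha> b \<in> hom (und M) (Cone M (onOb F b)) (onOb G b)" if "b \<in> Ob B" for b
      using natural_in[OF \<alpha> that] by simp
    have \<beta>_in: "\<beta> b \<in> hom (und M) (Cone M (onOb F b)) (onOb G b)" if "b \<in> Ob B" for b
      using natural_in[OF \<beta> that] by simp
    have "mate M (onOb F b) (onOb G b) (\<alpha> b) = mate M (onOb F b) (onOb G b) (\<beta> b)"
    proof (rule lan_unique[OF L is_functor_comp[OF G is_functor_path] mate_natural[OF F \<alpha> G] mate_natural[OF F \<beta> G] _ b])
      fix a assume a: "a \<in> Ob A"
      note Ka = K.ob_in[OF a]
      show "Comp (und M) (mate M (onOb F (onOb K a)) (onOb G (onOb K a)) (\<alpha> (onOb K a))) (\<eta> a) =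
          Comp (und M) (mate M (onOb F (onOb K a)) (onOb G (onOb K a)) (\<beta> (onOb K a))) (\<eta> a)"
        using mate_comp[OF \<eta>_in[OF a] \<alpha>_in[OF Ka]] mate_comp[OF \<eta>_in[OF a] \<beta>_in[OF Ka]] bspec[OF eq a] by simp
    qed
    then show "\<alpha> b = \<beta> b"
      using mate_inj[OF FO[OF b] \<alpha>_in[OF b] \<beta>_in[OF b]] by blast
  qed
qed

end

section \<open>The double cube as a Kan extension\<close>

text \<open>The functor \<open>X \<mapsto> Cone_diagram M X\<close> evaluated at \<open>B\<close>.\<close>

definition stage :: "('o, 's, 'u) simp_cat \<Rightarrow> 'e set \<Rightarrow> ('o, 'o \<times> 'o \<times> 's, 'o, 'o \<times> 'o \<times> 's) fctr" where
  "stage M B = (if B = {} then inclusion else cone_fctr M)"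

lemma stage_simps [simp]:
  "onOb (stage M B) X = (if B = {} then X else Cone M X)" "onAr (stage M B) f = Cone_diagram_map M f B"
  by (simp_all add: stage_def Cone_diagram_map_def)

lemma Cone_diagram_ob [simp]: "onOb (Cone_diagram M X) B = (if B = {} then X else Cone M X)"
  by (simp add: Cone_diagram_def)

locale cubes = pointed_simplicial_model_category M m
  for M :: "('o, 's, 'u) simp_cat" and m :: "('o \<times> 'o \<times> 's) model" +
  fixes S :: "'e set"
    and \<X> :: "'o \<Rightarrow> ('e set, 'e set \<times> 'e set, 'o, 'o \<times> 'o \<times> 's) fctr"
    and \<eta> :: "'o \<Rightarrow> 'e set \<Rightarrow> 'o \<times> 'o \<times> 's"
  assumes cube: "is_cube M S \<X> \<eta>"
begin

abbreviation "P \<equiv> subsets_cat S"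
abbreviation "Q \<equiv> subsets_le1_cat S"
abbreviation "D \<equiv> und M"
abbreviation "incl \<equiv> (inclusion :: ('e set, 'e set \<times> 'e set, 'e set, 'e set \<times> 'e set) fctr)"

lemma P_simps [simp]: "Ob P = Pow S" "u \<in> hom P U V \<longleftrightarrow> u = (U, V) \<and> U \<subseteq> V \<and> V \<subseteq> S" "Idn P U = (U, U)"
  unfolding subsets_cat_def hom_poset_cat by (auto simp: poset_cat_def)

lemma P_Comp [simp]: "Comp P (V', W) (U, V) = (U, W)"
  by (simp add: subsets_cat_def poset_cat_def)

lemma Q_simps [simp]: "U \<in> Ob Q \<longleftrightarrow> U \<subseteq> S \<and> finite U \<and> card U \<le> 1"
  "u \<in> hom Q U V \<longleftrightarrow> u = (U, V) \<and> U \<subseteq> V \<and> V \<subseteq> S \<and> finite V \<and> card V \<le> 1" "Idn Q U = (U, U)"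
proof -
  have "finite U \<and> card U \<le> 1" if "U \<subseteq> V" "finite V" "card V \<le> 1"
    using that finite_subset card_mono le_trans by metis
  then show "u \<in> hom Q U V \<longleftrightarrow> u = (U, V) \<and> U \<subseteq> V \<and> V \<subseteq> S \<and> finite V \<and> card V \<le> 1"
    unfolding subsets_le1_cat_def hom_poset_cat by auto
qed (auto simp: subsets_le1_cat_def poset_cat_def)

lemma category_P: "category P" and category_Q: "category Q"
  unfolding subsets_cat_def subsets_le1_cat_def by (rule category_poset_cat; blast)+

lemma category_PP: "category (prod_cat P P)"
  using category_prod_cat[OF category_P category_P] .

text \<open>A proper subset of a set with at most one element is empty. Hence the maps of the cone
  diagram are identities and cone inclusions only, which drives the case distinctions below.\<close>

lemma Q_empty_or_eq: "u \<in> hom Q B B' \<Longrightarrow> B = B' \<or> (B = {} \<and> B' \<noteq> {})"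
proof -
  assume "u \<in> hom Q B B'"
  then have "B \<subseteq> B'" "finite B'" "card B' \<le> 1"
    by simp_all
  then show ?thesis
    using psubset_card_mono[of B' B] card_eq_0_iff[of B] finite_subset[of B B'] by fastforce
qed

lemma lan_X: "X \<in> Obj M \<Longrightarrow> is_left_Kan_extension Q P D incl (Cone_diagram M X) (\<X> X) (\<eta> X)"
  using cube by (simp add: is_cube_def)

lemma
  assumes "X \<in> Obj M"
  shows is_functor_incl: "is_functor Q P incl"
    and is_functor_X: "is_functor P D (\<X> X)"
    and is_functor_diagram: "is_functor Q D (Cone_diagram M X :: ('e set, _, _, _) fctr)"
    and \<eta>_natural: "natural Q D (Cone_diagram M X) (comp_fctr (\<X> X) incl) (\<eta> X)"
    and \<eta>_ext: "\<eta> X \<in> extensional (Ob Q)"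
  using lan_X[OF assms] nat_trans_natural nat_trans.ext nat_trans.axioms(1)
  unfolding is_left_Kan_extension_def by blast+

lemma X_ob: "X \<in> Obj M \<Longrightarrow> U \<subseteq> S \<Longrightarrow> onOb (\<X> X) U \<in> Obj M"
  using is_functor.ob_in[OF is_functor_X] by (simp add: und_eq_lev(1))

lemma X_ar: "X \<in> Obj M \<Longrightarrow> U \<subseteq> V \<Longrightarrow> V \<subseteq> S \<Longrightarrow> onAr (\<X> X) (U, V) \<in> hom D (onOb (\<X> X) U) (onOb (\<X> X) V)"
  using is_functor.ar_in[OF is_functor_X] by simp

lemma \<eta>_in:
  assumes "X \<in> Obj M" "A \<in> Ob Q"
  shows "\<eta> X A \<in> hom D (onOb (stage M A) X) (onOb (\<X> X) A)"
  using natural_in[OF \<eta>_natural[OF assms(1)] assms(2)] by simp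

lemma is_functor_stage: "is_functor D D (stage M B)"
proof -
  have "is_functor D D inclusion"
    by unfold_locales simp_all
  then show ?thesis
    using is_functor_cone by (simp add: stage_def)
qed

lemma stage_ob: "X \<in> Obj M \<Longrightarrow> onOb (stage M B) X \<in> Obj M"
  using Cone_obj by simp

lemma stage_ar: "f \<in> hom D X Y \<Longrightarrow> Cone_diagram_map M f B \<in> hom D (onOb (stage M B) X) (onOb (stage M B) Y)"
  using is_functor.ar_in[OF is_functor_stage, of f X Y B] by simp

lemma stage_comp: "f \<in> hom D X Y \<Longrightarrow> g \<in> hom D Y Z \<Longrightarrow>
    Cone_diagram_map M (Comp D g f) B = Comp D (Cone_diagram_map M g B) (Cone_diagram_map M f B)"
  using is_functor.pres_comp[OF is_functor_stage, of f X Y g Z B] by simp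

text \<open>This handles the inner cube of the double cube: with a small subset \<open>B\<close>
  fixed in the outer cube, only the functor \<open>stage M B\<close> is applied to the inner one.
  For nonempty \<open>B\<close> it is \<open>lan_cone\<close>.\<close>

lemma lan_stage:
  assumes X: "X \<in> Obj M"
  shows "is_left_Kan_extension Q P D incl (comp_fctr (stage M B) (Cone_diagram M X)) (comp_fctr (stage M B) (\<X> X))
    (\<lambda>A \<in> Ob Q. Cone_diagram_map M (\<eta> X A) B)"
proof (cases "B = {}")
  case True
  have "(\<lambda>A \<in> Ob Q. \<eta> X A) = \<eta> X"
    using \<eta>_ext[OF X] by (simp add: extensional_restrict)
  then show ?thesis
    using lan_X[OF X] True by (simp add: stage_def Cone_diagram_map_def)
next
  case False
  then show ?thesis
    using lan_cone[OF lan_X[OF X]] by (simp add: stage_def Cone_diagram_map_def)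
qed

text \<open>For a fixed arrow \<open>u\<close> the map in the cone diagram is an identity or the
  cone inclusion, and both are natural in the object. Read with \<open>f\<close> fixed instead, the
  same square gives \<open>diagram_map_natural\<close>.\<close>

lemma diagram_ar_natural:
  assumes u: "u \<in> hom Q B B'"
  shows "natural D D (stage M B) (stage M B') (\<lambda>Y. onAr (Cone_diagram M Y) u)"
proof (cases "B = B'")
  case True
  then have u: "u = (B, B)"
    using u by simp
  show ?thesis
  proof (rule naturalI)
    show "onAr (Cone_diagram M Y) u \<in> hom D (onOb (stage M B) Y) (onOb (stage M B') Y)" if "Y \<in> Ob D" for Y
      using that idn_in stage_ob[of Y B] True u by (simp add: Cone_diagram_def und_eq_lev(1))
    fix Y Z f assume f: "f \<in> hom D Y Z"
    have "onAr (Cone_diagram M W) u = Idn D (onOb (stage M B) W)" for W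
      by (simp add: Cone_diagram_def u)
    then show "Comp D (onAr (Cone_diagram M Z) u) (onAr (stage M B) f) =
        Comp D (onAr (stage M B') f) (onAr (Cone_diagram M Y) u)"
      using idn_left[OF stage_ar[OF f, of B]] idn_right[OF stage_ar[OF f, of B]] True
      by (simp only: stage_simps(2))
  qed
next
  case False
  with u have e: "B = {}" "B' \<noteq> {}" "u = (B, B')"
    using Q_empty_or_eq[OF u] by auto
  show ?thesis
  proof (rule naturalI)
    show "onAr (Cone_diagram M Y) u \<in> hom D (onOb (stage M B) Y) (onOb (stage M B') Y)" if "Y \<in> Ob D" for Y
      using that Cone_incl_in e by (simp add: Cone_diagram_def und_eq_lev(1))
    show "Comp D (onAr (Cone_diagram M Z) u) (onAr (stage M B) f) =
        Comp D (onAr (stage M B') f) (onAr (Cone_diagram M Y) u)"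
      if "f \<in> hom D Y Z" for Y Z f
      using Cone_incl_natural[OF that] e by (auto simp: Cone_diagram_def Cone_diagram_map_def)
  qed
qed

lemma diagram_map_natural:
  assumes f: "f \<in> hom D X X'"
  shows "natural Q D (Cone_diagram M X) (Cone_diagram M X') (Cone_diagram_map M f)"
proof (rule naturalI)
  show "Cone_diagram_map M f A \<in> hom D (onOb (Cone_diagram M X) A) (onOb (Cone_diagram M X') A)" for A
    using stage_ar[OF f, of A] by simp
  fix A B u assume "u \<in> hom Q A B"
  from natural_sq[OF diagram_ar_natural[OF this] f]
  show "Comp D (Cone_diagram_map M f B) (onAr (Cone_diagram M X) u) =
      Comp D (onAr (Cone_diagram M X') u) (Cone_diagram_map M f A)"
    by simp
qed

section \<open>Functoriality of the cubes in the object\<close>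

abbreviation "cmap \<equiv> cube_map M S \<X> \<eta>"

text \<open>The \<open>THE\<close> in \<open>cube_map\<close> is an instance of the universal
  property for the cube of \<open>X\<close>, whose target is the cube of \<open>X'\<close> and whose
  datum is the diagram map followed by the unit of \<open>X'\<close>.\<close>

lemma cube_map:
  assumes f: "f \<in> hom D X X'"
  shows cube_map_natural: "natural P D (\<X> X) (\<X> X') (cmap f)"
    and cube_map_\<eta>: "A \<in> Ob Q \<Longrightarrow> Comp D (cmap f A) (\<eta> X A) = Comp D (\<eta> X' A) (Cone_diagram_map M f A)"
proof -
  have X: "X \<in> Obj M" and X': "X' \<in> Obj M"
    using und_obj[OF f] by blast+
  note C = is_functor_diagram[OF X] and C' = is_functor_diagram[OF X']
  note XI = is_functor_comp[OF is_functor_incl[OF X] is_functor_X[OF X']]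
  let ?\<gamma> = "\<lambda>A. Comp D (\<eta> X' A) (Cone_diagram_map M f A)"
  have "natural Q D (Cone_diagram M X) (comp_fctr (\<X> X') incl) ?\<gamma>"
    using natural_comp[OF C C' XI diagram_map_natural[OF f] \<eta>_natural[OF X']] .
  then have "nat_trans Q D (Cone_diagram M X) (comp_fctr (\<X> X') incl) (restrict ?\<gamma> (Ob Q))"
    by (rule natural_nat_trans[OF C XI])
  then have "\<exists>!\<alpha>. nat_trans P D (\<X> X) (\<X> X') \<alpha> \<and>
      (\<forall>a \<in> Ob Q. Comp D (\<alpha> (onOb incl a)) (\<eta> X a) = restrict ?\<gamma> (Ob Q) a)"
    using lan_X[OF X] is_functor_X[OF X'] unfolding is_left_Kan_extension_def by blast
  then have "\<exists>!\<alpha>. nat_trans P D (\<X> X) (\<X> X') \<alpha> \<and> (\<forall>a \<in> Ob Q. Comp D (\<alpha> a) (\<eta> X a) = ?\<gamma> a)"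
    by simp
  from theI'[OF this]
  have "nat_trans P D (\<X> X) (\<X> X') (cmap f) \<and> (\<forall>a \<in> Ob Q. Comp D (cmap f a) (\<eta> X a) = ?\<gamma> a)"
    by (simp add: cube_map_def Let_def und_Dom_Cod[OF f])
  then show "natural P D (\<X> X) (\<X> X') (cmap f)"
    and "A \<in> Ob Q \<Longrightarrow> Comp D (cmap f A) (\<eta> X A) = ?\<gamma> A"
    using nat_trans_natural by blast+
qed

lemma cube_map_in:
  assumes "f \<in> hom D X X'" "U \<subseteq> S"
  shows "cmap f U \<in> hom D (onOb (\<X> X) U) (onOb (\<X> X') U)"
  using natural_in[OF cube_map_natural[OF assms(1)]] assms(2) by simp

lemma cube_map_unique:
  assumes f: "f \<in> hom D X X'" and t: "natural P D (\<X> X) (\<X> X') t"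
    and eq: "\<And>A. A \<in> Ob Q \<Longrightarrow> Comp D (t A) (\<eta> X A) = Comp D (\<eta> X' A) (Cone_diagram_map M f A)"
    and U: "U \<subseteq> S"
  shows "cmap f U = t U"
  by (rule lan_unique[OF lan_X is_functor_X cube_map_natural[OF f] t])
    (use und_obj[OF f] U eq cube_map_\<eta>[OF f] in simp_all)

lemma cube_map_Idn:
  assumes X: "X \<in> Obj M" and U: "U \<subseteq> S"
  shows "cmap (Idn D X) U = Idn D (onOb (\<X> X) U)"
proof (rule cube_map_unique[OF _ _ _ U])
  interpret F: is_functor P D "\<X> X" by (rule is_functor_X[OF X])
  show i: "Idn D X \<in> hom D X X"
    using idn_in X by (simp add: und_eq_lev(1))
  show "natural P D (\<X> X) (\<X> X) (\<lambda>U. Idn D (onOb (\<X> X) U))"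
  proof (rule naturalI)
    show "Idn D (onOb (\<X> X) V) \<in> hom D (onOb (\<X> X) V) (onOb (\<X> X) V)" if "V \<in> Ob P" for V
      using idn_in F.ob_in[OF that] .
    show "Comp D (Idn D (onOb (\<X> X) W)) (onAr (\<X> X) u) = Comp D (onAr (\<X> X) u) (Idn D (onOb (\<X> X) V))"
      if "u \<in> hom P V W" for V W u
      using idn_left[OF F.ar_in[OF that]] idn_right[OF F.ar_in[OF that]] by simp
  qed
  fix A assume A: "A \<in> Ob Q"
  have "Cone_diagram_map M (Idn D X) A = Idn D (onOb (stage M A) X)"
    using is_functor.pres_idn[OF is_functor_stage, of X A] X by (simp add: und_eq_lev(1))
  then show "Comp D (Idn D (onOb (\<X> X) A)) (\<eta> X A) = Comp D (\<eta> X A) (Cone_diagram_map M (Idn D X) A)"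
    using idn_left[OF \<eta>_in[OF X A]] idn_right[OF \<eta>_in[OF X A]] by simp
qed

lemma cube_map_Comp:
  assumes f: "f \<in> hom D X Y" and g: "g \<in> hom D Y Z" and U: "U \<subseteq> S"
  shows "cmap (Comp D g f) U = Comp D (cmap g U) (cmap f U)"
proof (rule cube_map_unique[OF comp_in[OF f g] _ _ U])
  have X: "X \<in> Obj M" and Y: "Y \<in> Obj M" and Z: "Z \<in> Obj M"
    using und_obj[OF f] und_obj[OF g] by blast+
  show "natural P D (\<X> X) (\<X> Z) (\<lambda>U. Comp D (cmap g U) (cmap f U))"
    using natural_comp[OF is_functor_X[OF X] is_functor_X[OF Y] is_functor_X[OF Z]
        cube_map_natural[OF f] cube_map_natural[OF g]] .
  fix A assume A: "A \<in> Ob Q"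
  then have AS: "A \<subseteq> S"
    by simp
  have "Comp D (\<eta> Z A) (Comp D (Cone_diagram_map M g A) (Cone_diagram_map M f A)) =
      Comp D (Comp D (cmap g A) (cmap f A)) (\<eta> X A)"
    by (rule paste_squares[OF stage_ar[OF f] stage_ar[OF g] cube_map_in[OF f AS] cube_map_in[OF g AS]
          \<eta>_in[OF X A] \<eta>_in[OF Y A] \<eta>_in[OF Z A] cube_map_\<eta>[OF f A, symmetric] cube_map_\<eta>[OF g A, symmetric]])
  then show "Comp D (Comp D (cmap g A) (cmap f A)) (\<eta> X A) = Comp D (\<eta> Z A) (Cone_diagram_map M (Comp D g f) A)"
    unfolding stage_comp[OF f g] by (rule sym)
qed

section \<open>The double cube as a functor of two variables\<close>

abbreviation "F2 \<equiv> double_cube M S \<X> \<eta>"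

lemma F2_simps [simp]:
  "onOb (F2 X) (U, V) = onOb (\<X> (onOb (\<X> X) U)) V"
  "onAr (F2 X) ((U, U'), (V, V')) =
    Comp D (cmap (onAr (\<X> X) (U, U')) V') (onAr (\<X> (onOb (\<X> X) U)) (V, V'))"
  by (simp_all add: double_cube_def)

lemma X_Idn: "X \<in> Obj M \<Longrightarrow> U \<subseteq> S \<Longrightarrow> onAr (\<X> X) (U, U) = Idn D (onOb (\<X> X) U)"
  using is_functor.pres_idn[OF is_functor_X, of X U] by simp

lemma F2_fix_left:
  assumes X: "X \<in> Obj M" and U: "U \<subseteq> S" and V: "V \<subseteq> V'" "V' \<subseteq> S"
  shows "onAr (F2 X) ((U, U), (V, V')) = onAr (\<X> (onOb (\<X> X) U)) (V, V')"
  using idn_left[OF X_ar[OF X_ob[OF X U] V]] cube_map_Idn[OF X_ob[OF X U] V(2)] X_Idn[OF X U] by simp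

lemma F2_fix_right:
  assumes X: "X \<in> Obj M" and U: "U \<subseteq> U'" "U' \<subseteq> S" and V: "V \<subseteq> S"
  shows "onAr (F2 X) ((U, U'), (V, V)) = cmap (onAr (\<X> X) (U, U')) V"
proof -
  have "U \<subseteq> S"
    using U by blast
  then show ?thesis
    using idn_right[OF cube_map_in[OF X_ar[OF X U] V]] X_Idn[OF X_ob[OF X] V] by simp
qed

text \<open>For composition, an arrow of the outer cube must be moved past a map induced by an arrow
  of the inner cube; the square \<open>sq\<close>, naturality of \<open>cmap\<close>, does
  this.\<close>

lemma is_functor_F2:
  assumes X: "X \<in> Obj M"
  shows "is_functor (prod_cat P P) D (F2 X)"
proof -
  interpret PP: category "prod_cat P P" by (rule category_PP)
  interpret F: is_functor P D "\<X> X" by (rule is_functor_X[OF X])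
  have sub: "U \<subseteq> V \<Longrightarrow> V \<subseteq> S \<Longrightarrow> U \<subseteq> S" for U V
    by blast
  show ?thesis
  proof
    fix p assume "p \<in> Ob (prod_cat P P)"
    then obtain U V where p: "p = (U, V)" "U \<subseteq> S" "V \<subseteq> S"
      by auto
    then show "onOb (F2 X) p \<in> Ob D"
      using X_ob X by (simp add: und_eq_lev(1))
    show "onAr (F2 X) (Idn (prod_cat P P) p) = Idn D (onOb (F2 X) p)"
      using p F2_fix_left[OF X p(2) order_refl p(3)] X_Idn[OF X_ob[OF X p(2)] p(3)]
      by (simp del: F2_simps(2))
  next
    fix h p q assume h: "h \<in> hom (prod_cat P P) p q"
    obtain U V U' V' where pq: "p = (U, V)" "q = (U', V')"
      by (metis surj_pair)
    then have e: "h = ((U, U'), (V, V'))" and s: "U \<subseteq> U'" "U' \<subseteq> S" "V \<subseteq> V'" "V' \<subseteq> S"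
      using h by (auto simp: hom_prod_cat)
    show "onAr (F2 X) h \<in> hom D (onOb (F2 X) p) (onOb (F2 X) q)"
      using comp_in[OF X_ar[OF X_ob[OF X sub[OF s(1,2)]] s(3,4)] cube_map_in[OF X_ar[OF X s(1,2)] s(4)]]
      by (simp add: e pq)
  next
    fix h k p q r assume h: "h \<in> hom (prod_cat P P) p q" and k: "k \<in> hom (prod_cat P P) q r"
    obtain U V U' V' U'' V'' where pq: "p = (U, V)" "q = (U', V')" "r = (U'', V'')"
      by (metis surj_pair)
    then have e: "h = ((U, U'), (V, V'))" "k = ((U', U''), (V', V''))"
      and s: "U \<subseteq> U'" "U' \<subseteq> U''" "U'' \<subseteq> S" "V \<subseteq> V'" "V' \<subseteq> V''" "V'' \<subseteq> S"
      using h k by (auto simp: hom_prod_cat)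
    have s': "U' \<subseteq> S" "V' \<subseteq> S" "U \<subseteq> S" "V \<subseteq> S" "U \<subseteq> U''" "V \<subseteq> V''"
      using s by blast+
    have kh: "Comp (prod_cat P P) k h = ((U, U''), (V, V''))"
      by (simp add: e)
    let ?Y = "onOb (\<X> X) U" and ?Y' = "onOb (\<X> X) U'"
    have Y: "?Y \<in> Obj M" and Y': "?Y' \<in> Obj M"
      using X_ob[OF X] s' by blast+
    let ?u = "onAr (\<X> X) (U, U')" and ?u' = "onAr (\<X> X) (U', U'')"
    note u = X_ar[OF X s(1) s'(1)] and u' = X_ar[OF X s(2,3)]
    let ?v = "onAr (\<X> ?Y) (V, V')" and ?w = "onAr (\<X> ?Y) (V', V'')" and ?w' = "onAr (\<X> ?Y') (V', V'')"
    note v = X_ar[OF Y s(4) s'(2)] and w = X_ar[OF Y s(5,6)] and w' = X_ar[OF Y' s(5,6)]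
    have XU: "onAr (\<X> X) (U, U'') = Comp D ?u' ?u"
      using F.pres_comp[of "(U, U')" U U' "(U', U'')" U''] s s' by simp
    have XV: "onAr (\<X> ?Y) (V, V'') = Comp D ?w ?v"
      using is_functor.pres_comp[OF is_functor_X[OF Y], of "(V, V')" V V' "(V', V'')" V''] s s'
      by simp
    have sq: "Comp D (cmap ?u V'') ?w = Comp D ?w' (cmap ?u V')"
      using natural_sq[OF cube_map_natural[OF u], of "(V', V'')" V' V''] s by simp
    note c = cube_map_in[OF u s(6)] and c' = cube_map_in[OF u' s(6)] and c1 = cube_map_in[OF u s'(2)]
    have "onAr (F2 X) (Comp (prod_cat P P) k h) = Comp D (Comp D (cmap ?u' V'') (cmap ?u V'')) (Comp D ?w ?v)"
      using cube_map_Comp[OF u u' s(6)] by (simp add: kh XU XV)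
    also have "\<dots> = Comp D (cmap ?u' V'') (Comp D (cmap ?u V'') (Comp D ?w ?v))"
      using comp_assoc[OF comp_in[OF v w] c c'] by simp
    also have "\<dots> = Comp D (cmap ?u' V'') (Comp D ?w' (Comp D (cmap ?u V') ?v))"
      using comp_assoc[OF v w c] comp_assoc[OF v c1 w'] sq by simp
    also have "\<dots> = Comp D (Comp D (cmap ?u' V'') ?w') (Comp D (cmap ?u V') ?v)"
      using comp_assoc[OF comp_in[OF v c1] w' c'] .
    also have "\<dots> = Comp D (onAr (F2 X) k) (onAr (F2 X) h)"
      by (simp add: e)
    finally show "onAr (F2 X) (Comp (prod_cat P P) k h) = Comp D (onAr (F2 X) k) (onAr (F2 X) h)" .
  qed
qed

text \<open>The unit exhibiting \<open>F2 X\<close> as a left Kan extension of \<open>(A, B) \<mapsto> C\<^sub>B(C\<^sub>A(X))\<close>, where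
  \<open>C\<^sub>A = stage M A\<close>.\<close>

definition unit2 :: "'o \<Rightarrow> 'e set \<Rightarrow> 'e set \<Rightarrow> 'o \<times> 'o \<times> 's" where
  "unit2 X A B = Comp D (\<eta> (onOb (\<X> X) A) B) (Cone_diagram_map M (\<eta> X A) B)"

lemma unit2_in:
  assumes X: "X \<in> Obj M" and A: "A \<in> Ob Q" and B: "B \<in> Ob Q"
  shows "unit2 X A B \<in> hom D (onOb (stage M B) (onOb (stage M A) X)) (onOb (F2 X) (A, B))"
proof -
  have "A \<subseteq> S"
    using A by simp
  then show ?thesis
    unfolding unit2_def using comp_in[OF stage_ar[OF \<eta>_in[OF X A]] \<eta>_in[OF X_ob[OF X] B]] by simp
qed

text \<open>Here the object whose cube is formed varies, not the subset, and the naturality square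
  is the defining equation \<open>cube_map_\<eta>\<close>.\<close>

lemma \<eta>_natural_outer:
  assumes X: "X \<in> Obj M" and B: "B \<in> Ob Q"
  shows "natural P D (comp_fctr (stage M B) (\<X> X)) (fix_right P (F2 X) B) (\<lambda>U. \<eta> (onOb (\<X> X) U) B)"
proof (rule naturalI)
  show "\<eta> (onOb (\<X> X) U) B \<in> hom D (onOb (comp_fctr (stage M B) (\<X> X)) U) (onOb (fix_right P (F2 X) B) U)"
    if "U \<in> Ob P" for U
    using \<eta>_in[OF X_ob[OF X] B] that by simp
  fix U U' u assume "u \<in> hom P U U'"
  then have u: "u = (U, U')" "U \<subseteq> U'" "U' \<subseteq> S"
    by simp_all
  have BS: "B \<subseteq> S"
    using B by simp
  show "Comp D (\<eta> (onOb (\<X> X) U') B) (onAr (comp_fctr (stage M B) (\<X> X)) u) =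
      Comp D (onAr (fix_right P (F2 X) B) u) (\<eta> (onOb (\<X> X) U) B)"
    using cube_map_\<eta>[OF X_ar[OF X u(2,3)] B] F2_fix_right[OF X u(2,3) BS] u(1) by (simp del: F2_simps)
qed

text \<open>The source (A, B) -> \<open>C_B(C_A(X))\<close> is not packed into a functor on pairs.
  In the variable \<open>A\<close> it is \<open>stage M B\<close> after the cone diagram of
  \<open>X\<close>; in the variable \<open>B\<close>, in the next lemma, it is the cone diagram of
  \<open>stage M A\<close> applied to \<open>X\<close>.\<close>

lemma unit2_natural_left:
  assumes X: "X \<in> Obj M" and B: "B \<in> Ob Q"
  shows "natural Q D (comp_fctr (stage M B) (Cone_diagram M X)) (comp_fctr (fix_right P (F2 X) B) incl)
    (\<lambda>A. unit2 X A B)"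
proof -
  have BP: "B \<in> Ob P"
    using B by simp
  note i = is_functor_incl[OF X] and FX = is_functor_X[OF X] and st = is_functor_stage[of B]
  note XI = is_functor_comp[OF i FX]
  have 1: "natural Q D (comp_fctr (stage M B) (Cone_diagram M X)) (comp_fctr (stage M B) (comp_fctr (\<X> X) incl))
      (\<lambda>A. Cone_diagram_map M (\<eta> X A) B)"
    using natural_whisker_left[OF is_functor_diagram[OF X] XI st \<eta>_natural[OF X]] by simp
  have 2: "natural Q D (comp_fctr (stage M B) (comp_fctr (\<X> X) incl)) (comp_fctr (fix_right P (F2 X) B) incl)
      (\<lambda>A. \<eta> (onOb (\<X> X) A) B)"
    using natural_whisker_right[OF i \<eta>_natural_outer[OF X B]] by (simp add: natural_def)
  show ?thesis
    unfolding unit2_def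
    using natural_comp[OF is_functor_comp[OF is_functor_diagram[OF X] st] is_functor_comp[OF XI st]
        is_functor_comp[OF i is_functor_fix_right[OF category_P category_P is_functor_F2[OF X] BP]] 1 2] .
qed

lemma unit2_natural_right:
  assumes X: "X \<in> Obj M" and A: "A \<in> Ob Q"
  shows "natural Q D (Cone_diagram M (onOb (stage M A) X)) (comp_fctr (\<X> (onOb (\<X> X) A)) incl) (unit2 X A)"
proof -
  have XA: "onOb (\<X> X) A \<in> Obj M" and CA: "onOb (stage M A) X \<in> Obj M"
    using X_ob[OF X, of A] A stage_ob[OF X, of A] by simp_all
  have "natural Q D (Cone_diagram M (onOb (stage M A) X)) (comp_fctr (\<X> (onOb (\<X> X) A)) incl)
      (\<lambda>B. Comp D (\<eta> (onOb (\<X> X) A) B) (Cone_diagram_map M (\<eta> X A) B))"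
    using natural_comp[OF is_functor_diagram[OF CA] is_functor_diagram[OF XA]
        is_functor_comp[OF is_functor_incl[OF X] is_functor_X[OF XA]]
        diagram_map_natural[OF \<eta>_in[OF X A]] \<eta>_natural[OF XA]] .
  then show ?thesis
    by (simp add: unit2_def[abs_def])
qed

section \<open>The universal property of the double cube\<close>

lemma double_fix_left:
  assumes X: "X \<in> Obj M" and t: "natural (prod_cat P P) D (F2 X) G t" and U: "U \<subseteq> S"
  shows "natural P D (\<X> (onOb (\<X> X) U)) (fix_left P G U) (\<lambda>V. t (U, V))"
  using U by (intro natural_fctr_cong[OF category_P natural_fix_left[OF category_P t]])
    (auto simp: F2_fix_left[OF X] simp del: F2_simps(2))

text \<open>Uniqueness is applied twice: with \<open>U\<close> fixed, for the outer cube, which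
  reduces the second index to a small \<open>B\<close>; then with \<open>B\<close> fixed, for
  \<open>stage M B\<close> of the inner cube, which reduces the first index to a small
  \<open>A\<close>.\<close>

lemma double_unique:
  assumes X: "X \<in> Obj M" and G: "is_functor (prod_cat P P) D G"
    and \<alpha>: "natural (prod_cat P P) D (F2 X) G \<alpha>" and \<beta>: "natural (prod_cat P P) D (F2 X) G \<beta>"
    and eq: "\<And>A B. A \<in> Ob Q \<Longrightarrow> B \<in> Ob Q \<Longrightarrow> Comp D (\<alpha> (A, B)) (unit2 X A B) = Comp D (\<beta> (A, B)) (unit2 X A B)"
    and U: "U \<subseteq> S" and V: "V \<subseteq> S"
  shows "\<alpha> (U, V) = \<beta> (U, V)"
proof -
  have UP: "U \<in> Ob P" and VP: "V \<in> Ob P"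
    using U V by simp_all
  note XU = X_ob[OF X U]
  show ?thesis
  proof (rule lan_unique[OF lan_X[OF XU] is_functor_fix_left[OF category_P category_P G UP]
        double_fix_left[OF X \<alpha> U] double_fix_left[OF X \<beta> U] _ VP])
    fix B assume B: "B \<in> Ob Q"
    then have BP: "B \<in> Ob P"
      by simp
    \<comment> \<open>After composition with the outer unit the equation is again one between
      families natural in \<open>U\<close>, as the second application requires.\<close>
    let ?n = "\<lambda>t U. Comp D (t (U, B)) (\<eta> (onOb (\<X> X) U) B)"
    have nat: "natural P D (comp_fctr (stage M B) (\<X> X)) (fix_right P G B) (?n t)"
      if "natural (prod_cat P P) D (F2 X) G t" for t
      using natural_comp[OF is_functor_comp[OF is_functor_X[OF X] is_functor_stage]
          is_functor_fix_right[OF category_P category_P is_functor_F2[OF X] BP]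
          is_functor_fix_right[OF category_P category_P G BP]
          \<eta>_natural_outer[OF X B] natural_fix_right[OF category_P that BP]] .
    have "?n \<alpha> U = ?n \<beta> U"
    proof (rule lan_unique[OF lan_stage[OF X] is_functor_fix_right[OF category_P category_P G BP]
          nat[OF \<alpha>] nat[OF \<beta>] _ UP])
      fix A assume A: "A \<in> Ob Q"
      then have AP: "A \<in> Ob P" "A \<subseteq> S"
        by simp_all
      have t: "Comp D (?n t A) (Cone_diagram_map M (\<eta> X A) B) = Comp D (t (A, B)) (unit2 X A B)"
        if "natural (prod_cat P P) D (F2 X) G t" for t
        unfolding unit2_def
        using comp_assoc[OF stage_ar[OF \<eta>_in[OF X A]] \<eta>_in[OF X_ob[OF X AP(2)] B]]
          natural_in[OF that, of "(A, B)"] AP BP by simp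
      show "Comp D (?n \<alpha> (onOb incl A)) ((\<lambda>A \<in> Ob Q. Cone_diagram_map M (\<eta> X A) B) A) =
          Comp D (?n \<beta> (onOb incl A)) ((\<lambda>A \<in> Ob Q. Cone_diagram_map M (\<eta> X A) B) A)"
        unfolding restrict_apply'[OF A] inclusion_simps t[OF \<alpha>] t[OF \<beta>] by (rule eq[OF A B])
    qed
    then show "Comp D (\<alpha> (U, onOb incl B)) (\<eta> (onOb (\<X> X) U) B) = Comp D (\<beta> (U, onOb incl B)) (\<eta> (onOb (\<X> X) U) B)"
      by simp
  qed
qed

text \<open>The datum is extended one variable at a time: to \<open>\<beta>\<close>, defined for all
  \<open>U\<close> and small \<open>B\<close>, and then to \<open>\<alpha>\<close>, defined for all
  \<open>U\<close> and \<open>V\<close>. Each extension is natural in the extended variable by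
  construction; naturality in the other variable is recovered from uniqueness.\<close>

lemma double_exists:
  assumes X: "X \<in> Obj M" and G: "is_functor (prod_cat P P) D G"
    and left: "\<And>B. B \<in> Ob Q \<Longrightarrow> natural Q D (comp_fctr (stage M B) (Cone_diagram M X))
      (comp_fctr (fix_right P G B) incl) (\<lambda>A. \<gamma> A B)"
    and right: "\<And>A. A \<in> Ob Q \<Longrightarrow> natural Q D (Cone_diagram M (onOb (stage M A) X))
      (comp_fctr (fix_left P G A) incl) (\<gamma> A)"
  shows "\<exists>\<alpha>. natural (prod_cat P P) D (F2 X) G \<alpha> \<and>
    (\<forall>A \<in> Ob Q. \<forall>B \<in> Ob Q. Comp D (\<alpha> (A, B)) (unit2 X A B) = \<gamma> A B)"
proof -
  have Gr: "is_functor P D (fix_right P G B)" and Gl: "is_functor P D (fix_left P G B)" if "B \<subseteq> S" for B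
    using is_functor_fix_right[OF category_P category_P G] is_functor_fix_left[OF category_P category_P G] that
    by simp_all
  note CX = is_functor_comp[OF is_functor_X[OF X] is_functor_stage]
  let ?b = "\<lambda>B t. natural P D (comp_fctr (stage M B) (\<X> X)) (fix_right P G B) t \<and>
    (\<forall>A \<in> Ob Q. Comp D (t A) (Cone_diagram_map M (\<eta> X A) B) = \<gamma> A B)"
  define \<beta> where "\<beta> = (\<lambda>B. SOME t. ?b B t)"
  have "?b B (\<beta> B)" if B: "B \<in> Ob Q" for B
  proof -
    have BS: "B \<subseteq> S"
      using B by simp
    have "\<exists>t. ?b B t"
      by (rule lan_ex[OF lan_stage[OF X] Gr[OF BS] left[OF B]]) auto
    then show ?thesis
      unfolding \<beta>_def by (rule someI_ex)
  qed
  then have \<beta>: "\<And>B. B \<in> Ob Q \<Longrightarrow> natural P D (comp_fctr (stage M B) (\<X> X)) (fix_right P G B) (\<beta> B)"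
    and \<beta>\<gamma>: "\<And>A B. A \<in> Ob Q \<Longrightarrow> B \<in> Ob Q \<Longrightarrow> Comp D (\<beta> B A) (Cone_diagram_map M (\<eta> X A) B) = \<gamma> A B"
    by blast+
  have \<beta>_in: "\<beta> B U \<in> hom D (onOb (stage M B) (onOb (\<X> X) U)) (onOb G (U, B))" if "B \<in> Ob Q" "U \<subseteq> S" for B U
    using natural_in[OF \<beta>[OF that(1)], of U] that(2) by simp
  \<comment> \<open>The second extension needs \<open>\<beta>\<close> to be natural in
    \<open>B\<close>. For a fixed arrow \<open>u\<close> both sides of the square, \<open>?l\<close>
    and \<open>?r\<close>, are natural in \<open>U\<close>, so \<open>lan_unique\<close> reduces the
    claim to small \<open>U\<close>, where it is naturality of \<open>\<gamma>\<close> in its second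
    index.\<close>
  have \<beta>_right: "natural Q D (Cone_diagram M (onOb (\<X> X) U)) (comp_fctr (fix_left P G U) incl) (\<lambda>B. \<beta> B U)"
    if U: "U \<subseteq> S" for U
  proof (rule naturalI)
    show "\<beta> B U \<in> hom D (onOb (Cone_diagram M (onOb (\<X> X) U)) B) (onOb (comp_fctr (fix_left P G U) incl) B)"
      if "B \<in> Ob Q" for B
      using \<beta>_in[OF that U] by simp
    fix B B' u assume u: "u \<in> hom Q B B'"
    have BQ: "B \<in> Ob Q" "B' \<in> Ob Q"
      using category.dom_in[OF category_Q hom_Ar[OF u]] category.cod_in[OF category_Q hom_Ar[OF u]] u
      unfolding hom_def by blast+
    then have BS: "B \<subseteq> S" "B' \<subseteq> S"
      by simp_all
    have uP: "u \<in> hom P B B'"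
      using u by simp
    let ?l = "\<lambda>U. Comp D (\<beta> B' U) (onAr (Cone_diagram M (onOb (\<X> X) U)) u)"
    let ?r = "\<lambda>U. Comp D (onAr G ((U, U), u)) (\<beta> B U)"
    have d: "natural P D (comp_fctr (stage M B) (\<X> X)) (comp_fctr (stage M B') (\<X> X))
        (\<lambda>U. onAr (Cone_diagram M (onOb (\<X> X) U)) u)"
      using natural_whisker_right[OF is_functor_X[OF X] diagram_ar_natural[OF u]] .
    have l: "natural P D (comp_fctr (stage M B) (\<X> X)) (fix_right P G B') ?l"
      using natural_comp[OF CX CX Gr[OF BS(2)] d \<beta>[OF BQ(2)]] .
    have g: "natural P D (fix_right P G B) (fix_right P G B') (\<lambda>U. onAr G ((U, U), u))"
      using natural_arrow_right[OF category_P category_P G uP] by simp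
    have r: "natural P D (comp_fctr (stage M B) (\<X> X)) (fix_right P G B') ?r"
      using natural_comp[OF CX Gr[OF BS(1)] Gr[OF BS(2)] \<beta>[OF BQ(1)] g] .
    have "?l U = ?r U"
    proof (rule lan_unique[OF lan_stage[OF X] Gr[OF BS(2)] l r])
      fix A assume A: "A \<in> Ob Q"
      then have AS: "A \<subseteq> S"
        by simp
      note eA = \<eta>_in[OF X A]
      let ?d = "\<lambda>Y. onAr (Cone_diagram M Y) u"
      have d_in: "?d Y \<in> hom D (onOb (stage M B) Y) (onOb (stage M B') Y)" if "Y \<in> Obj M" for Y
        using natural_in[OF diagram_ar_natural[OF u], of Y] that by (simp only: und_eq_lev(1))
      have g_in: "onAr G ((A, A), u) \<in> hom D (onOb G (A, B)) (onOb G (A, B'))"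
        using natural_in[OF g, of A] AS by simp
      have "Comp D (?l A) (Cone_diagram_map M (\<eta> X A) B) =
          Comp D (\<beta> B' A) (Comp D (?d (onOb (\<X> X) A)) (Cone_diagram_map M (\<eta> X A) B))"
        using comp_assoc[OF stage_ar[OF eA] d_in[OF X_ob[OF X AS]] \<beta>_in[OF BQ(2) AS]] by simp
      also have "\<dots> = Comp D (\<beta> B' A) (Comp D (Cone_diagram_map M (\<eta> X A) B') (?d (onOb (stage M A) X)))"
        using natural_sq[OF diagram_ar_natural[OF u] eA] by (simp only: stage_simps(2))
      also have "\<dots> = Comp D (\<gamma> A B') (?d (onOb (stage M A) X))"
        using comp_assoc[OF d_in[OF stage_ob[OF X]] stage_ar[OF eA] \<beta>_in[OF BQ(2) AS]] \<beta>\<gamma>[OF A BQ(2)]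
        by simp
      also have "\<dots> = Comp D (onAr G ((A, A), u)) (\<gamma> A B)"
        using natural_sq[OF right[OF A] u] by simp
      also have "\<dots> = Comp D (?r A) (Cone_diagram_map M (\<eta> X A) B)"
        using comp_assoc[OF stage_ar[OF eA] \<beta>_in[OF BQ(1) AS] g_in] \<beta>\<gamma>[OF A BQ(1)] by simp
      finally show "Comp D (?l (onOb incl A)) ((\<lambda>A \<in> Ob Q. Cone_diagram_map M (\<eta> X A) B) A) =
          Comp D (?r (onOb incl A)) ((\<lambda>A \<in> Ob Q. Cone_diagram_map M (\<eta> X A) B) A)"
        unfolding restrict_apply'[OF A] inclusion_simps .
    qed (use U in simp)
    then show "Comp D (\<beta> B' U) (onAr (Cone_diagram M (onOb (\<X> X) U)) u) =
        Comp D (onAr (comp_fctr (fix_left P G U) incl) u) (\<beta> B U)"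
      by simp
  qed
  let ?a = "\<lambda>U t. natural P D (\<X> (onOb (\<X> X) U)) (fix_left P G U) t \<and>
    (\<forall>B \<in> Ob Q. Comp D (t B) (\<eta> (onOb (\<X> X) U) B) = \<beta> B U)"
  define \<alpha> where "\<alpha> = (\<lambda>U. SOME t. ?a U t)"
  have "?a U (\<alpha> U)" if U: "U \<subseteq> S" for U
  proof -
    have "\<exists>t. ?a U t"
      by (rule lan_ex[OF lan_X[OF X_ob[OF X U]] Gl[OF U] \<beta>_right[OF U]]) auto
    then show ?thesis
      unfolding \<alpha>_def by (rule someI_ex)
  qed
  then have \<alpha>: "\<And>U. U \<subseteq> S \<Longrightarrow> natural P D (\<X> (onOb (\<X> X) U)) (fix_left P G U) (\<alpha> U)"
    and \<alpha>\<beta>: "\<And>U B. U \<subseteq> S \<Longrightarrow> B \<in> Ob Q \<Longrightarrow> Comp D (\<alpha> U B) (\<eta> (onOb (\<X> X) U) B) = \<beta> B U"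
    by blast+
  have \<alpha>_in: "\<alpha> U V \<in> hom D (onOb (\<X> (onOb (\<X> X) U)) V) (onOb G (U, V))" if "U \<subseteq> S" "V \<subseteq> S" for U V
    using natural_in[OF \<alpha>[OF that(1)], of V] that(2) by simp
  \<comment> \<open>Naturality of \<open>\<alpha>\<close> in the first variable: both sides are
    natural in \<open>V\<close>, and after the outer unit they agree because
    \<open>\<beta> B\<close> is natural in \<open>U\<close>.\<close>
  have sq: "Comp D (\<alpha> U' V) (cmap (onAr (\<X> X) (U, U')) V) = Comp D (onAr G ((U, U'), (V, V))) (\<alpha> U V)"
    if U: "U \<subseteq> U'" "U' \<subseteq> S" and V: "V \<subseteq> S" for U U' V
  proof -
    have US: "U \<subseteq> S"
      using U by blast
    have uP: "(U, U') \<in> hom P U U'"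
      using U by simp
    note XU = X_ob[OF X US] and XU' = X_ob[OF X U(2)]
    note u = X_ar[OF X U]
    have l: "natural P D (\<X> (onOb (\<X> X) U)) (fix_left P G U') (\<lambda>V. Comp D (\<alpha> U' V) (cmap (onAr (\<X> X) (U, U')) V))"
      using natural_comp[OF is_functor_X[OF XU] is_functor_X[OF XU'] Gl[OF U(2)]
          cube_map_natural[OF u] \<alpha>[OF U(2)]] .
    have g: "natural P D (fix_left P G U) (fix_left P G U') (\<lambda>V. onAr G ((U, U'), (V, V)))"
      using natural_arrow_left[OF category_P category_P G uP] by simp
    have r: "natural P D (\<X> (onOb (\<X> X) U)) (fix_left P G U') (\<lambda>V. Comp D (onAr G ((U, U'), (V, V))) (\<alpha> U V))"
      using natural_comp[OF is_functor_X[OF XU] Gl[OF US] Gl[OF U(2)] \<alpha>[OF US] g] .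
    show ?thesis
    proof (rule lan_unique[OF lan_X[OF XU] Gl[OF U(2)] l r])
      fix B assume B: "B \<in> Ob Q"
      then have BS: "B \<subseteq> S"
        by simp
      have g_in: "onAr G ((U, U'), (B, B)) \<in> hom D (onOb G (U, B)) (onOb G (U', B))"
        using natural_in[OF g, of B] BS by simp
      have "Comp D (Comp D (\<alpha> U' B) (cmap (onAr (\<X> X) (U, U')) B)) (\<eta> (onOb (\<X> X) U) B) =
          Comp D (\<alpha> U' B) (Comp D (\<eta> (onOb (\<X> X) U') B) (Cone_diagram_map M (onAr (\<X> X) (U, U')) B))"
        using comp_assoc[OF \<eta>_in[OF XU B] cube_map_in[OF u BS] \<alpha>_in[OF U(2) BS]] cube_map_\<eta>[OF u B] by simp
      also have "\<dots> = Comp D (\<beta> B U') (Cone_diagram_map M (onAr (\<X> X) (U, U')) B)"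
        using comp_assoc[OF stage_ar[OF u] \<eta>_in[OF XU' B] \<alpha>_in[OF U(2) BS]] \<alpha>\<beta>[OF U(2) B] by simp
      also have "\<dots> = Comp D (onAr G ((U, U'), (B, B))) (\<beta> B U)"
        using natural_sq[OF \<beta>[OF B] uP] by simp
      also have "\<dots> = Comp D (Comp D (onAr G ((U, U'), (B, B))) (\<alpha> U B)) (\<eta> (onOb (\<X> X) U) B)"
        using comp_assoc[OF \<eta>_in[OF XU B] \<alpha>_in[OF US BS] g_in] \<alpha>\<beta>[OF US B] by simp
      finally show "Comp D (Comp D (\<alpha> U' (onOb incl B)) (cmap (onAr (\<X> X) (U, U')) (onOb incl B))) (\<eta> (onOb (\<X> X) U) B) =
          Comp D (Comp D (onAr G ((U, U'), (onOb incl B, onOb incl B))) (\<alpha> U (onOb incl B))) (\<eta> (onOb (\<X> X) U) B)"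
        unfolding inclusion_simps .
    qed (use V in simp)
  qed
  have "natural (prod_cat P P) D (F2 X) G (\<lambda>(U, V). \<alpha> U V)"
  proof (rule natural_prodI[OF category_P category_P is_functor_F2[OF X] G])
    fix U assume "U \<in> Ob P"
    then have U: "U \<subseteq> S"
      by simp
    have "natural P D (fix_left P (F2 X) U) (fix_left P G U) (\<alpha> U)"
      using U by (intro natural_fctr_cong[OF category_P \<alpha>[OF U]])
        (auto simp: F2_fix_left[OF X] simp del: F2_simps(2))
    then show "natural P D (fix_left P (F2 X) U) (fix_left P G U) (\<lambda>V. case (U, V) of (U, V) \<Rightarrow> \<alpha> U V)"
      by simp
  next
    fix V assume "V \<in> Ob P"
    then have V: "V \<subseteq> S"
      by simp
    show "natural P D (fix_right P (F2 X) V) (fix_right P G V) (\<lambda>U. case (U, V) of (U, V) \<Rightarrow> \<alpha> U V)"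
    proof (rule naturalI)
      show "(case (U, V) of (U, V) \<Rightarrow> \<alpha> U V) \<in> hom D (onOb (fix_right P (F2 X) V) U) (onOb (fix_right P G V) U)"
        if "U \<in> Ob P" for U
        using \<alpha>_in[OF _ V] that by simp
      fix U U' u assume "u \<in> hom P U U'"
      then have u: "u = (U, U')" "U \<subseteq> U'" "U' \<subseteq> S"
        by simp_all
      show "Comp D (case (U', V) of (U, V) \<Rightarrow> \<alpha> U V) (onAr (fix_right P (F2 X) V) u) =
          Comp D (onAr (fix_right P G V) u) (case (U, V) of (U, V) \<Rightarrow> \<alpha> U V)"
        using sq[OF u(2,3) V] F2_fix_right[OF X u(2,3) V] by (simp add: u(1) del: F2_simps(2))
    qed
  qed
  moreover have "Comp D (\<alpha> A B) (unit2 X A B) = \<gamma> A B" if A: "A \<in> Ob Q" and B: "B \<in> Ob Q" for A B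
  proof -
    have AS: "A \<subseteq> S" and BS: "B \<subseteq> S"
      using A B by simp_all
    show ?thesis
      unfolding unit2_def
      using comp_assoc[OF stage_ar[OF \<eta>_in[OF X A]] \<eta>_in[OF X_ob[OF X AS] B] \<alpha>_in[OF AS BS]]
        \<alpha>\<beta>[OF AS B] \<beta>\<gamma>[OF A B] by simp
  qed
  ultimately show ?thesis
    by (intro exI[of _ "\<lambda>(U, V). \<alpha> U V"]) simp
qed

end

section \<open>Exchanging the two variables\<close>

context cubes
begin

text \<open>If one of the subsets is empty, both orders of applying the stages give the same object.
  The symmetry of the cone is needed only when both are nonempty.\<close>

definition twist :: "'o \<Rightarrow> 'e set \<Rightarrow> 'e set \<Rightarrow> 'o \<times> 'o \<times> 's" where
  "twist X A B = (if A = {} \<or> B = {} then Idn D (onOb (stage M B) (onOb (stage M A) X)) else flip M X)"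

lemma Idn_in: "X \<in> Obj M \<Longrightarrow> Idn D X \<in> hom D X X"
  using idn_in by (simp add: und_eq_lev(1))

lemma twist_in:
  assumes X: "X \<in> Obj M"
  shows "twist X A B \<in> hom D (onOb (stage M B) (onOb (stage M A) X)) (onOb (stage M A) (onOb (stage M B) X))"
  using Idn_in[OF X] Idn_in[OF Cone_obj[OF X]] flip_in[OF X] by (auto simp: twist_def)

lemma twist_twist:
  assumes X: "X \<in> Obj M"
  shows "Comp D (twist X B A) (twist X A B) = Idn D (onOb (stage M B) (onOb (stage M A) X))"
  using idn_left[OF Idn_in[OF X]] idn_left[OF Idn_in[OF Cone_obj[OF X]]] flip_flip[OF X]
  by (auto simp: twist_def)

lemma twist_natural:
  assumes f: "f \<in> hom D X Y"
  shows "Comp D (twist Y A B) (Cone_diagram_map M (Cone_diagram_map M f A) B) =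
    Comp D (Cone_diagram_map M (Cone_diagram_map M f B) A) (twist X A B)"
  using idn_left[OF f] idn_right[OF f] idn_left[OF Cone_map_in[OF f]] idn_right[OF Cone_map_in[OF f]]
    flip_natural[OF f]
  by (auto simp: twist_def Cone_diagram_map_def)

text \<open>Apart from identities, \<open>u\<close> starts at the empty set. If \<open>B\<close> is
  nonempty as well, the two equations are \<open>flip_Cone_map_incl\<close> and
  \<open>flip_incl_Cone\<close>; all other cases are identity laws.\<close>

lemma twist_square:
  assumes X: "X \<in> Obj M" and u: "u \<in> hom Q A A'"
  shows "Comp D (twist X A' B) (Cone_diagram_map M (onAr (Cone_diagram M X) u) B) =
      Comp D (onAr (Cone_diagram M (onOb (stage M B) X)) u) (twist X A B)"
    and "Comp D (twist X B A') (onAr (Cone_diagram M (onOb (stage M B) X)) u) =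
      Comp D (Cone_diagram_map M (onAr (Cone_diagram M X) u) B) (twist X B A)"
proof -
  note CX = Cone_obj[OF X]
  note i = Idn_in[OF X] and iC = Idn_in[OF CX] and iCC = Idn_in[OF Cone_obj[OF CX]]
  note c = Cone_incl_in[OF X] and fl = flip_in[OF X]
  note s = Cone_diagram_def Cone_diagram_map_def twist_def Cone_map_Idn[OF X] Cone_map_Idn[OF CX]
    idn_left[OF i] idn_left[OF iC] idn_left[OF iCC] idn_left[OF fl] idn_right[OF fl]
    idn_left[OF c] idn_right[OF c] idn_right[OF Cone_incl_in[OF CX]] idn_right[OF Cone_map_in[OF c]]
    flip_Cone_map_incl[OF X] flip_incl_Cone[OF X]
  have "u = (A, A')"
    using u by simp
  moreover from u have "A = A' \<or> (A = {} \<and> A' \<noteq> {})"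
    by (rule Q_empty_or_eq)
  ultimately show "Comp D (twist X A' B) (Cone_diagram_map M (onAr (Cone_diagram M X) u) B) =
      Comp D (onAr (Cone_diagram M (onOb (stage M B) X)) u) (twist X A B)"
    "Comp D (twist X B A') (onAr (Cone_diagram M (onOb (stage M B) X)) u) =
      Comp D (Cone_diagram_map M (onAr (Cone_diagram M X) u) B) (twist X B A)"
    by (auto simp: s)
qed

lemma twist_natural_left:
  assumes X: "X \<in> Obj M"
  shows "natural Q D (comp_fctr (stage M B) (Cone_diagram M X)) (Cone_diagram M (onOb (stage M B) X)) (\<lambda>A. twist X A B)"
proof (rule naturalI)
  show "twist X A B \<in> hom D (onOb (comp_fctr (stage M B) (Cone_diagram M X)) A) (onOb (Cone_diagram M (onOb (stage M B) X)) A)" for A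
    using twist_in[OF X, of A B] by simp
  show "Comp D (twist X A' B) (onAr (comp_fctr (stage M B) (Cone_diagram M X)) u) =
      Comp D (onAr (Cone_diagram M (onOb (stage M B) X)) u) (twist X A B)" if "u \<in> hom Q A A'" for A A' u
    using twist_square(1)[OF X that, of B] by simp
qed

lemma twist_natural_right:
  assumes X: "X \<in> Obj M"
  shows "natural Q D (Cone_diagram M (onOb (stage M A) X)) (comp_fctr (stage M A) (Cone_diagram M X)) (twist X A)"
proof (rule naturalI)
  show "twist X A B \<in> hom D (onOb (Cone_diagram M (onOb (stage M A) X)) B) (onOb (comp_fctr (stage M A) (Cone_diagram M X)) B)" for B
    using twist_in[OF X, of A B] by simp
  show "Comp D (twist X A B') (onAr (Cone_diagram M (onOb (stage M A) X)) u) =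
      Comp D (onAr (comp_fctr (stage M A) (Cone_diagram M X)) u) (twist X A B)" if "u \<in> hom Q B B'" for B B' u
    using twist_square(2)[OF X that, of A] by simp
qed

lemma is_functor_F2_swap: "X \<in> Obj M \<Longrightarrow> is_functor (prod_cat P P) D (comp_fctr (F2 X) swap_functor)"
  using is_functor_comp[OF is_functor_swap[OF category_P category_P] is_functor_F2] .

text \<open>This is \<open>double_exists\<close> with the transposed double cube as target and the
  datum "twist, then the unit at the transposed pair". Transposition exchanges the roles of the
  variables, so each naturality hypothesis combines a twist lemma with the unit lemma of the
  opposite side.\<close>

lemma swap_exists:
  assumes X: "X \<in> Obj M"
  shows "\<exists>t. natural (prod_cat P P) D (F2 X) (comp_fctr (F2 X) swap_functor) t \<and>
    (\<forall>A \<in> Ob Q. \<forall>B \<in> Ob Q. Comp D (t (A, B)) (unit2 X A B) = Comp D (unit2 X B A) (twist X A B))"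
proof (rule double_exists[OF X is_functor_F2_swap[OF X]])
  let ?G = "comp_fctr (F2 X) swap_functor"
  note i = is_functor_incl[OF X]
  note CD = is_functor_comp[OF is_functor_diagram[OF X] is_functor_stage]
  fix A assume A: "A \<in> Ob Q"
  then have AP: "A \<in> Ob P" "A \<subseteq> S"
    by simp_all
  note XA = X_ob[OF X AP(2)] and CA = stage_ob[OF X]
  have "natural Q D (comp_fctr (stage M A) (Cone_diagram M X)) (comp_fctr (\<X> (onOb (\<X> X) A)) incl)
      (\<lambda>B. Comp D (unit2 X A B) (twist X B A))"
    using natural_comp[OF CD is_functor_diagram[OF CA] is_functor_comp[OF i is_functor_X[OF XA]]
        twist_natural_left[OF X] unit2_natural_right[OF X A]] .
  then show "natural Q D (comp_fctr (stage M A) (Cone_diagram M X)) (comp_fctr (fix_right P ?G A) incl)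
      (\<lambda>B. Comp D (unit2 X A B) (twist X B A))"
    by (rule natural_fctr_cong[OF category_Q])
      (use AP F2_fix_left[OF X AP(2)] in \<open>auto simp del: F2_simps(2)\<close>)
  have "natural Q D (Cone_diagram M (onOb (stage M A) X)) (comp_fctr (fix_right P (F2 X) A) incl)
      (\<lambda>B. Comp D (unit2 X B A) (twist X A B))"
    using natural_comp[OF is_functor_diagram[OF CA] CD
        is_functor_comp[OF i is_functor_fix_right[OF category_P category_P is_functor_F2[OF X] AP(1)]]
        twist_natural_right[OF X] unit2_natural_left[OF X A]] .
  then show "natural Q D (Cone_diagram M (onOb (stage M A) X)) (comp_fctr (fix_left P ?G A) incl)
      (\<lambda>B. Comp D (unit2 X B A) (twist X A B))"
    by (simp add: natural_def)
qed

section \<open>The exchange map, its inverse and its naturality in the object\<close>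

definition swap_iso :: "'o \<Rightarrow> 'e set \<times> 'e set \<Rightarrow> 'o \<times> 'o \<times> 's" where
  "swap_iso X = (SOME t. natural (prod_cat P P) D (F2 X) (comp_fctr (F2 X) swap_functor) t \<and>
    (\<forall>A \<in> Ob Q. \<forall>B \<in> Ob Q. Comp D (t (A, B)) (unit2 X A B) = Comp D (unit2 X B A) (twist X A B)))"

lemma swap_iso:
  assumes X: "X \<in> Obj M"
  shows swap_iso_natural: "natural (prod_cat P P) D (F2 X) (comp_fctr (F2 X) swap_functor) (swap_iso X)"
    and swap_iso_unit2: "A \<in> Ob Q \<Longrightarrow> B \<in> Ob Q \<Longrightarrow>
      Comp D (swap_iso X (A, B)) (unit2 X A B) = Comp D (unit2 X B A) (twist X A B)"
  using someI_ex[OF swap_exists[OF X], folded swap_iso_def] by blast+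

lemma swap_iso_in:
  assumes "X \<in> Obj M" "U \<subseteq> S" "V \<subseteq> S"
  shows "swap_iso X (U, V) \<in> hom D (onOb (F2 X) (U, V)) (onOb (F2 X) (V, U))"
  using natural_in[OF swap_iso_natural[OF assms(1)], of "(U, V)"] assms(2,3) by simp

lemma natural_swap:
  assumes t: "natural (prod_cat P P) D F G t"
  shows "natural (prod_cat P P) D (comp_fctr F swap_functor) (comp_fctr G swap_functor) (\<lambda>p. t (prod.swap p))"
  by (rule natural_fctr_cong[OF category_PP natural_cong[OF category_PP
          natural_whisker_right[OF is_functor_swap[OF category_P category_P] t]]])
    (auto simp: swap_functor_def)

text \<open>The composite is an endomorphism of the double cube. On units it acts by two twists,
  which cancel, so \<open>double_unique\<close> identifies it with the identity.\<close>

lemma swap_iso_inverse: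
  assumes X: "X \<in> Obj M" and U: "U \<subseteq> S" and V: "V \<subseteq> S"
  shows "Comp D (swap_iso X (V, U)) (swap_iso X (U, V)) = Idn D (onOb (F2 X) (U, V))"
proof -
  let ?G = "comp_fctr (F2 X) swap_functor"
  interpret F: is_functor "prod_cat P P" D "F2 X" by (rule is_functor_F2[OF X])
  note sw = swap_iso_natural[OF X]
  have "natural (prod_cat P P) D ?G (F2 X) (\<lambda>p. swap_iso X (prod.swap p))"
    by (rule natural_fctr_cong[OF category_PP natural_swap[OF sw]]) (auto simp: swap_functor_def)
  then have 1: "natural (prod_cat P P) D (F2 X) (F2 X) (\<lambda>p. Comp D (swap_iso X (prod.swap p)) (swap_iso X p))"
    by (rule natural_comp[OF is_functor_F2[OF X] is_functor_F2_swap[OF X] is_functor_F2[OF X] sw])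
  have 2: "natural (prod_cat P P) D (F2 X) (F2 X) (\<lambda>p. Idn D (onOb (F2 X) p))"
  proof (rule naturalI)
    show "Idn D (onOb (F2 X) p) \<in> hom D (onOb (F2 X) p) (onOb (F2 X) p)" if "p \<in> Ob (prod_cat P P)" for p
      using idn_in[OF F.ob_in[OF that]] .
    show "Comp D (Idn D (onOb (F2 X) q)) (onAr (F2 X) h) = Comp D (onAr (F2 X) h) (Idn D (onOb (F2 X) p))"
      if "h \<in> hom (prod_cat P P) p q" for p q h
      using idn_left[OF F.ar_in[OF that]] idn_right[OF F.ar_in[OF that]] by simp
  qed
  have "Comp D (swap_iso X (prod.swap (U, V))) (swap_iso X (U, V)) = Idn D (onOb (F2 X) (U, V))"
  proof (rule double_unique[OF X is_functor_F2[OF X] 1 2 _ U V])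
    fix A B assume A: "A \<in> Ob Q" and B: "B \<in> Ob Q"
    then have AS: "A \<subseteq> S" and BS: "B \<subseteq> S"
      by simp_all
    note sAB = swap_iso_in[OF X AS BS] and sBA = swap_iso_in[OF X BS AS]
    note uAB = unit2_in[OF X A B] and uBA = unit2_in[OF X B A]
    note tAB = twist_in[OF X, of A B] and tBA = twist_in[OF X, of B A]
    have "Comp D (Comp D (swap_iso X (B, A)) (swap_iso X (A, B))) (unit2 X A B) =
        Comp D (swap_iso X (B, A)) (Comp D (unit2 X B A) (twist X A B))"
      using comp_assoc[OF uAB sAB sBA] swap_iso_unit2[OF X A B] by simp
    also have "\<dots> = Comp D (Comp D (unit2 X A B) (twist X B A)) (twist X A B)"
      using comp_assoc[OF tAB uBA sBA] swap_iso_unit2[OF X B A] by simp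
    also have "\<dots> = unit2 X A B"
      unfolding comp_assoc[OF tAB tBA uAB, symmetric] twist_twist[OF X] by (rule idn_right[OF uAB])
    also have "\<dots> = Comp D (Idn D (onOb (F2 X) (A, B))) (unit2 X A B)"
      by (rule idn_left[OF uAB, symmetric])
    finally show "Comp D (Comp D (swap_iso X (prod.swap (A, B))) (swap_iso X (A, B))) (unit2 X A B) =
        Comp D (Idn D (onOb (F2 X) (A, B))) (unit2 X A B)"
      by (simp only: swap_simp)
  qed
  then show ?thesis
    by (simp only: swap_simp)
qed

text \<open>The inverse is the same family at the transposed pair, so both inverse laws are
  instances of \<open>swap_iso_inverse\<close>.\<close>

lemma swap_iso_is_iso:
  assumes X: "X \<in> Obj M" and U: "U \<subseteq> S" and V: "V \<subseteq> S"
  shows "is_iso D (swap_iso X (U, V))"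
proof -
  note s = swap_iso_in[OF X U V] and s' = swap_iso_in[OF X V U]
  show ?thesis
    unfolding is_iso_def und_Dom_Cod[OF s]
    using hom_Ar[OF s] s' swap_iso_inverse[OF X U V] swap_iso_inverse[OF X V U] by blast
qed

abbreviation "dmap \<equiv> double_cube_map M S \<X> \<eta>"

lemma dmap_simp: "dmap f (U, V) = cmap (cmap f U) V"
  by (simp add: double_cube_map_def)

text \<open>In the second variable this is naturality of \<open>cmap\<close> for the arrow
  \<open>cmap f U\<close>. In the first, the naturality square of \<open>cmap f\<close> is carried
  over by functoriality of the outer cube, \<open>cube_map_Comp\<close>.\<close>

lemma dmap_natural:
  assumes f: "f \<in> hom D X Y"
  shows "natural (prod_cat P P) D (F2 X) (F2 Y) (dmap f)"
proof (rule natural_prodI[OF category_P category_P is_functor_F2 is_functor_F2])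
  show X: "X \<in> Obj M" and Y: "Y \<in> Obj M"
    using und_obj[OF f] by blast+
  fix U assume "U \<in> Ob P"
  then have U: "U \<subseteq> S"
    by simp
  have "natural P D (fix_left P (F2 X) U) (fix_left P (F2 Y) U) (cmap (cmap f U))"
    by (rule natural_fctr_cong[OF category_P cube_map_natural[OF cube_map_in[OF f U]]])
      (use U F2_fix_left[OF X U] F2_fix_left[OF Y U] in \<open>auto simp del: F2_simps(2)\<close>)
  then show "natural P D (fix_left P (F2 X) U) (fix_left P (F2 Y) U) (\<lambda>V. dmap f (U, V))"
    by (simp add: dmap_simp)
  show "natural P D (fix_right P (F2 X) U) (fix_right P (F2 Y) U) (\<lambda>V. dmap f (V, U))"
  proof (rule naturalI)
    show "dmap f (V, U) \<in> hom D (onOb (fix_right P (F2 X) U) V) (onOb (fix_right P (F2 Y) U) V)"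
      if "V \<in> Ob P" for V
      using cube_map_in[OF cube_map_in[OF f] U] that by (simp add: dmap_simp)
    fix V V' v assume vP: "v \<in> hom P V V'"
    then have v: "v = (V, V')" "V \<subseteq> V'" "V' \<subseteq> S" and VS: "V \<subseteq> S"
      by auto
    have "Comp D (cmap f V') (onAr (\<X> X) (V, V')) = Comp D (onAr (\<X> Y) (V, V')) (cmap f V)"
      using natural_sq[OF cube_map_natural[OF f] vP] v by simp
    then have "Comp D (cmap (cmap f V') U) (cmap (onAr (\<X> X) (V, V')) U) =
        Comp D (cmap (onAr (\<X> Y) (V, V')) U) (cmap (cmap f V) U)"
      using cube_map_Comp[OF X_ar[OF X v(2,3)] cube_map_in[OF f v(3)] U]
        cube_map_Comp[OF cube_map_in[OF f VS] X_ar[OF Y v(2,3)] U] by simp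
    then show "Comp D (dmap f (V', U)) (onAr (fix_right P (F2 X) U) v) =
        Comp D (onAr (fix_right P (F2 Y) U) v) (dmap f (V, U))"
      using F2_fix_right[OF X v(2,3) U] F2_fix_right[OF Y v(2,3) U] by (simp add: v(1) dmap_simp del: F2_simps(2))
  qed
qed

lemma dmap_in:
  assumes "f \<in> hom D X Y" "U \<subseteq> S" "V \<subseteq> S"
  shows "dmap f (U, V) \<in> hom D (onOb (F2 X) (U, V)) (onOb (F2 Y) (U, V))"
  using natural_in[OF dmap_natural[OF assms(1)], of "(U, V)"] assms(2,3) by simp

text \<open>Two squares are pasted: \<open>stage M B\<close> of the unit square for the inner cube,
  and the unit square for the outer cube of the arrow \<open>cmap f A\<close>.\<close>

lemma dmap_unit2:
  assumes f: "f \<in> hom D X Y" and A: "A \<in> Ob Q" and B: "B \<in> Ob Q"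
  shows "Comp D (dmap f (A, B)) (unit2 X A B) = Comp D (unit2 Y A B) (Cone_diagram_map M (Cone_diagram_map M f A) B)"
proof -
  have X: "X \<in> Obj M" and Y: "Y \<in> Obj M" and AS: "A \<subseteq> S" and BS: "B \<subseteq> S"
    using und_obj[OF f] A B by simp_all
  note g = cube_map_in[OF f AS] and eX = \<eta>_in[OF X A] and eY = \<eta>_in[OF Y A]
  have "Comp D (cmap (cmap f A) B) (Comp D (\<eta> (onOb (\<X> X) A) B) (Cone_diagram_map M (\<eta> X A) B)) =
      Comp D (Comp D (\<eta> (onOb (\<X> Y) A) B) (Cone_diagram_map M (\<eta> Y A) B)) (Cone_diagram_map M (Cone_diagram_map M f A) B)"
  proof (rule paste_squares[OF stage_ar[OF eX] \<eta>_in[OF X_ob[OF X AS] B] stage_ar[OF eY] \<eta>_in[OF X_ob[OF Y AS] B]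
        stage_ar[OF stage_ar[OF f]] stage_ar[OF g] cube_map_in[OF g BS]])
    show "Comp D (Cone_diagram_map M (cmap f A) B) (Cone_diagram_map M (\<eta> X A) B) =
        Comp D (Cone_diagram_map M (\<eta> Y A) B) (Cone_diagram_map M (Cone_diagram_map M f A) B)"
      unfolding stage_comp[OF eX g, symmetric] stage_comp[OF stage_ar[OF f] eY, symmetric] cube_map_\<eta>[OF f A] ..
  qed (rule cube_map_\<eta>[OF g B])
  then show ?thesis
    by (simp add: dmap_simp unit2_def)
qed

text \<open>Both sides are natural from the double cube of \<open>X\<close> to the transposed double
  cube of \<open>Y\<close>. By \<open>double_unique\<close> they are compared on units, where the
  equation becomes \<open>twist_natural\<close>.\<close>

lemma swap_iso_dmap:
  assumes f: "f \<in> hom D X Y" and U: "U \<subseteq> S" and V: "V \<subseteq> S"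
  shows "Comp D (swap_iso Y (U, V)) (dmap f (U, V)) = Comp D (dmap f (V, U)) (swap_iso X (U, V))"
proof -
  have X: "X \<in> Obj M" and Y: "Y \<in> Obj M"
    using und_obj[OF f] by blast+
  note d = dmap_natural[OF f]
  note FX = is_functor_F2[OF X] and FY = is_functor_F2[OF Y]
  note SX = is_functor_F2_swap[OF X] and SY = is_functor_F2_swap[OF Y]
  note 1 = natural_comp[OF FX FY SY d swap_iso_natural[OF Y]]
  note 2 = natural_comp[OF FX SX SY swap_iso_natural[OF X] natural_swap[OF d]]
  have "Comp D (swap_iso Y (U, V)) (dmap f (U, V)) = Comp D (dmap f (prod.swap (U, V))) (swap_iso X (U, V))"
  proof (rule double_unique[OF X SY 1 2 _ U V])
    fix A B assume A: "A \<in> Ob Q" and B: "B \<in> Ob Q"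
    then have AS: "A \<subseteq> S" and BS: "B \<subseteq> S"
      by simp_all
    let ?f = "Cone_diagram_map M (Cone_diagram_map M f A) B" and ?f' = "Cone_diagram_map M (Cone_diagram_map M f B) A"
    note ff = stage_ar[OF stage_ar[OF f], of A B] and ff' = stage_ar[OF stage_ar[OF f], of B A]
    have "Comp D (Comp D (swap_iso Y (A, B)) (dmap f (A, B))) (unit2 X A B) =
        Comp D (swap_iso Y (A, B)) (Comp D (unit2 Y A B) ?f)"
      using comp_assoc[OF unit2_in[OF X A B] dmap_in[OF f AS BS] swap_iso_in[OF Y AS BS]] dmap_unit2[OF f A B]
      by simp
    also have "\<dots> = Comp D (Comp D (unit2 Y B A) (twist Y A B)) ?f"
      using comp_assoc[OF ff unit2_in[OF Y A B] swap_iso_in[OF Y AS BS]] swap_iso_unit2[OF Y A B] by simp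
    also have "\<dots> = Comp D (unit2 Y B A) (Comp D ?f' (twist X A B))"
      using comp_assoc[OF ff twist_in[OF Y] unit2_in[OF Y B A]] twist_natural[OF f] by simp
    also have "\<dots> = Comp D (dmap f (B, A)) (Comp D (unit2 X B A) (twist X A B))"
      using comp_assoc[OF twist_in[OF X] ff' unit2_in[OF Y B A]]
        comp_assoc[OF twist_in[OF X] unit2_in[OF X B A] dmap_in[OF f BS AS]] dmap_unit2[OF f B A] by simp
    also have "\<dots> = Comp D (Comp D (dmap f (B, A)) (swap_iso X (A, B))) (unit2 X A B)"
      using comp_assoc[OF unit2_in[OF X A B] swap_iso_in[OF X AS BS] dmap_in[OF f BS AS]]
        swap_iso_unit2[OF X A B] by simp
    finally show "Comp D (Comp D (swap_iso Y (A, B)) (dmap f (A, B))) (unit2 X A B) =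
        Comp D (Comp D (dmap f (prod.swap (A, B))) (swap_iso X (A, B))) (unit2 X A B)"
      by (simp only: swap_simp)
  qed
  then show ?thesis
    by (simp only: swap_simp)
qed

end

theorem proposition3p15:
  fixes M :: "('o, 's, 'u) simp_cat"
    and m :: "('o \<times> 'o \<times> 's) model"
    and S :: "'e set"
    and \<X> :: "'o \<Rightarrow> ('e set, 'e set \<times> 'e set, 'o, 'o \<times> 'o \<times> 's) fctr"
    and \<eta> :: "'o \<Rightarrow> 'e set \<Rightarrow> 'o \<times> 'o \<times> 's"
  assumes "ps_cg_model_category M m \<or>
      (\<exists>m0. ps_cg_model_category M m0 \<and> left_Bousfield_localization TYPE('u) (und M) m0 m)"
    and "finite S"
    and "is_cube M S \<X> \<eta>"
  shows "\<exists>\<phi>.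
      (\<forall>X \<in> Obj M.
         nat_iso (prod_cat (subsets_cat S) (subsets_cat S)) (und M)
           (double_cube M S \<X> \<eta> X) (comp_fctr (double_cube M S \<X> \<eta> X) swap_functor) (\<phi> X)) \<and>
      (\<forall>X X'. \<forall>f \<in> hom (und M) X X'. \<forall>U \<in> Pow S. \<forall>V \<in> Pow S.
         Comp (und M) (\<phi> X' (U, V)) (double_cube_map M S \<X> \<eta> f (U, V)) =
         Comp (und M) (double_cube_map M S \<X> \<eta> f (V, U)) (\<phi> X (U, V)))"
proof -
  \<comment> \<open>A left Bousfield localization has the same underlying simplicial category and
    tensoring, so in that case the argument is run with the original structure \<open>m0\<close>;
    otherwise \<open>m0\<close> is \<open>m\<close>.\<close>
  obtain m0 where "pointed_simplicial_model_category M m0"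
    using assms(1) by (auto simp: ps_cg_model_category_def)
  then interpret cubes M m0 S \<X> \<eta>
    using assms(3) by (intro cubes.intro cubes_axioms.intro)
  let ?PP = "prod_cat (subsets_cat S) (subsets_cat S)"
  show ?thesis
  \<comment> \<open>The restriction meets the extensionality requirement of
    \<open>nat_trans\<close>.\<close>
  proof (intro exI[of _ "\<lambda>X. restrict (swap_iso X) (Ob ?PP)"] conjI ballI allI)
    fix X assume X: "X \<in> Obj M"
    show "nat_iso ?PP (und M) (double_cube M S \<X> \<eta> X) (comp_fctr (double_cube M S \<X> \<eta> X) swap_functor)
        (restrict (swap_iso X) (Ob ?PP))"
      unfolding nat_iso_def
      using natural_nat_trans[OF is_functor_F2[OF X] is_functor_F2_swap[OF X] swap_iso_natural[OF X]]
        swap_iso_is_iso[OF X] by auto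
  next
    fix X X' f U V assume "f \<in> hom (und M) X X'" "U \<in> Pow S" "V \<in> Pow S"
    then show "Comp (und M) (restrict (swap_iso X') (Ob ?PP) (U, V)) (double_cube_map M S \<X> \<eta> f (U, V)) =
        Comp (und M) (double_cube_map M S \<X> \<eta> f (V, U)) (restrict (swap_iso X) (Ob ?PP) (U, V))"
      using swap_iso_dmap by simp
  qed
qed

end
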